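(* Let $C\subset\mathbb{R}^d$ be a non-trivial closed convex cone, let $\mathbf{g}\sim\mathcal{N}(0,I_d)$, and let $$F=\|\boldsymbol{\mu}-\Pi_C(\mathbf{g}+\boldsymbol{\mu})\|^2-m,\quad\text{with}\quad m=E[\|\boldsymbol{\mu}-\Pi_C(\mathbf{g}+\boldsymbol{\mu})\|^2]\quad\text{and}\quad\sigma^2=\mathrm{Var}(F).$$ Let $N\sim\mathcal{N}(0,\sigma^2)$. Then for every $\boldsymbol{\mu}\in\mathbb{R}^d$, $$d_{TV}(F,N)\le\frac{16}{\sigma^2}\left\{\sqrt{E\|\Pi_C(\mathbf{g}+\boldsymbol{\mu})\|^2}+2\sqrt{m}\,\|\boldsymbol{\mu}\|+3\|\boldsymbol{\mu}\|^2\right\}\le\frac{16}{\sigma^2}\left\{\sqrt{m}\,(1+2\|\boldsymbol{\mu}\|)+3\|\boldsymbol{\mu}\|^2+\|\boldsymbol{\mu}\|\right\}.$$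
   Context: A set $C\subset\mathbb{R}^d$ is a convex cone if $a\mathbf{x}+b\mathbf{y}\in C$ whenever $\mathbf{x},\mathbf{y}\in C$ and $a,b$ are positive reals. A set $C$ is called non-trivial if $\emptyset\subsetneq C\subsetneq\mathbb{R}^d$. $\|\cdot\|$ is the Euclidean norm, and $\Pi_C(\mathbf{x})$ is the metric projection of $\mathbf{x}$ onto $C$ (the unique nearest point of $C$ in Euclidean norm). $\mathcal{N}(0,I_d)$ is the standard Gaussian law on $\mathbb{R}^d$. The total variation distance between the laws of two random variables $F$ and $G$ is $d_{TV}(F,G)=\sup_A|P(F\in A)-P(G\in A)|$, the supremum being over all Borel sets $A\subset\mathbb{R}$. *)

theory Defs
  imports "HOL-Probability.Probability"
begin

text \<open>Closure under positive combinations only: unlike the library's \<open>convex_cone\<close>, this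
  requires neither \<open>0 \<in> C\<close> nor \<open>C \<noteq> {}\<close>.\<close>

definition positive_convex_cone :: "'a::real_vector set \<Rightarrow> bool" where
  "positive_convex_cone C \<longleftrightarrow>
     (\<forall>x\<in>C. \<forall>y\<in>C. \<forall>a>0. \<forall>b>0. a *\<^sub>R x + b *\<^sub>R y \<in> C)"

definition std_gaussian_density :: "real ^ 'd \<Rightarrow> real" where
  "std_gaussian_density x = (\<Prod>i\<in>UNIV. std_normal_density (x $ i))"

text \<open>The second parameter is the variance, whereas \<open>normal_density\<close> takes the standard
  deviation. The law of variance 0 has no density and is the point mass at the mean.\<close>

definition normal_law :: "real \<Rightarrow> real \<Rightarrow> real measure" where
  "normal_law a v =
     (if v = 0 then return borel a
      else density lborel (\<lambda>x. ennreal (normal_density a (sqrt v) x)))"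

text \<open>The two random variables may live on different probability spaces. For probability
  spaces the supremum is over a nonempty set of reals bounded by 1.\<close>

definition tv_distance ::
  "'w measure \<Rightarrow> ('w \<Rightarrow> real) \<Rightarrow> 'v measure \<Rightarrow> ('v \<Rightarrow> real) \<Rightarrow> real" where
  "tv_distance M F M' G =
     (SUP A\<in>sets borel. \<bar>measure M {\<omega> \<in> space M. F \<omega> \<in> A}
                         - measure M' {\<omega> \<in> space M'. G \<omega> \<in> A}\<bar>)"

end

theory Submission
  imports Defs
begin

text \<open>The proof is Stein's method combined with Gaussian integration by parts, as in the Malliavin-Stein
approach, but carried out with elementary means on a Euclidean space.

Write \<open>\<Phi> x = |\<mu> - \<Pi>(x + \<mu>)|\<^sup>2\<close>, where \<open>\<Pi>\<close> is the projection onto the cone, and let \<open>m\<close> be its Gaussian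
mean. For a continuous test function \<open>h\<close> with values in \<open>[0, 1]\<close>, Stein's equation
\<open>\<sigma>\<^sup>2 f' t - t f t = h t - E h(N)\<close> has a solution with \<open>|f'| \<le> 2 / \<sigma>\<^sup>2\<close> (lemma \<open>stein_equation\<close>). If \<open>\<Phi>\<close>
has a gradient \<open>G\<close>, the covariance identity \<open>gauss_covariance\<close> gives
\<open>E[(\<Phi> - m) f(\<Phi> - m)] = E[f'(\<Phi> - m) T]\<close> with \<open>T = R G \<bullet> G\<close>; here \<open>R\<close> averages \<open>G\<close> along the
Ornstein-Uhlenbeck flow. Since \<open>E T = Var \<Phi> = \<sigma>\<^sup>2\<close>, it follows that
\<open>|E h(\<Phi> - m) - E h(N)| \<le> 2 / \<sigma>\<^sup>2 E|T - E T|\<close>.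

On a cone, \<open>|\<Pi> u|\<^sup>2\<close> is continuously differentiable with gradient \<open>2 \<Pi> u\<close>, a Lipschitz field. Hence
\<open>\<Phi> x = |\<mu>|\<^sup>2 + |\<Pi>(x + \<mu>)|\<^sup>2 - 2 \<mu> \<bullet> \<Pi>(x + \<mu>)\<close> splits into a part whose gradient \<open>a = 2 \<Pi>(x + \<mu>)\<close> is
2-Lipschitz and a part that is only \<open>2 |\<mu>|\<close>-Lipschitz, so that \<open>G = a + b\<close> with \<open>|b| \<le> 2 |\<mu>|\<close>.
Correspondingly \<open>T = R a \<bullet> a + r\<close>. The Poincare inequality bounds the standard deviation of
\<open>R a \<bullet> a\<close> by a multiple of \<open>sqrt(E|\<Pi>|\<^sup>2)\<close>, and the remainder \<open>r\<close> is bounded in mean by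
\<open>2 sup|b| E|a| + (sup|b|)\<^sup>2\<close>, which involves no derivative of \<open>b\<close>. This is lemma \<open>stein_bound\<close>. It
yields the factor 12 in front of \<open>sqrt(E|\<Pi>|\<^sup>2)\<close>, where 16 is claimed, and 16 in front of
\<open>2 |\<mu>| E|\<Pi>| + |\<mu>|\<^sup>2\<close>, which is at most \<open>2 sqrt m |\<mu>| + 3 |\<mu>|\<^sup>2\<close>.

The linear part \<open>\<mu> \<bullet> \<Pi>(x + \<mu>)\<close> and the function \<open>R a \<bullet> a\<close> need not be differentiable. Instead of
differentiating almost everywhere, both are convolved with a small Gaussian, which makes them smooth
without enlarging local slopes in the limit; the scale then tends to 0. This passage to the limit is
legitimate because only continuous test functions are involved, and these already determine the total
variation distance, by inner and outer regularity of measures on the line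
(\<open>measure_le_of_continuous\<close>).

If \<open>\<sigma> = 0\<close>, both laws are the point mass at 0 and the distance is 0. The second inequality is
Minkowski's inequality \<open>sqrt(E|\<Pi>|\<^sup>2) \<le> sqrt m + |\<mu>|\<close>.\<close>

section \<open>Stein's equation\<close>

lemma normal_density_derivative:
  assumes "s > 0"
  shows "(normal_density 0 s has_real_derivative - x / s\<^sup>2 * normal_density 0 s x) (at x)"
  unfolding normal_density_def [abs_def] using assms
  by (auto intro!: derivative_eq_intros simp: field_simps power2_eq_square)

lemma continuous_on_normal_density: "s > 0 \<Longrightarrow> continuous_on A (normal_density 0 s)"
  by (rule continuous_at_imp_continuous_on) (auto intro: DERIV_isCont normal_density_derivative)

text \<open>On \<open>[x, \<infinity>)\<close> the factor \<open>x\<close> is at most \<open>t\<close>, and \<open>t \<phi>(t)\<close> has the primitive \<open>- s\<^sup>2 \<phi>(t)\<close>.\<close>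

lemma mills_ratio_bound:
  assumes s: "s > 0" and x: "x \<ge> 0"
  shows "x * (\<integral>t. indicator {x..} t * normal_density 0 s t \<partial>lborel) \<le> s\<^sup>2 * normal_density 0 s x"
proof -
  let ?\<phi> = "normal_density 0 s"
  have int: "integrable lborel ?\<phi>" using integrable_normal_density[OF s] .
  have lim: "((\<lambda>t. - s\<^sup>2 * ?\<phi> t) \<longlongrightarrow> 0) at_top"
  proof -
    have "filterlim (\<lambda>t. t\<^sup>2 / (2 * s\<^sup>2)) at_top at_top"
      using filterlim_tendsto_pos_mult_at_top[OF tendsto_const[of "1 / (2 * s\<^sup>2)"] _
          filterlim_pow_at_top[OF _ filterlim_ident], of 2] s by simp
    then have "((\<lambda>t. exp (- (t\<^sup>2 / (2 * s\<^sup>2)))) \<longlongrightarrow> 0) at_top"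
      by (intro filterlim_compose[OF exp_at_bot]) (simp add: filterlim_uminus_at_bot)
    then have "((\<lambda>t. - s\<^sup>2 * (1 / sqrt (2 * pi * s\<^sup>2) * exp (- (t\<^sup>2 / (2 * s\<^sup>2))))) \<longlongrightarrow>
        - s\<^sup>2 * (1 / sqrt (2 * pi * s\<^sup>2) * 0)) at_top"
      by (intro tendsto_intros)
    then show ?thesis unfolding normal_density_def by simp
  qed
  have "ennreal (x * (\<integral>t. indicator {x..} t * ?\<phi> t \<partial>lborel))
      = (\<integral>\<^sup>+t. ennreal (x * (indicator {x..} t * ?\<phi> t)) \<partial>lborel)"
  proof (subst nn_integral_eq_integral)
    have "integrable lborel (\<lambda>t. indicator {x..} t *\<^sub>R ?\<phi> t)"
      by (rule integrable_mult_indicator[OF _ int]) simp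
    then show "integrable lborel (\<lambda>t. x * (indicator {x..} t * ?\<phi> t))" by simp
  qed (use x in auto)
  also have "\<dots> \<le> (\<integral>\<^sup>+t. ennreal (t * ?\<phi> t) * indicator {x..} t \<partial>lborel)"
    by (intro nn_integral_mono) (auto simp: indicator_def intro!: ennreal_leI mult_right_mono)
  also have "\<dots> = 0 - (- s\<^sup>2 * ?\<phi> x)"
  proof (rule nn_integral_FTC_atLeast)
    show "((\<lambda>t. - s\<^sup>2 * ?\<phi> t) has_real_derivative t * ?\<phi> t) (at t)" for t
      using DERIV_cmult[OF normal_density_derivative[OF s, of t], of "- s\<^sup>2"] s by simp
  qed (use lim x in auto)
  finally show ?thesis using s by (simp add: ennreal_le_iff)
qed

text \<open>The solution is \<open>f x = (s\<^sup>2 \<phi> x)\<^sup>-\<^sup>1 W x\<close>, where \<open>W x\<close> is the integral of \<open>(h - E h) \<phi>\<close> over \<open>(-\<infinity>, x]\<close>. Because the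
total integral vanishes, \<open>W x\<close> can be estimated by either tail; choosing the tail on the side of \<open>x\<close>
away from 0, the Mills ratio bound gives \<open>|x f x| \<le> 1\<close>, and then the equation itself bounds \<open>f'\<close>.\<close>

lemma stein_equation:
  fixes h :: "real \<Rightarrow> real"
  assumes s: "s > 0" and h: "continuous_on UNIV h" "\<And>x. 0 \<le> h x" "\<And>x. h x \<le> 1"
  obtains f f' where
    "\<And>x. (f has_real_derivative f' x) (at x)"
    "continuous_on UNIV f'"
    "\<And>x. \<bar>f' x\<bar> \<le> 2 / s\<^sup>2"
    "\<And>x. s\<^sup>2 * f' x - x * f x = h x - (\<integral>t. h t \<partial>density lborel (\<lambda>t. ennreal (normal_density 0 s t)))"
proof -
  let ?\<phi> = "normal_density 0 s"
  let ?N = "density lborel (\<lambda>t. ennreal (?\<phi> t))"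
  interpret N: prob_space ?N by (rule prob_space_normal_density[OF s])
  define c where "c = (\<integral>t. h t \<partial>?N)"
  define u where "u t = (h t - c) * ?\<phi> t" for t
  have hm [measurable]: "h \<in> borel_measurable borel" by (rule borel_measurable_continuous_onI[OF h(1)])
  have hint: "integrable ?N h"
    by (rule N.integrable_const_bound[where B=1]) (use h in auto)
  have c: "0 \<le> c" "c \<le> 1"
  proof -
    show "0 \<le> c" unfolding c_def using h by (intro integral_nonneg_AE) auto
    have "c \<le> (\<integral>t. 1 \<partial>?N)" unfolding c_def using h by (intro integral_mono hint) auto
    then show "c \<le> 1" using N.prob_space by simp
  qed
  have hc: "\<bar>h t - c\<bar> \<le> 1" for t using h(2,3)[of t] c by linarith
  have \<phi>pos: "?\<phi> t > 0" for t using s by (rule normal_density_pos)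
  have \<phi>int: "integrable lborel ?\<phi>" using integrable_normal_density[OF s] .
  have ub: "\<bar>u t\<bar> \<le> ?\<phi> t" for t
    using mult_right_mono[OF hc[of t] less_imp_le[OF \<phi>pos[of t]]] \<phi>pos[of t] by (simp add: u_def abs_mult)
  have u_cont: "continuous_on A u" for A
    unfolding u_def [abs_def]
    by (intro continuous_intros continuous_on_normal_density[OF s] continuous_on_subset[OF h(1)]) auto
  have um [measurable]: "u \<in> borel_measurable borel" by (rule borel_measurable_continuous_onI[OF u_cont])
  have uint: "integrable lborel u"
    by (rule Bochner_Integration.integrable_bound[OF \<phi>int]) (use ub \<phi>pos in \<open>auto simp: less_imp_le\<close>)
  have uind: "integrable lborel (\<lambda>t. indicator A t * u t)" "integrable lborel (\<lambda>t. indicator A t * ?\<phi> t)"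
    if "A \<in> sets borel" for A
    using integrable_mult_indicator[OF _ uint, of A] integrable_mult_indicator[OF _ \<phi>int, of A] that by auto
  have u0: "(\<integral>t. u t \<partial>lborel) = 0"
  proof -
    have "(\<integral>t. u t \<partial>lborel) = (\<integral>t. ?\<phi> t *\<^sub>R (h t - c) \<partial>lborel)"
      by (simp add: u_def mult.commute)
    also have "\<dots> = (\<integral>t. h t - c \<partial>?N)"
      by (subst integral_density) (use \<phi>pos in \<open>auto simp: less_imp_le\<close>)
    also have "\<dots> = 0"
      using N.prob_space by (subst Bochner_Integration.integral_diff[OF hint]) (auto simp: c_def)
    finally show ?thesis .
  qed
  define W where "W x = (\<integral>t. indicator {..x} t * u t \<partial>lborel)" for x
  have dW: "(W has_real_derivative u x) (at x)" for x
  proof -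
    define a where "a = x - 1"
    have split: "W y = W a + (LBINT t=a..y. u t)" if "a \<le> y" for y
    proof -
      have "W y = (\<integral>t. indicator {..a} t * u t + indicator {a<..y} t * u t \<partial>lborel)"
        unfolding W_def by (intro Bochner_Integration.integral_cong refl) (use that in \<open>auto simp: indicator_def\<close>)
      also have "\<dots> = W a + (\<integral>t. indicator {a<..y} t * u t \<partial>lborel)"
        unfolding W_def by (intro Bochner_Integration.integral_add uind) auto
      also have "(\<integral>t. indicator {a<..y} t * u t \<partial>lborel) = (LBINT t=a..y. u t)"
        using that by (simp add: interval_integral_Ioc set_lebesgue_integral_def)
      finally show ?thesis .
    qed
    have "((\<lambda>y. LBINT t=a..y. u t) has_vector_derivative u x) (at x within {a..x+1})"
      by (rule interval_integral_FTC2) (auto simp: a_def intro: u_cont)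
    then have "((\<lambda>y. LBINT t=a..y. u t) has_real_derivative u x) (at x within {a..x+1})"
      by (simp add: has_real_derivative_iff_has_vector_derivative)
    then have "((\<lambda>y. W a + (LBINT t=a..y. u t)) has_real_derivative u x) (at x within {a..x+1})"
      by (auto intro!: derivative_eq_intros)
    then have "(W has_real_derivative u x) (at x within {a..x+1})"
    proof (rule has_field_derivative_transform_within[where d=1])
      show "W a + (LBINT t=a..y. u t) = W y" if "y \<in> {a..x+1}" for y
        using that by (intro split[symmetric]) auto
    qed (auto simp: a_def)
    moreover have "at x within {a..x+1} = at x"
      by (rule at_within_interior) (auto simp: a_def)
    ultimately show ?thesis by simp
  qed
  have W_bound: "\<bar>x * W x\<bar> \<le> s\<^sup>2 * ?\<phi> x" for x
  proof (cases "x \<ge> 0")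
    case True
    have "W x + (\<integral>t. indicator {x<..} t * u t \<partial>lborel) = (\<integral>t. indicator {..x} t * u t + indicator {x<..} t * u t \<partial>lborel)"
      unfolding W_def by (subst Bochner_Integration.integral_add) (auto intro: uind)
    also have "\<dots> = (\<integral>t. u t \<partial>lborel)"
      by (intro Bochner_Integration.integral_cong refl) (auto simp: indicator_def)
    finally have "\<bar>W x\<bar> = \<bar>\<integral>t. indicator {x<..} t * u t \<partial>lborel\<bar>" using u0 by simp
    also have "\<dots> \<le> (\<integral>t. \<bar>indicator {x<..} t * u t\<bar> \<partial>lborel)" by (rule integral_abs_bound)
    also have "\<dots> \<le> (\<integral>t. indicator {x..} t * ?\<phi> t \<partial>lborel)"
      by (intro integral_mono integrable_abs uind) (use ub in \<open>auto simp: indicator_def\<close>)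
    finally have "x * \<bar>W x\<bar> \<le> x * (\<integral>t. indicator {x..} t * ?\<phi> t \<partial>lborel)"
      using True by (intro mult_left_mono) auto
    also have "\<dots> \<le> s\<^sup>2 * ?\<phi> x" by (rule mills_ratio_bound[OF s True])
    finally show ?thesis using True by (simp add: abs_mult)
  next
    case False
    have "\<bar>W x\<bar> \<le> (\<integral>t. \<bar>indicator {..x} t * u t\<bar> \<partial>lborel)"
      unfolding W_def by (rule integral_abs_bound)
    also have "\<dots> \<le> (\<integral>t. indicator {..x} t * ?\<phi> t \<partial>lborel)"
      by (intro integral_mono integrable_abs uind) (use ub in \<open>auto simp: indicator_def\<close>)
    also have "\<dots> = (\<integral>t. indicator {-x..} t * ?\<phi> t \<partial>lborel)"
      by (subst lborel_integral_real_affine[where c="-1" and t=0])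
         (auto simp: indicator_def normal_density_def intro!: Bochner_Integration.integral_cong)
    finally have "- x * \<bar>W x\<bar> \<le> - x * (\<integral>t. indicator {-x..} t * ?\<phi> t \<partial>lborel)"
      using False by (intro mult_left_mono) auto
    also have "\<dots> \<le> s\<^sup>2 * ?\<phi> (- x)" using False by (intro mills_ratio_bound[OF s]) auto
    also have "?\<phi> (- x) = ?\<phi> x" by (simp add: normal_density_def)
    finally show ?thesis using False by (simp add: abs_mult)
  qed
  define f where "f x = W x / (s\<^sup>2 * ?\<phi> x)" for x
  define f' where "f' x = (h x - c + x * f x) / s\<^sup>2" for x
  have xf: "\<bar>x * f x\<bar> \<le> 1" for x
    using W_bound[of x] s \<phi>pos[of x] by (simp add: f_def abs_mult abs_divide field_simps)
  have df: "(f has_real_derivative f' x) (at x)" for x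
    unfolding f_def [abs_def]
    by (rule derivative_eq_intros dW normal_density_derivative[OF s] refl)+
       (use s \<phi>pos[of x] in \<open>auto simp: f'_def f_def u_def field_simps power2_eq_square\<close>)
  show thesis
  proof
    show "(f has_real_derivative f' x) (at x)" for x by (rule df)
    have "continuous_on UNIV f"
      by (rule continuous_at_imp_continuous_on) (auto intro: DERIV_isCont df)
    then show "continuous_on UNIV f'"
      unfolding f'_def [abs_def] using s by (intro continuous_intros h(1)) auto
    show "\<bar>f' x\<bar> \<le> 2 / s\<^sup>2" for x
    proof -
      have "\<bar>h x - c + x * f x\<bar> \<le> 2" using hc[of x] xf[of x] by linarith
      then show ?thesis unfolding f'_def using s by (simp add: abs_divide divide_right_mono)
    qed
    show "s\<^sup>2 * f' x - x * f x = h x - (\<integral>t. h t \<partial>?N)" for x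
      unfolding f'_def using s by (simp add: c_def)
  qed
qed

section \<open>Total variation distance and continuous test functions\<close>

text \<open>Approximate \<open>A\<close> from inside by compact \<open>K\<close> for \<open>P\<close> and from outside by open \<open>U\<close> for \<open>Q\<close>, and
separate \<open>K\<close> from the complement of \<open>U\<close> by a Urysohn function \<open>h\<close>: then
\<open>P K \<le> \<integral>h dP \<le> \<integral>h dQ + B \<le> Q U + B\<close>.\<close>

lemma measure_le_of_continuous:
  fixes P Q :: "real measure"
  assumes P: "prob_space P" "sets P = sets borel" and Q: "prob_space Q" "sets Q = sets borel"
    and B: "\<And>h. continuous_on UNIV h \<Longrightarrow> (\<And>x. 0 \<le> h x) \<Longrightarrow> (\<And>x. h x \<le> 1) \<Longrightarrow>
      (\<integral>x. h x \<partial>P) \<le> (\<integral>x. h x \<partial>Q) + B"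
    and A: "A \<in> sets borel"
  shows "measure P A \<le> measure Q A + B"
proof -
  interpret P: prob_space P by (rule P)
  interpret Q: prob_space Q by (rule Q)
  have finP: "emeasure P (space P) \<noteq> \<infinity>" and finQ: "emeasure Q (space Q) \<noteq> \<infinity>"
    using P.emeasure_space_1 Q.emeasure_space_1 by simp_all
  have B0: "B \<ge> 0" using B[of "\<lambda>_. 0"] by simp
  have KU: "measure P K \<le> measure Q U + B" if K: "compact K" and U: "open U" and "K \<subseteq> U" for K U
  proof -
    have sets: "K \<in> sets borel" "U \<in> sets borel" using borel_closed[OF compact_imp_closed[OF K]] U by auto
    obtain h :: "real \<Rightarrow> real" where h: "continuous_on UNIV h" "\<And>x. h x \<in> closed_segment 1 0"
      "\<And>x. x \<in> K \<Longrightarrow> h x = 1" "\<And>x. x \<in> - U \<Longrightarrow> h x = 0"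
      using Urysohn[of K "- U" 1 0] compact_imp_closed[OF K] U \<open>K \<subseteq> U\<close> by (auto simp: closed_Compl)
    have h01: "0 \<le> h x" "h x \<le> 1" for x
      using h(2)[of x] by (auto simp: closed_segment_eq_real_ivl)
    have hm: "h \<in> borel_measurable borel" by (rule borel_measurable_continuous_onI[OF h(1)])
    have intP: "integrable P h"
      by (rule P.integrable_const_bound[where B=1]) (use h01 hm in \<open>auto simp: measurable_cong_sets[OF P(2)]\<close>)
    have intQ: "integrable Q h"
      by (rule Q.integrable_const_bound[where B=1]) (use h01 hm in \<open>auto simp: measurable_cong_sets[OF Q(2)]\<close>)
    have "measure P K = (\<integral>x. indicator K x \<partial>P)" using sets P by simp
    also have "\<dots> \<le> (\<integral>x. h x \<partial>P)"
    proof (intro integral_mono intP)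
      show "integrable P (indicat_real K)"
        using sets P(2) by (intro integrable_real_indicator) (auto simp: P.emeasure_eq_measure)
    qed (use h(3) h01 in \<open>auto simp: indicator_def\<close>)
    also have "\<dots> \<le> (\<integral>x. h x \<partial>Q) + B" by (rule B[OF h(1) h01])
    also have "(\<integral>x. h x \<partial>Q) \<le> (\<integral>x. indicator U x \<partial>Q)"
    proof (intro integral_mono intQ)
      show "integrable Q (indicat_real U)"
        using sets Q(2) by (intro integrable_real_indicator) (auto simp: Q.emeasure_eq_measure)
    qed (use h(4) h01 in \<open>auto simp: indicator_def\<close>)
    also have "\<dots> = measure Q U" using sets Q by simp
    finally show ?thesis by simp
  qed
  have KA: "measure P K \<le> measure Q A + B" if K: "compact K" "K \<subseteq> A" for K
  proof -
    have "ennreal (measure P K - B) \<le> emeasure Q A"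
      unfolding outer_regular[OF Q(2) finQ A]
    proof (rule INF_greatest)
      fix U assume "U \<in> {U. A \<subseteq> U \<and> open U}"
      then have "open U" "K \<subseteq> U" using K(2) by auto
      from KU[OF K(1) this] have "measure P K - B \<le> measure Q U" by simp
      then show "ennreal (measure P K - B) \<le> emeasure Q U"
        by (simp add: Q.emeasure_eq_measure ennreal_leI)
    qed
    then show ?thesis by (simp add: Q.emeasure_eq_measure ennreal_le_iff)
  qed
  have "emeasure P A \<le> ennreal (measure Q A + B)"
    unfolding inner_regular[OF P(2) finP A]
    by (rule SUP_least) (use KA in \<open>auto simp: P.emeasure_eq_measure intro!: ennreal_leI\<close>)
  then show ?thesis
    using ennreal_le_iff[of "measure Q A + B" "measure P A"] B0 unfolding P.emeasure_eq_measure by simp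
qed

lemma tv_distance_le:
  assumes M: "prob_space M" "F \<in> borel_measurable M" and N: "prob_space M'" "N \<in> borel_measurable M'"
    and B: "\<And>h. continuous_on UNIV h \<Longrightarrow> (\<And>x. 0 \<le> h x) \<Longrightarrow> (\<And>x. h x \<le> 1) \<Longrightarrow>
      \<bar>(\<integral>\<omega>. h (F \<omega>) \<partial>M) - (\<integral>x. h x \<partial>distr M' borel N)\<bar> \<le> B"
  shows "tv_distance M F M' N \<le> B"
  unfolding tv_distance_def
proof (rule cSUP_least)
  fix A :: "real set" assume A: "A \<in> sets borel"
  have P: "prob_space (distr M borel F)" by (rule prob_space.prob_space_distr[OF M])
  have Q: "prob_space (distr M' borel N)" by (rule prob_space.prob_space_distr[OF N])
  have le: "(\<integral>x. h x \<partial>distr M borel F) \<le> (\<integral>x. h x \<partial>distr M' borel N) + B"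
    and ge: "(\<integral>x. h x \<partial>distr M' borel N) \<le> (\<integral>x. h x \<partial>distr M borel F) + B"
    if h: "continuous_on UNIV h" "\<And>x. 0 \<le> h x" "\<And>x. h x \<le> 1" for h
    using B[OF h] unfolding integral_distr[OF M(2) borel_measurable_continuous_onI[OF h(1)]] by linarith+
  have "measure (distr M borel F) A \<le> measure (distr M' borel N) A + B"
    by (rule measure_le_of_continuous[OF P sets_distr Q sets_distr le A])
  moreover have "measure (distr M' borel N) A \<le> measure (distr M borel F) A + B"
    by (rule measure_le_of_continuous[OF Q sets_distr P sets_distr ge A])
  ultimately have "\<bar>measure (distr M borel F) A - measure (distr M' borel N) A\<bar> \<le> B" by linarith
  then show "\<bar>measure M {\<omega> \<in> space M. F \<omega> \<in> A} - measure M' {\<omega> \<in> space M'. N \<omega> \<in> A}\<bar> \<le> B"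
    using measure_distr[OF M(2) A] measure_distr[OF N(2) A]
    by (simp add: vimage_def Collect_conj_eq Int_commute)
qed auto

section \<open>Projection onto a closed convex cone\<close>

lemma positive_convex_cone_scale:
  assumes "positive_convex_cone C" "x \<in> C" "t > 0"
  shows "t *\<^sub>R x \<in> C"
proof -
  have "(t / 2) *\<^sub>R x + (t / 2) *\<^sub>R x \<in> C"
    using assms unfolding positive_convex_cone_def by (meson half_gt_zero)
  then show ?thesis by (simp flip: scaleR_add_left)
qed

lemma positive_convex_cone_zero:
  fixes C :: "'a::real_normed_vector set"
  assumes "positive_convex_cone C" "closed C" "C \<noteq> {}"
  shows "0 \<in> C"
proof -
  obtain x where x: "x \<in> C" using assms(3) by blast
  have "(\<lambda>n. inverse (real (Suc n)) *\<^sub>R x) \<longlonglongrightarrow> 0 *\<^sub>R x"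
    by (intro tendsto_intros LIMSEQ_inverse_real_of_nat)
  moreover have "inverse (real (Suc n)) *\<^sub>R x \<in> C" for n
    by (rule positive_convex_cone_scale[OF assms(1) x]) simp
  ultimately show ?thesis using closed_sequentially[OF assms(2)] by fastforce
qed

lemma positive_convex_cone_convex: "positive_convex_cone C \<Longrightarrow> convex C"
  unfolding convex_def positive_convex_cone_def
proof (intro ballI allI impI)
  fix x y and u v :: real
  assume C: "\<forall>x\<in>C. \<forall>y\<in>C. \<forall>a>0. \<forall>b>0. a *\<^sub>R x + b *\<^sub>R y \<in> C"
    and xy: "x \<in> C" "y \<in> C" and uv: "0 \<le> u" "0 \<le> v" "u + v = 1"
  show "u *\<^sub>R x + v *\<^sub>R y \<in> C"
  proof (cases "u = 0 \<or> v = 0")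
    case True
    then show ?thesis using xy uv by auto
  next
    case False
    with uv have "u > 0" "v > 0" by auto
    with C xy show ?thesis by blast
  qed
qed


lemma cone_projection_in:
  fixes C :: "'a::euclidean_space set"
  assumes C: "positive_convex_cone C" "closed C" "C \<noteq> {}"
  shows "closest_point C x \<in> C"
  by (rule closest_point_in_set[OF C(2,3)])

text \<open>The variational inequality for the projection, tested with the two points \<open>0\<close> and \<open>2 \<Pi> x\<close> of the ray
through \<open>\<Pi> x\<close>.\<close>

lemma cone_projection_orthogonal:
  fixes C :: "'a::euclidean_space set"
  assumes C: "positive_convex_cone C" "closed C" "C \<noteq> {}"
  shows "(x - closest_point C x) \<bullet> closest_point C x = 0"
proof -
  have le: "(x - closest_point C x) \<bullet> (y - closest_point C x) \<le> 0" if "y \<in> C" for y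
    by (rule closest_point_dot[OF positive_convex_cone_convex[OF C(1)] C(2) that])
  have "2 *\<^sub>R closest_point C x \<in> C"
    by (rule positive_convex_cone_scale[OF C(1) cone_projection_in[OF C]]) simp
  from le[OF this] le[OF positive_convex_cone_zero[OF C]] show ?thesis
    by (simp add: scaleR_2)
qed

lemma cone_projection_lipschitz:
  fixes C :: "'a::euclidean_space set"
  assumes C: "positive_convex_cone C" "closed C" "C \<noteq> {}"
  shows "norm (closest_point C x - closest_point C y) \<le> norm (x - y)"
  using closest_point_lipschitz[OF positive_convex_cone_convex[OF C(1)] C(2,3), of x y]
  by (simp add: dist_norm)

lemma cone_projection_pythagoras:
  fixes C :: "'a::euclidean_space set"
  assumes C: "positive_convex_cone C" "closed C" "C \<noteq> {}"
  shows "(norm (closest_point C x))\<^sup>2 = (norm x)\<^sup>2 - (norm (x - closest_point C x))\<^sup>2"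
  using cone_projection_orthogonal[OF C, of x]
  by (simp add: power2_norm_eq_inner inner_diff_left inner_diff_right inner_commute)

text \<open>By Pythagoras \<open>|\<Pi> y|\<^sup>2\<close> is \<open>|y|\<^sup>2\<close> minus the squared distance from \<open>y\<close> to the cone, and that distance is
at most \<open>|y - \<Pi> x|\<close>. Thus \<open>|\<Pi> x|\<^sup>2\<close> is convex with subgradient \<open>2 \<Pi> x\<close>.\<close>

lemma cone_projection_sq_subgradient:
  fixes C :: "'a::euclidean_space set"
  assumes C: "positive_convex_cone C" "closed C" "C \<noteq> {}"
  shows "2 * (closest_point C x \<bullet> (y - x)) \<le> (norm (closest_point C y))\<^sup>2 - (norm (closest_point C x))\<^sup>2"
proof -
  have "norm (y - closest_point C y) \<le> norm (y - closest_point C x)"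
    using closest_point_le[OF C(2) cone_projection_in[OF C, of x], of y] by (simp add: dist_norm)
  then have "(norm (y - closest_point C y))\<^sup>2 \<le> (norm (y - closest_point C x))\<^sup>2"
    by (intro power_mono) auto
  also have "\<dots> = (norm y)\<^sup>2 - 2 * (closest_point C x \<bullet> y) + (norm (closest_point C x))\<^sup>2"
    by (simp add: power2_norm_eq_inner inner_diff_left inner_diff_right inner_commute)
  finally have "2 * (closest_point C x \<bullet> y) - (norm (closest_point C x))\<^sup>2 \<le> (norm (closest_point C y))\<^sup>2"
    using cone_projection_pythagoras[OF C, of y] by linarith
  moreover have "closest_point C x \<bullet> x = (norm (closest_point C x))\<^sup>2"
    using cone_projection_orthogonal[OF C, of x]
    unfolding power2_norm_eq_inner inner_diff_left inner_commute[of "closest_point C x" x] by linarith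
  ultimately show ?thesis by (simp add: inner_diff_right)
qed

text \<open>Exchanging \<open>x\<close> and \<open>y\<close> in the subgradient inequality bounds the error of the linear approximation from
above by \<open>2 (\<Pi> y - \<Pi> x) \<bullet> (y - x) \<le> 2 |y - x|\<^sup>2\<close>.\<close>

lemma cone_projection_sq_derivative:
  fixes C :: "'a::euclidean_space set"
  assumes C: "positive_convex_cone C" "closed C" "C \<noteq> {}"
  shows "((\<lambda>x. (norm (closest_point C x))\<^sup>2) has_derivative (\<lambda>v. (2 *\<^sub>R closest_point C x) \<bullet> v)) (at x)"
  unfolding has_derivative_at_alt
proof (intro conjI allI impI)
  show "bounded_linear (\<lambda>v. (2 *\<^sub>R closest_point C x) \<bullet> v)" by (rule bounded_linear_inner_right)
  fix e :: real assume e: "e > 0"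
  show "\<exists>d>0. \<forall>y. norm (y - x) < d \<longrightarrow> norm ((norm (closest_point C y))\<^sup>2 - (norm (closest_point C x))\<^sup>2
      - (2 *\<^sub>R closest_point C x) \<bullet> (y - x)) \<le> e * norm (y - x)"
  proof (intro exI[of _ "e / 2"] conjI allI impI)
    fix y assume y: "norm (y - x) < e / 2"
    have up: "(norm (closest_point C y))\<^sup>2 - (norm (closest_point C x))\<^sup>2 \<le> 2 * (closest_point C y \<bullet> (y - x))"
      using cone_projection_sq_subgradient[OF C, of y x] by (simp add: inner_diff_right)
    have "(closest_point C y - closest_point C x) \<bullet> (y - x) \<le> norm (closest_point C y - closest_point C x) * norm (y - x)"
      by (rule norm_cauchy_schwarz)
    also have "\<dots> \<le> (e / 2) * norm (y - x)"
      using cone_projection_lipschitz[OF C, of y x] y by (intro mult_right_mono) auto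
    finally show "norm ((norm (closest_point C y))\<^sup>2 - (norm (closest_point C x))\<^sup>2
      - (2 *\<^sub>R closest_point C x) \<bullet> (y - x)) \<le> e * norm (y - x)"
      using up cone_projection_sq_subgradient[OF C, of x y] by (simp add: inner_diff_left)
  qed (use e in simp)
qed

section \<open>Functions of polynomial growth\<close>

text \<open>Apart from Lebesgue densities, the functions integrated below are continuous of polynomial growth. This class is closed under
composition, bilinear operations and integration over parameters, so that membership can be decided
by the introduction rules collected in \<open>tame_intros\<close>, and it implies both measurability and
integrability with respect to every probability measure with finite moments of all orders.\<close>

definition tame :: "('a::euclidean_space \<Rightarrow> 'b::euclidean_space) \<Rightarrow> bool" where
  "tame f \<longleftrightarrow> continuous_on UNIV f \<and> (\<exists>A\<ge>0. \<exists>k::nat. \<forall>x. norm (f x) \<le> A * (1 + norm x) ^ k)"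

lemma tameI:
  assumes "continuous_on UNIV f" "\<And>x. norm (f x) \<le> A * (1 + norm x) ^ k"
  shows "tame f"
proof -
  have "norm (f x) \<le> \<bar>A\<bar> * (1 + norm x) ^ k" for x
    using assms(2)[of x] mult_right_mono[OF abs_ge_self[of A], of "(1 + norm x) ^ k"] by simp
  then show ?thesis
    unfolding tame_def using assms(1) abs_ge_zero by blast
qed

lemma tameD_continuous: "tame f \<Longrightarrow> continuous_on S f"
  unfolding tame_def using continuous_on_subset by blast

lemma tameD_measurable: "tame f \<Longrightarrow> f \<in> borel_measurable borel"
  by (intro borel_measurable_continuous_onI tameD_continuous)

lemma tameE:
  assumes "tame f"
  obtains A k where "A \<ge> 0" "\<And>x. norm (f x) \<le> A * (1 + norm x) ^ k"
  using assms unfolding tame_def by blast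

lemma tame_bound_common:
  fixes f :: "'a::euclidean_space \<Rightarrow> 'b::euclidean_space" and g :: "'a \<Rightarrow> 'c::euclidean_space"
  assumes "tame f" "tame g"
  obtains A k where "A \<ge> 0" "\<And>x. norm (f x) \<le> A * (1 + norm x) ^ k"
    "\<And>x. norm (g x) \<le> A * (1 + norm x) ^ k"
proof -
  obtain A k where A: "A \<ge> 0" "\<And>x. norm (f x) \<le> A * (1 + norm x) ^ k"
    using tameE[OF assms(1)] by blast
  obtain B l where B: "B \<ge> 0" "\<And>x. norm (g x) \<le> B * (1 + norm x) ^ l"
    using tameE[OF assms(2)] by blast
  have mono: "C * (1 + norm x) ^ i \<le> max A B * (1 + norm x) ^ max k l"
    if "0 \<le> C" "C \<le> max A B" "i \<le> max k l" for C i and x :: 'a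
    using that by (intro mult_mono power_increasing) auto
  show thesis
  proof
    show "max A B \<ge> 0" using A by simp
    show "norm (f x) \<le> max A B * (1 + norm x) ^ max k l" for x
      using A(2)[of x] mono[of A k x] A(1) by simp
    show "norm (g x) \<le> max A B * (1 + norm x) ^ max k l" for x
      using B(2)[of x] mono[of B l x] B(1) by simp
  qed
qed

lemma tame_const: "tame (\<lambda>x. c)"
  by (rule tameI[where A="norm c" and k=0]) auto

lemma tame_bounded_linear: "bounded_linear f \<Longrightarrow> tame f"
proof -
  assume f: "bounded_linear f"
  then obtain K where K: "\<And>x. norm (f x) \<le> norm x * K" "K \<ge> 0"
    using bounded_linear.nonneg_bounded by blast
  have "norm (f x) \<le> K * (1 + norm x) ^ 1" for x
    using K(1)[of x] K(2) by (simp add: algebra_simps)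
  with linear_continuous_on[OF f] show ?thesis by (rule tameI)
qed

lemma tame_ident: "tame (\<lambda>x. x)"
  by (intro tame_bounded_linear bounded_linear_ident)

lemma tame_comp:
  assumes "tame f" "tame g"
  shows "tame (\<lambda>x. f (g x))"
proof -
  obtain A k where A: "A \<ge> 0" "\<And>x. norm (f x) \<le> A * (1 + norm x) ^ k"
    using tameE[OF assms(1)] by blast
  obtain B l where B: "B \<ge> 0" "\<And>x. norm (g x) \<le> B * (1 + norm x) ^ l"
    using tameE[OF assms(2)] by blast
  have "norm (f (g x)) \<le> (A * (1 + B) ^ k) * (1 + norm x) ^ (l * k)" for x
  proof -
    have one: "1 \<le> (1 + norm x) ^ l" by (simp add: one_le_power)
    have *: "1 + norm (g x) \<le> (1 + B) * (1 + norm x) ^ l"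
      using B(2)[of x] one unfolding distrib_right mult_1_left by linarith
    have "norm (f (g x)) \<le> A * (1 + norm (g x)) ^ k" by (rule A)
    also have "\<dots> \<le> A * ((1 + B) * (1 + norm x) ^ l) ^ k"
      using A(1) * by (intro mult_left_mono power_mono) simp_all
    finally show ?thesis by (simp only: power_mult_distrib power_mult mult.assoc)
  qed
  moreover have "continuous_on UNIV (\<lambda>x. f (g x))"
    by (rule continuous_on_compose2[OF tameD_continuous[OF assms(1)] tameD_continuous[OF assms(2)] subset_UNIV])
  ultimately show ?thesis by (rule tameI[rotated])
qed

lemma tame_Pair:
  assumes "tame f" "tame g"
  shows "tame (\<lambda>x. (f x, g x))"
proof -
  obtain A k where A: "A \<ge> 0" "\<And>x. norm (f x) \<le> A * (1 + norm x) ^ k"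
    "\<And>x. norm (g x) \<le> A * (1 + norm x) ^ k"
    using tame_bound_common[OF assms] by blast
  have "norm (f x, g x) \<le> (2 * A) * (1 + norm x) ^ k" for x
    using norm_Pair_le[of "f x" "g x"] A(2,3)[of x] by linarith
  then show ?thesis
    by (rule tameI[OF continuous_on_Pair[OF tameD_continuous[OF assms(1)] tameD_continuous[OF assms(2)]]])
qed

lemma tame_fst: "tame f \<Longrightarrow> tame (\<lambda>x. fst (f x))"
  by (rule tame_comp[OF tame_bounded_linear[OF bounded_linear_fst]])

lemma tame_snd: "tame f \<Longrightarrow> tame (\<lambda>x. snd (f x))"
  by (rule tame_comp[OF tame_bounded_linear[OF bounded_linear_snd]])

lemma tame_add_pair: "tame (\<lambda>z. fst z + snd z)"
  by (intro tame_bounded_linear bounded_linear_add bounded_linear_fst bounded_linear_snd)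

lemma tame_add: "tame f \<Longrightarrow> tame g \<Longrightarrow> tame (\<lambda>x. f x + g x)"
  using tame_comp[OF tame_add_pair tame_Pair[of f g]] by simp

lemma tame_uminus: "tame f \<Longrightarrow> tame (\<lambda>x. - f x)"
  by (rule tame_comp[OF tame_bounded_linear[OF bounded_linear_minus[OF bounded_linear_ident]]])

lemma tame_diff: "tame f \<Longrightarrow> tame g \<Longrightarrow> tame (\<lambda>x. f x - g x)"
  using tame_add[of f "\<lambda>x. - g x"] tame_uminus[of g] by simp

lemma tame_bounded_bilinear:
  assumes "bounded_bilinear p" "tame f" "tame g"
  shows "tame (\<lambda>x. p (f x) (g x))"
proof -
  obtain K where K: "K \<ge> 0" "\<And>a b. norm (p a b) \<le> norm a * norm b * K"
    using bounded_bilinear.nonneg_bounded[OF assms(1)] by blast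
  obtain A k where A: "A \<ge> 0" "\<And>x. norm (f x) \<le> A * (1 + norm x) ^ k"
    "\<And>x. norm (g x) \<le> A * (1 + norm x) ^ k"
    using tame_bound_common[OF assms(2,3)] by blast
  have "norm (p (f x) (g x)) \<le> (A * A * K) * (1 + norm x) ^ (k + k)" for x
  proof -
    have "norm (f x) * norm (g x) * K \<le> (A * (1 + norm x) ^ k) * (A * (1 + norm x) ^ k) * K"
      using A K by (intro mult_mono) auto
    then show ?thesis using K(2)[of "f x" "g x"] by (simp add: power_add ac_simps)
  qed
  moreover have "continuous_on UNIV (\<lambda>x. p (f x) (g x))"
    by (intro bounded_bilinear.continuous_on[OF assms(1)] tameD_continuous assms)
  ultimately show ?thesis by (rule tameI[rotated])
qed

lemmas tame_inner = tame_bounded_bilinear[OF bounded_bilinear_inner]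
lemmas tame_scaleR = tame_bounded_bilinear[OF bounded_bilinear_scaleR]
lemmas tame_mult = tame_bounded_bilinear[OF bounded_bilinear_mult]

lemma tame_norm: "tame f \<Longrightarrow> tame (\<lambda>x. norm (f x))"
  by (rule tame_comp[OF tameI[where A=1 and k=1]]) (auto intro: continuous_intros)

lemma tame_divide: "tame f \<Longrightarrow> tame (\<lambda>x. f x / c :: real)"
  unfolding divide_inverse by (intro tame_mult tame_const)

lemma tame_abs: "tame f \<Longrightarrow> tame (\<lambda>x. \<bar>f x\<bar> :: real)"
  using tame_norm[of f] by simp

lemma tame_power: "tame f \<Longrightarrow> tame (\<lambda>x. (f x :: real) ^ n)"
  by (induction n) (auto intro: tame_const tame_mult)

lemma tame_cos: "tame f \<Longrightarrow> tame (\<lambda>x. cos (f x :: real))"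
  by (rule tame_comp[OF tameI[where A=1 and k=0]]) (auto intro: continuous_intros)

lemma tame_sin: "tame f \<Longrightarrow> tame (\<lambda>x. sin (f x :: real))"
  by (rule tame_comp[OF tameI[where A=1 and k=0]]) (auto intro: continuous_intros)

lemmas tame_intros = tame_const tame_ident tame_Pair tame_fst tame_snd tame_add tame_uminus
  tame_diff tame_inner tame_scaleR tame_mult tame_divide tame_norm tame_abs tame_power tame_cos tame_sin

lemma tame_linear_growth:
  assumes "continuous_on UNIV f" "\<And>x. norm (f x) \<le> A + B * norm x"
  shows "tame f"
proof (rule tameI[where A="\<bar>A\<bar> + \<bar>B\<bar>" and k=1])
  show "norm (f x) \<le> (\<bar>A\<bar> + \<bar>B\<bar>) * (1 + norm x) ^ 1" for x
  proof -
    have "B * norm x \<le> \<bar>B\<bar> * norm x" by (simp add: mult_right_mono)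
    moreover have "0 \<le> \<bar>A\<bar> * norm x" "0 \<le> \<bar>B\<bar>" "A \<le> \<bar>A\<bar>" by simp_all
    ultimately show ?thesis using assms(2)[of x] unfolding power_one_right distrib_left distrib_right mult_1_right
      by linarith
  qed
qed (rule assms(1))

lemma tame_lipschitz:
  fixes f :: "'a::euclidean_space \<Rightarrow> 'b::euclidean_space"
  assumes "\<And>x y. norm (f x - f y) \<le> L * norm (x - y)"
  shows "tame f"
proof (rule tame_linear_growth)
  have "\<bar>L\<bar>-lipschitz_on UNIV f"
  proof (intro lipschitz_onI)
    fix x y
    show "dist (f x) (f y) \<le> \<bar>L\<bar> * dist x y"
      using assms[of x y] mult_right_mono[OF abs_ge_self[of L], of "norm (x - y)"] by (simp add: dist_norm)
  qed simp
  then show "continuous_on UNIV f" by (rule lipschitz_on_continuous_on)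
  show "norm (f x) \<le> norm (f 0) + L * norm x" for x
    using assms[of x 0] norm_triangle_ineq2[of "f x" "f 0"] by simp
qed

text \<open>The moment condition makes every tame function integrable; the condition passes to products, so
Fubini's theorem holds for tame functions without further side conditions.\<close>

definition tame_measure :: "'a::euclidean_space measure \<Rightarrow> bool" where
  "tame_measure M \<longleftrightarrow> prob_space M \<and> sets M = sets borel \<and> (\<forall>k. integrable M (\<lambda>x. (1 + norm x) ^ k))"

lemma tame_measureD:
  assumes "tame_measure M"
  shows "prob_space M" "sets M = sets borel" "space M = UNIV" "integrable M (\<lambda>x. (1 + norm x) ^ k)"
  using assms sets_eq_imp_space_eq[of M borel] unfolding tame_measure_def by auto

lemma tame_measure_pair_sigma_finite:
  assumes "tame_measure M" "tame_measure N"
  shows "pair_sigma_finite M N"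
  using assms by (intro pair_sigma_finite.intro prob_space_imp_sigma_finite tame_measureD)

lemma tame_integrable:
  assumes "tame_measure M" "tame f"
  shows "integrable M f"
proof -
  obtain A k where A: "A \<ge> 0" "\<And>x. norm (f x) \<le> A * (1 + norm x) ^ k"
    using tameE[OF assms(2)] by blast
  show ?thesis
  proof (rule Bochner_Integration.integrable_bound)
    show "integrable M (\<lambda>x. A * (1 + norm x) ^ k)"
      by (intro integrable_mult_right tame_measureD assms)
    show "f \<in> borel_measurable M"
      using tameD_measurable[OF assms(2)] measurable_cong_sets[OF tame_measureD(2)[OF assms(1)]] by blast
    show "AE x in M. norm (f x) \<le> norm (A * (1 + norm x) ^ k)"
      using A by auto
  qed
qed

lemma tame_measure_pair:
  assumes "tame_measure M" "tame_measure N"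
  shows "tame_measure (M \<Otimes>\<^sub>M N)"
proof -
  have one: "measure M UNIV = 1" "measure N UNIV = 1"
    using prob_space.prob_space[OF tame_measureD(1)] tame_measureD(3) assms by metis+
  have sets: "sets (M \<Otimes>\<^sub>M N) = sets borel"
    by (rule trans[OF sets_pair_measure_cong[OF tame_measureD(2)[OF assms(1)] tame_measureD(2)[OF assms(2)]]
          arg_cong[where f=sets, OF borel_prod]])
  have "integrable (M \<Otimes>\<^sub>M N) (\<lambda>z. (1 + norm z) ^ k)" for k
  proof (rule Bochner_Integration.integrable_bound)
    have meas: "(\<lambda>z. (1 + norm (fst z)) ^ k * (1 + norm (snd z)) ^ k) \<in> borel_measurable (M \<Otimes>\<^sub>M N)"
      unfolding measurable_cong_sets[OF sets refl]
      by (intro tameD_measurable tame_intros)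
    show "integrable (M \<Otimes>\<^sub>M N) (\<lambda>z. (1 + norm (fst z)) ^ k * (1 + norm (snd z)) ^ k)"
    proof (rule pair_sigma_finite.Fubini_integrable[OF tame_measure_pair_sigma_finite[OF assms] meas])
      show "integrable M (\<lambda>x. \<integral>y. norm ((1 + norm (fst (x, y))) ^ k * (1 + norm (snd (x, y))) ^ k) \<partial>N)"
        using tame_measureD(4)[OF assms(1), of k] by (simp add: abs_mult)
      show "AE x in M. integrable N (\<lambda>y. (1 + norm (fst (x, y))) ^ k * (1 + norm (snd (x, y))) ^ k)"
        using tame_measureD(4)[OF assms(2), of k] by auto
    qed
    show "(\<lambda>z. (1 + norm z) ^ k) \<in> borel_measurable (M \<Otimes>\<^sub>M N)"
      unfolding measurable_cong_sets[OF sets refl]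
      by (intro tameD_measurable tame_intros)
    have "(1 + norm z) ^ k \<le> ((1 + norm (fst z)) * (1 + norm (snd z))) ^ k" for z :: "'a \<times> 'b"
    proof (rule power_mono)
      have "norm z \<le> norm (fst z) + norm (snd z)" by (metis norm_Pair_le prod.collapse)
      moreover have "0 \<le> norm (fst z) * norm (snd z)" by simp
      ultimately show "1 + norm z \<le> (1 + norm (fst z)) * (1 + norm (snd z))"
        unfolding distrib_left distrib_right mult_1_right mult_1_left by linarith
    qed simp
    then show "AE z in M \<Otimes>\<^sub>M N. norm ((1 + norm z) ^ k)
        \<le> norm ((1 + norm (fst z)) ^ k * (1 + norm (snd z)) ^ k)"
      by (intro AE_I2) (simp add: power_mult_distrib abs_mult)
  qed
  then show ?thesis
    unfolding tame_measure_def using sets prob_space_pair[OF assms[THEN tame_measureD(1)]] by blast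
qed

lemma tame_Fubini:
  fixes f :: "'a::euclidean_space \<times> 'b::euclidean_space \<Rightarrow> 'c::euclidean_space"
  assumes "tame_measure M" "tame_measure N" "tame f"
  shows "(\<integral>z. f z \<partial>(M \<Otimes>\<^sub>M N)) = (\<integral>x. \<integral>y. f (x, y) \<partial>N \<partial>M)"
    and "(\<integral>z. f z \<partial>(M \<Otimes>\<^sub>M N)) = (\<integral>y. \<integral>x. f (x, y) \<partial>M \<partial>N)"
    and "integrable M (\<lambda>x. \<integral>y. f (x, y) \<partial>N)"
proof -
  note pair = tame_measure_pair_sigma_finite[OF assms(1,2)]
  have int: "integrable (M \<Otimes>\<^sub>M N) f"
    by (intro tame_integrable tame_measure_pair assms)
  show 1: "(\<integral>z. f z \<partial>(M \<Otimes>\<^sub>M N)) = (\<integral>x. \<integral>y. f (x, y) \<partial>N \<partial>M)"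
    using pair_sigma_finite.integral_fst'[OF pair int] by simp
  have int': "integrable (M \<Otimes>\<^sub>M N) (case_prod (\<lambda>x y. f (x, y)))" using int by (simp add: case_prod_beta')
  show "(\<integral>z. f z \<partial>(M \<Otimes>\<^sub>M N)) = (\<integral>y. \<integral>x. f (x, y) \<partial>M \<partial>N)"
    using pair_sigma_finite.Fubini_integral[OF pair int'] 1 by simp
  show "integrable M (\<lambda>x. \<integral>y. f (x, y) \<partial>N)"
    by (rule pair_sigma_finite.integrable_fst'[OF pair int])
qed

text \<open>Continuity in the parameter is dominated convergence; the dominating function comes from
\<open>1 + |(x, y)| \<le> (1 + |x|) (1 + |y|)\<close>, which separates the variables in a polynomial bound.\<close>

lemma tame_integral:
  fixes f :: "'a::euclidean_space \<times> 'b::euclidean_space \<Rightarrow> 'c::euclidean_space"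
  assumes N: "tame_measure N" and f: "tame f"
  shows "tame (\<lambda>x. \<integral>y. f (x, y) \<partial>N)"
proof -
  obtain A k where A: "A \<ge> 0" "\<And>x. norm (f x) \<le> A * (1 + norm x) ^ k"
    using tameE[OF f] by blast
  have bound: "norm (f (x, y)) \<le> A * (1 + norm x) ^ k * (1 + norm y) ^ k" for x y
  proof -
    have "norm (f (x, y)) \<le> A * (1 + norm (x, y)) ^ k" by (rule A)
    also have "\<dots> \<le> A * ((1 + norm x) * (1 + norm y)) ^ k"
    proof (intro mult_left_mono power_mono A(1))
      have "0 \<le> norm x * norm y" by simp
      then show "1 + norm (x, y) \<le> (1 + norm x) * (1 + norm y)"
        using norm_Pair_le[of x y] unfolding distrib_left distrib_right mult_1_right mult_1_left by linarith
    qed simp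
    finally show ?thesis by (simp only: power_mult_distrib mult.assoc)
  qed
  have mom: "integrable N (\<lambda>y. c * (1 + norm y) ^ k)" for c
    by (intro integrable_mult_right tame_measureD N)
  have sect: "tame (\<lambda>y. f (x, y))" for x
    by (intro tame_comp[OF f] tame_intros)
  have int: "integrable N (\<lambda>y. f (x, y))" for x
    by (intro tame_integrable N sect)
  show ?thesis
  proof (rule tameI)
    show "norm (\<integral>y. f (x, y) \<partial>N) \<le> (A * (\<integral>y. (1 + norm y) ^ k \<partial>N)) * (1 + norm x) ^ k" for x
    proof -
      have "norm (\<integral>y. f (x, y) \<partial>N) \<le> (\<integral>y. norm (f (x, y)) \<partial>N)" by (rule integral_norm_bound)
      also have "\<dots> \<le> (\<integral>y. A * (1 + norm x) ^ k * (1 + norm y) ^ k \<partial>N)"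
        by (intro integral_mono integrable_norm int mom bound)
      finally show ?thesis by (simp add: ac_simps)
    qed
    show "continuous_on UNIV (\<lambda>x. \<integral>y. f (x, y) \<partial>N)"
    proof (rule continuous_on_sequentiallyI)
      fix u :: "nat \<Rightarrow> 'a" and x
      assume u: "u \<longlonglongrightarrow> x"
      then have "Bseq u" by (intro convergent_imp_Bseq) (auto simp: convergent_def)
      then obtain K where K: "\<And>n. norm (u n) \<le> K" using BseqE by blast
      have meas: "(\<lambda>y. f (x, y)) \<in> borel_measurable N" for x using int[of x] by simp
      show "(\<lambda>n. \<integral>y. f (u n, y) \<partial>N) \<longlonglongrightarrow> (\<integral>y. f (x, y) \<partial>N)"
      proof (rule integral_dominated_convergence[where w="\<lambda>y. A * (1 + K) ^ k * (1 + norm y) ^ k"])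
        show "AE y in N. (\<lambda>n. f (u n, y)) \<longlonglongrightarrow> f (x, y)"
        proof (intro AE_I2)
          fix y :: 'b
          have "isCont f (x, y)" using tameD_continuous[OF f, of UNIV] continuous_on_eq_continuous_at by blast
          then show "(\<lambda>n. f (u n, y)) \<longlonglongrightarrow> f (x, y)"
            by (rule isCont_tendsto_compose) (intro tendsto_intros u)
        qed
        show "AE y in N. norm (f (u n, y)) \<le> A * (1 + K) ^ k * (1 + norm y) ^ k" for n
        proof (intro AE_I2)
          fix y :: 'b
          have "A * (1 + norm (u n)) ^ k * (1 + norm y) ^ k \<le> A * (1 + K) ^ k * (1 + norm y) ^ k"
            using K[of n] A(1) by (intro mult_right_mono mult_left_mono power_mono) auto
          with bound[of "u n" y] show "norm (f (u n, y)) \<le> A * (1 + K) ^ k * (1 + norm y) ^ k" by linarith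
        qed
      qed (use meas mom in auto)
    qed
  qed
qed

section \<open>The standard Gaussian measure\<close>

definition gauss_density :: "'a::euclidean_space \<Rightarrow> real" where
  "gauss_density x = (1 / sqrt (2 * pi)) ^ DIM('a) * exp (- (norm x)\<^sup>2 / 2)"

definition gauss :: "'a::euclidean_space measure" where
  "gauss = density lborel (\<lambda>x. ennreal (gauss_density x))"

lemma gauss_density_pos: "gauss_density x > 0"
  unfolding gauss_density_def by (simp add: zero_less_divide_iff)

lemma gauss_density_nonneg [simp]: "0 \<le> gauss_density x"
  by (rule less_imp_le[OF gauss_density_pos])

lemma continuous_on_gauss_density: "continuous_on S gauss_density"
  unfolding gauss_density_def [abs_def] by (intro continuous_intros) auto

lemma gauss_density_measurable [measurable]: "gauss_density \<in> borel_measurable borel"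
  by (intro borel_measurable_continuous_onI continuous_on_gauss_density)

lemma norm_sq_Basis: "(norm (x::'a::euclidean_space))\<^sup>2 = (\<Sum>b\<in>Basis. (x \<bullet> b)\<^sup>2)"
  unfolding norm_eq_sqrt_inner euclidean_inner[of x x]
  by (simp add: power2_eq_square sum_nonneg)

lemma prod_Basis_exp:
  fixes x :: "'a::euclidean_space"
  shows "(\<Prod>b\<in>(Basis::'a set). K * exp (- (x \<bullet> b)\<^sup>2 / r)) = K ^ DIM('a) * exp (- (norm x)\<^sup>2 / r)"
proof -
  have "(\<Sum>b\<in>Basis. - (x \<bullet> b)\<^sup>2 / r) = - (norm x)\<^sup>2 / r"
    unfolding norm_sq_Basis by (simp add: sum_negf sum_divide_distrib)
  then show ?thesis
    by (simp only: prod.distrib prod_constant exp_sum[OF finite_Basis, symmetric])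
qed

lemma gauss_density_prod: "gauss_density x = (\<Prod>b\<in>Basis. std_normal_density (x \<bullet> b))"
  unfolding gauss_density_def std_normal_density_def prod_Basis_exp ..

lemma sets_gauss [simp, measurable_cong]: "sets gauss = sets borel"
  by (simp add: gauss_def)

lemma space_gauss [simp]: "space gauss = UNIV"
  by (simp add: gauss_def)

lemma prob_space_gauss: "prob_space (gauss :: 'a::euclidean_space measure)"
proof
  have "emeasure (gauss :: 'a measure) (space gauss) = (\<integral>\<^sup>+x. ennreal (gauss_density (x::'a)) \<partial>lborel)"
    by (simp add: gauss_def emeasure_density)
  also have "\<dots> = (\<integral>\<^sup>+x. (\<Prod>b\<in>Basis. ennreal (std_normal_density ((x::'a) \<bullet> b))) \<partial>lborel)"
    by (simp add: gauss_density_prod prod_ennreal)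
  also have "\<dots> = (\<Prod>b\<in>(Basis::'a set). (\<integral>\<^sup>+t. ennreal (std_normal_density t) \<partial>lborel))"
    by (rule nn_integral_lborel_prod) auto
  also have "(\<integral>\<^sup>+t. ennreal (std_normal_density t) \<partial>lborel) = 1"
    using prob_space.emeasure_space_1[OF prob_space_normal_density[of 1 0]]
    by (simp add: emeasure_density)
  finally show "emeasure (gauss :: 'a measure) (space gauss) = 1" by simp
qed

lemma measure_gauss_UNIV [simp]: "measure (gauss :: 'a::euclidean_space measure) UNIV = 1"
  using prob_space.prob_space[OF prob_space_gauss] by simp

lemma integrable_gauss_iff:
  fixes f :: "'a::euclidean_space \<Rightarrow> 'b::euclidean_space"
  assumes "f \<in> borel_measurable borel"
  shows "integrable gauss f \<longleftrightarrow> integrable lborel (\<lambda>x. gauss_density x *\<^sub>R f x)"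
  unfolding gauss_def using assms by (subst integrable_density) auto

lemma integral_gauss:
  fixes f :: "'a::euclidean_space \<Rightarrow> 'b::euclidean_space"
  assumes "f \<in> borel_measurable borel"
  shows "integral\<^sup>L gauss f = (\<integral>x. gauss_density x *\<^sub>R f x \<partial>lborel)"
  unfolding gauss_def using assms by (subst integral_density) auto

text \<open>All moments are finite because polynomials are dominated by \<open>exp (|x|\<^sup>2 / 4)\<close>, and multiplying the
density by this factor gives a multiple of a product of normal densities of variance 2.\<close>

lemma tame_measure_gauss: "tame_measure (gauss :: 'a::euclidean_space measure)"
  unfolding tame_measure_def
proof (intro conjI allI prob_space_gauss sets_gauss)
  fix k :: nat
  have bound: "(1 + norm x) ^ k \<le> (fact k * exp 2) * exp ((norm x)\<^sup>2 / 4)" for x :: 'a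
  proof -
    \<comment> \<open>a single term of the exponential series\<close>
    have "(1 + norm x) ^ k /\<^sub>R fact k \<le> exp (1 + norm x)"
      using summable_exp_generic[of "1 + norm x"] unfolding exp_def
      by (intro sum_le_suminf[of _ "{k}", simplified]) auto
    then have "(1 + norm x) ^ k \<le> fact k * exp (1 + norm x)"
      by (simp add: field_simps)
    also have "1 + norm x \<le> 2 + (norm x)\<^sup>2 / 4"
      using zero_le_power2[of "norm x / 2 - 1"] by (simp add: power2_eq_square algebra_simps)
    then have "fact k * exp (1 + norm x) \<le> fact k * exp (2 + (norm x)\<^sup>2 / 4)"
      by simp
    finally show ?thesis by (simp add: exp_add)
  qed
  have fin: "integrable lborel (\<lambda>x. gauss_density x * exp ((norm (x::'a))\<^sup>2 / 4))"
  proof (rule integrableI_bounded)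
    have one: "ennreal (gauss_density x * exp ((norm x)\<^sup>2 / 4))
        = (\<Prod>b\<in>Basis. ennreal (sqrt 2 * normal_density 0 (sqrt 2) (x \<bullet> b)))" for x :: 'a
    proof -
      have "gauss_density x * exp ((norm x)\<^sup>2 / 4) = (1 / sqrt (2 * pi)) ^ DIM('a) * exp (- (norm x)\<^sup>2 / 4)"
        unfolding gauss_density_def by (simp add: exp_add[symmetric])
      also have "\<dots> = (\<Prod>b\<in>(Basis::'a set). (1 / sqrt (2 * pi)) * exp (- (x \<bullet> b)\<^sup>2 / 4))"
        unfolding prod_Basis_exp ..
      also have "\<dots> = (\<Prod>b\<in>(Basis::'a set). sqrt 2 * normal_density 0 (sqrt 2) (x \<bullet> b))"
      proof (intro prod.cong refl)
        fix b :: 'a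
        have "sqrt (2 * pi * (sqrt 2)\<^sup>2) = sqrt (2 * pi) * sqrt 2"
          by (simp only: real_sqrt_mult) simp
        then have "1 / sqrt (2 * pi) = sqrt 2 * (1 / sqrt (2 * pi * (sqrt 2)\<^sup>2))"
          by simp
        then show "(1 / sqrt (2 * pi)) * exp (- (x \<bullet> b)\<^sup>2 / 4) = sqrt 2 * normal_density 0 (sqrt 2) (x \<bullet> b)"
          by (simp add: normal_density_def)
      qed
      finally show ?thesis by (simp add: prod_ennreal)
    qed
    have "(\<integral>\<^sup>+x. ennreal (norm (gauss_density x * exp ((norm (x::'a))\<^sup>2 / 4))) \<partial>lborel)
        = (\<Prod>b\<in>(Basis::'a set). (\<integral>\<^sup>+t. ennreal (sqrt 2 * normal_density 0 (sqrt 2) t) \<partial>lborel))"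
      using nn_integral_lborel_prod[of "\<lambda>b t. ennreal (sqrt 2 * normal_density 0 (sqrt 2) t)"]
      by (simp add: one abs_mult)
    also have "\<dots> < \<infinity>"
    proof -
      have "(\<integral>\<^sup>+t. ennreal (sqrt 2 * normal_density 0 (sqrt 2) t) \<partial>lborel) < \<infinity>"
        using integrable_normal_density[of "sqrt 2" 0]
        by (subst nn_integral_eq_integral) auto
      then show ?thesis by (simp add: power_less_top_ennreal)
    qed
    finally show "(\<integral>\<^sup>+x. ennreal (norm (gauss_density x * exp ((norm (x::'a))\<^sup>2 / 4))) \<partial>lborel) < \<infinity>" .
  qed measurable
  have "integrable lborel (\<lambda>x. gauss_density x *\<^sub>R (1 + norm (x::'a)) ^ k)"
  proof (rule Bochner_Integration.integrable_bound)
    show "integrable lborel (\<lambda>x. (fact k * exp 2) * (gauss_density x * exp ((norm (x::'a))\<^sup>2 / 4)))"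
      by (intro integrable_mult_right fin)
    show "AE x in lborel. norm (gauss_density x *\<^sub>R (1 + norm (x::'a)) ^ k)
        \<le> norm ((fact k * exp 2) * (gauss_density x * exp ((norm x)\<^sup>2 / 4)))"
    proof (intro AE_I2)
      fix x :: 'a
      show "norm (gauss_density x *\<^sub>R (1 + norm (x::'a)) ^ k)
        \<le> norm ((fact k * exp 2) * (gauss_density x * exp ((norm x)\<^sup>2 / 4)))"
        using mult_left_mono[OF bound[of x] gauss_density_nonneg[of x]]
        by (simp add: abs_mult ac_simps)
    qed
  qed measurable
  then show "integrable gauss (\<lambda>x. (1 + norm (x::'a)) ^ k)"
    by (subst integrable_gauss_iff) measurable
qed

lemmas gauss_integrable = tame_integrable[OF tame_measure_gauss]

lemma integrable_gauss_const [simp]: "integrable gauss (\<lambda>x. c :: 'b::euclidean_space)"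
  by (rule gauss_integrable[OF tame_const])

section \<open>Shears and rotations\<close>

lemma nn_integral_lborel_translate:
  fixes c :: "'a::euclidean_space"
  assumes [measurable]: "f \<in> borel_measurable borel"
  shows "(\<integral>\<^sup>+y. f (y + c) \<partial>lborel) = (\<integral>\<^sup>+y. f y \<partial>lborel)"
proof -
  have "(\<integral>\<^sup>+y. f y \<partial>lborel) = (\<integral>\<^sup>+y. f y \<partial>distr lborel borel ((+) c))"
    by (simp only: lborel_distr_plus)
  then show ?thesis by (simp add: nn_integral_distr add.commute)
qed

text \<open>A shear translates each fibre, so it preserves the product of any measure with Lebesgue measure.
It is used twice: rotations are products of shears, and integration along a segment moves a point
by an amount that depends on the position on the segment.\<close>

lemma nn_integral_shear:
  fixes c :: "'s \<Rightarrow> 'a::euclidean_space"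
  assumes [measurable]: "f \<in> borel_measurable (S \<Otimes>\<^sub>M borel)" "c \<in> borel_measurable S"
  shows "(\<integral>\<^sup>+(s, y). f (s, y + c s) \<partial>(S \<Otimes>\<^sub>M lborel)) = (\<integral>\<^sup>+z. f z \<partial>(S \<Otimes>\<^sub>M lborel))"
proof -
  have "(\<integral>\<^sup>+(s, y). f (s, y + c s) \<partial>(S \<Otimes>\<^sub>M lborel)) = (\<integral>\<^sup>+s. \<integral>\<^sup>+y. f (s, y + c s) \<partial>lborel \<partial>S)"
    by (subst lborel.nn_integral_fst[symmetric]) auto
  also have "\<dots> = (\<integral>\<^sup>+s. \<integral>\<^sup>+y. f (s, y) \<partial>lborel \<partial>S)"
    by (intro nn_integral_cong nn_integral_lborel_translate) auto
  also have "\<dots> = (\<integral>\<^sup>+z. f z \<partial>(S \<Otimes>\<^sub>M lborel))"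
    by (subst lborel.nn_integral_fst) auto
  finally show ?thesis .
qed

lemma integrable_shear:
  fixes c :: "'s \<Rightarrow> 'a::euclidean_space" and f :: "'s \<times> 'a \<Rightarrow> real"
  assumes "integrable (S \<Otimes>\<^sub>M lborel) f" and [measurable]: "c \<in> borel_measurable S"
  shows "integrable (S \<Otimes>\<^sub>M lborel) (\<lambda>(s, y). f (s, y + c s))"
proof -
  have "f \<in> borel_measurable (S \<Otimes>\<^sub>M lborel)" using assms(1) by simp
  then have [measurable]: "f \<in> borel_measurable (S \<Otimes>\<^sub>M borel)"
    by (simp cong: measurable_cong_sets sets_pair_measure_cong)
  have "(\<integral>\<^sup>+(s, y). ennreal (norm (f (s, y + c s))) \<partial>(S \<Otimes>\<^sub>M lborel)) < \<infinity>"
    using nn_integral_shear[of "\<lambda>z. ennreal (norm (f z))" S c] assms(1)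
    unfolding integrable_iff_bounded by simp
  moreover have "(\<lambda>(s, y). f (s, y + c s)) \<in> borel_measurable (S \<Otimes>\<^sub>M lborel)"
    by measurable
  ultimately show ?thesis
    unfolding integrable_iff_bounded by (simp add: case_prod_beta')
qed

text \<open>A rotation by an angle other than \<open>\<pi>\<close> is a product of three shears: with \<open>t = - s / (1 + c)\<close>, shear
the first coordinate by \<open>t\<close>, the second by \<open>s\<close>, and the first by \<open>t\<close> again.\<close>

lemma nn_integral_rotate_lborel:
  fixes c s :: real and f :: "'a::euclidean_space \<times> 'a \<Rightarrow> ennreal"
  assumes f [measurable]: "f \<in> borel_measurable (borel \<Otimes>\<^sub>M borel)"
    and cs: "c\<^sup>2 + s\<^sup>2 = 1" "c \<noteq> -1"
  shows "(\<integral>\<^sup>+(x, y). f (c *\<^sub>R x - s *\<^sub>R y, s *\<^sub>R x + c *\<^sub>R y) \<partial>(lborel \<Otimes>\<^sub>M lborel))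
    = (\<integral>\<^sup>+z. f z \<partial>(lborel \<Otimes>\<^sub>M lborel))"
proof -
  have up: "(\<integral>\<^sup>+(x, y). h (x, y + t *\<^sub>R x) \<partial>(lborel \<Otimes>\<^sub>M lborel)) = (\<integral>\<^sup>+z. h z \<partial>(lborel \<Otimes>\<^sub>M lborel))"
    if "h \<in> borel_measurable (borel \<Otimes>\<^sub>M borel)" for h :: "'a \<times> 'a \<Rightarrow> ennreal" and t :: real
    using that nn_integral_shear[of h lborel "\<lambda>x. t *\<^sub>R x"]
    by (simp cong: measurable_cong_sets sets_pair_measure_cong)
  have swap: "(\<integral>\<^sup>+(x, y). h (y, x) \<partial>(lborel \<Otimes>\<^sub>M lborel)) = (\<integral>\<^sup>+z. h z \<partial>(lborel \<Otimes>\<^sub>M lborel))"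
    if [measurable]: "h \<in> borel_measurable (borel \<Otimes>\<^sub>M borel)" for h :: "'a \<times> 'a \<Rightarrow> ennreal"
    by (subst (2) lborel_pair.distr_pair_swap)
       (auto simp: nn_integral_distr case_prod_beta' intro!: nn_integral_cong)
  have left: "(\<integral>\<^sup>+(x, y). h (x + t *\<^sub>R y, y) \<partial>(lborel \<Otimes>\<^sub>M lborel)) = (\<integral>\<^sup>+z. h z \<partial>(lborel \<Otimes>\<^sub>M lborel))"
    if [measurable]: "h \<in> borel_measurable (borel \<Otimes>\<^sub>M borel)" for h :: "'a \<times> 'a \<Rightarrow> ennreal" and t :: real
    using swap[of "\<lambda>(x, y). h (y, x)"] up[of "\<lambda>(x, y). h (y, x)" t]
      swap[of "\<lambda>(x, y). h (y + t *\<^sub>R x, x)"] swap[OF that]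
    by (simp add: case_prod_beta')
  define t where "t = - s / (1 + c)"
  have c1: "1 + c \<noteq> 0" using cs(2) by auto
  have "s * s = (1 + c) * (1 - c)" using cs(1) by (simp add: power2_eq_square algebra_simps)
  then have t1: "1 + t * s = c" using c1 by (simp add: t_def field_simps)
  have "t + t * c = t * (1 + c)" by (simp add: algebra_simps)
  then have t2: "t + t * c = - s" using c1 by (simp add: t_def)
  have comb: "(x + t *\<^sub>R y) + t *\<^sub>R (y + s *\<^sub>R (x + t *\<^sub>R y)) = c *\<^sub>R x - s *\<^sub>R y"
    "y + s *\<^sub>R (x + t *\<^sub>R y) = s *\<^sub>R x + c *\<^sub>R y" for x y :: 'a
  proof -
    have "y + s *\<^sub>R (x + t *\<^sub>R y) = s *\<^sub>R x + (1 + t * s) *\<^sub>R y" by (simp add: algebra_simps)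
    then show 1: "y + s *\<^sub>R (x + t *\<^sub>R y) = s *\<^sub>R x + c *\<^sub>R y" by (simp only: t1)
    have "(x + t *\<^sub>R y) + t *\<^sub>R (s *\<^sub>R x + c *\<^sub>R y) = (1 + t * s) *\<^sub>R x + (t + t * c) *\<^sub>R y"
      by (simp add: algebra_simps)
    then show "(x + t *\<^sub>R y) + t *\<^sub>R (y + s *\<^sub>R (x + t *\<^sub>R y)) = c *\<^sub>R x - s *\<^sub>R y"
      unfolding 1 by (simp add: t1 t2)
  qed
  have "(\<integral>\<^sup>+(x, y). f (c *\<^sub>R x - s *\<^sub>R y, s *\<^sub>R x + c *\<^sub>R y) \<partial>(lborel \<Otimes>\<^sub>M lborel))
     = (\<integral>\<^sup>+(x, y). (\<lambda>(x, y). (\<lambda>(x, y). f (x + t *\<^sub>R y, y)) (x, y + s *\<^sub>R x)) (x + t *\<^sub>R y, y) \<partial>(lborel \<Otimes>\<^sub>M lborel))"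
    by (simp add: comb(2) comb(1)[unfolded comb(2)])
  also have "\<dots> = (\<integral>\<^sup>+(x, y). (\<lambda>(x, y). f (x + t *\<^sub>R y, y)) (x, y + s *\<^sub>R x) \<partial>(lborel \<Otimes>\<^sub>M lborel))"
    by (subst left) auto
  also have "\<dots> = (\<integral>\<^sup>+(x, y). f (x + t *\<^sub>R y, y) \<partial>(lborel \<Otimes>\<^sub>M lborel))"
    by (subst up) auto
  also have "\<dots> = (\<integral>\<^sup>+z. f z \<partial>(lborel \<Otimes>\<^sub>M lborel))"
    by (rule left) (rule f)
  finally show ?thesis .
qed

lemma gauss_pair_eq:
  "(gauss \<Otimes>\<^sub>M gauss :: ('a::euclidean_space \<times> 'a) measure)
     = density (lborel \<Otimes>\<^sub>M lborel) (\<lambda>(x, y). ennreal (gauss_density x * gauss_density y))"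
proof -
  have "sigma_finite_measure (gauss :: 'a measure)"
    using prob_space_gauss prob_space_imp_sigma_finite by blast
  then have "sigma_finite_measure (density (lborel::'a measure) (\<lambda>x. ennreal (gauss_density x)))"
    unfolding gauss_def .
  from pair_measure_density[OF _ _ _ this, of "\<lambda>x. ennreal (gauss_density x)" lborel]
  show ?thesis
    unfolding gauss_def by (simp add: sigma_finite_lborel ennreal_mult case_prod_beta')
qed

text \<open>The joint density of two independent standard Gaussian vectors depends on \<open>|x|\<^sup>2 + |y|\<^sup>2\<close> only.\<close>

lemma distr_gauss_rotate:
  fixes c s :: real
  assumes cs: "c\<^sup>2 + s\<^sup>2 = 1" "c \<noteq> -1"
  shows "distr (gauss \<Otimes>\<^sub>M gauss :: ('a::euclidean_space \<times> 'a) measure) (gauss \<Otimes>\<^sub>M gauss)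
      (\<lambda>z. (c *\<^sub>R fst z - s *\<^sub>R snd z, s *\<^sub>R fst z + c *\<^sub>R snd z)) = gauss \<Otimes>\<^sub>M gauss"
proof (rule measure_eqI)
  fix A :: "('a \<times> 'a) set"
  let ?r = "\<lambda>z::'a \<times> 'a. (c *\<^sub>R fst z - s *\<^sub>R snd z, s *\<^sub>R fst z + c *\<^sub>R snd z)"
  let ?d = "\<lambda>(x::'a, y::'a). ennreal (gauss_density x * gauss_density y)"
  assume "A \<in> sets (distr (gauss \<Otimes>\<^sub>M gauss) (gauss \<Otimes>\<^sub>M gauss) ?r)"
  then have A [measurable]: "A \<in> sets (borel \<Otimes>\<^sub>M borel)"
    by (simp cong: sets_pair_measure_cong)
  have norms: "(norm (c *\<^sub>R x - s *\<^sub>R y))\<^sup>2 + (norm (s *\<^sub>R x + c *\<^sub>R y))\<^sup>2 = (norm x)\<^sup>2 + (norm y)\<^sup>2" for x y :: 'a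
  proof -
    have "(norm (c *\<^sub>R x - s *\<^sub>R y))\<^sup>2 + (norm (s *\<^sub>R x + c *\<^sub>R y))\<^sup>2
        = (c\<^sup>2 + s\<^sup>2) * ((norm x)\<^sup>2 + (norm y)\<^sup>2)"
      unfolding power2_norm_eq_inner by (simp add: inner_simps power2_eq_square algebra_simps inner_commute)
    then show ?thesis by (simp add: cs)
  qed
  have inv: "?d (?r z) = ?d z" for z
  proof -
    have "gauss_density x * gauss_density y = (1 / sqrt (2 * pi)) ^ (DIM('a) + DIM('a)) * exp (- ((norm x)\<^sup>2 + (norm y)\<^sup>2) / 2)"
      for x y :: 'a
      unfolding gauss_density_def by (simp add: power_add exp_add[symmetric] add_divide_distrib[symmetric] field_simps)
    then show ?thesis by (simp only: case_prod_beta' norms fst_conv snd_conv)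
  qed
  have "emeasure (distr (gauss \<Otimes>\<^sub>M gauss) (gauss \<Otimes>\<^sub>M gauss) ?r) A = (\<integral>\<^sup>+z. indicator A (?r z) \<partial>(gauss \<Otimes>\<^sub>M gauss))"
    by (subst nn_integral_indicator[symmetric], simp, subst nn_integral_distr) auto
  also have "\<dots> = (\<integral>\<^sup>+z. ?d z * indicator A (?r z) \<partial>(lborel \<Otimes>\<^sub>M lborel))"
    unfolding gauss_pair_eq by (subst nn_integral_density) auto
  also have "\<dots> = (\<integral>\<^sup>+z. (\<lambda>z. ?d z * indicator A z) (?r z) \<partial>(lborel \<Otimes>\<^sub>M lborel))"
    using inv by simp
  also have "\<dots> = (\<integral>\<^sup>+z. ?d z * indicator A z \<partial>(lborel \<Otimes>\<^sub>M lborel))"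
    using nn_integral_rotate_lborel[OF _ cs, of "\<lambda>z. ?d z * indicator A z"]
    by (simp add: case_prod_beta')
  also have "\<dots> = (\<integral>\<^sup>+z. indicator A z \<partial>(gauss \<Otimes>\<^sub>M gauss))"
    unfolding gauss_pair_eq by (subst nn_integral_density) auto
  also have "\<dots> = emeasure (gauss \<Otimes>\<^sub>M gauss) A" by simp
  finally show "emeasure (distr (gauss \<Otimes>\<^sub>M gauss) (gauss \<Otimes>\<^sub>M gauss) ?r) A = emeasure (gauss \<Otimes>\<^sub>M gauss) A" .
qed simp

lemma integral_gauss_rotate:
  fixes f :: "'a::euclidean_space \<times> 'a \<Rightarrow> 'b::euclidean_space"
  assumes cs: "c\<^sup>2 + s\<^sup>2 = 1" "c \<noteq> -1" and f: "f \<in> borel_measurable borel"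
  shows "(\<integral>z. f (c *\<^sub>R fst z - s *\<^sub>R snd z, s *\<^sub>R fst z + c *\<^sub>R snd z) \<partial>(gauss \<Otimes>\<^sub>M gauss)) = (\<integral>z. f z \<partial>(gauss \<Otimes>\<^sub>M gauss))"
proof -
  have [measurable]: "f \<in> borel_measurable (borel \<Otimes>\<^sub>M borel)" using f by (simp add: borel_prod)
  show ?thesis
    by (subst (2) distr_gauss_rotate[OF cs, symmetric], subst integral_distr) auto
qed

section \<open>Integration by parts\<close>

definition unit_law :: "real measure" where
  "unit_law = density lborel (\<lambda>s. ennreal (indicator {0..1} s))"

lemma sets_unit_law [simp, measurable_cong]: "sets unit_law = sets borel"
  by (simp add: unit_law_def)

lemma space_unit_law [simp]: "space unit_law = UNIV"
  by (simp add: unit_law_def)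

lemma tame_measure_unit_law: "tame_measure unit_law"
  unfolding tame_measure_def
proof (intro conjI allI sets_unit_law)
  show "prob_space unit_law"
    by (rule prob_spaceI) (simp add: unit_law_def emeasure_density ennreal_indicator)
  show "integrable unit_law (\<lambda>x. (1 + norm x) ^ k)" for k
  proof -
    have "integrable lborel (\<lambda>x. indicator {0..1} x *\<^sub>R (1 + norm (x::real)) ^ k)"
      by (rule borel_integrable_compact) (auto intro!: continuous_intros)
    then show ?thesis
      unfolding unit_law_def by (subst integrable_density) auto
  qed
qed

lemma measure_unit_law_UNIV [simp]: "measure unit_law UNIV = 1"
  using prob_space.prob_space[OF tame_measureD(1)[OF tame_measure_unit_law]] by simp

lemma integrable_unit_law_const [simp]: "integrable unit_law (\<lambda>s. c :: 'b::euclidean_space)"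
  by (rule tame_integrable[OF tame_measure_unit_law tame_const])

lemma AE_unit_law: "AE s in unit_law. 0 \<le> s \<and> s \<le> 1"
  unfolding unit_law_def by (subst AE_density) (auto simp: indicator_def)

lemma integral_unit_law_derivative:
  fixes f :: "real \<Rightarrow> real"
  assumes "\<And>s. (f has_real_derivative f' s) (at s)" "continuous_on UNIV f'"
  shows "(\<integral>s. f' s \<partial>unit_law) = f 1 - f 0"
proof -
  have "f' \<in> borel_measurable borel" by (rule borel_measurable_continuous_onI[OF assms(2)])
  then have "(\<integral>s. f' s \<partial>unit_law) = (\<integral>s. indicator {0..1} s *\<^sub>R f' s \<partial>lborel)"
    unfolding unit_law_def by (subst integral_density) auto
  also have "\<dots> = f 1 - f 0"
  proof (rule integral_FTC_atLeastAtMost)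
    show "(f has_vector_derivative f' x) (at x within {0..1})" for x
      using has_field_derivative_at_within[OF assms(1)[of x]]
      by (simp add: has_real_derivative_iff_has_vector_derivative)
  qed (use assms(2) continuous_on_subset in auto)
  finally show ?thesis .
qed

text \<open>Interchanging the integration over the position \<open>s\<close> on a path with that over \<open>y\<close>, and undoing the
translation by \<open>c s\<close> inside. On the left the fundamental theorem of calculus applies to the inner
integral when the integrand is the derivative along the path; on the right only Gaussian
expectations remain. Both integration by parts and the derivative of a smoothed function are
obtained in this way, which avoids differentiating under the integral sign.\<close>

lemma integral_gauss_shear:
  fixes \<Psi> :: "real \<times> 'a::euclidean_space \<Rightarrow> real" and c :: "real \<Rightarrow> 'a"
  assumes tame: "tame \<Psi>" and c: "c \<in> borel_measurable borel"
  shows "(\<integral>y. \<integral>s. gauss_density (y + c s) * \<Psi> (s, y + c s) \<partial>unit_law \<partial>lborel)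
    = (\<integral>s. \<integral>y. \<Psi> (s, y) \<partial>gauss \<partial>unit_law)"
proof -
  have pair: "pair_sigma_finite unit_law (lborel :: 'a measure)"
    by (intro pair_sigma_finite.intro prob_space_imp_sigma_finite tame_measureD(1) tame_measure_unit_law sigma_finite_lborel)
  have \<Psi>: "\<Psi> \<in> borel_measurable borel" by (rule tameD_measurable[OF tame])
  then have [measurable]: "\<Psi> \<in> borel_measurable (borel \<Otimes>\<^sub>M borel)" by (simp add: borel_prod)
  have [measurable]: "c \<in> borel_measurable unit_law" using c by simp
  have int: "integrable (unit_law \<Otimes>\<^sub>M lborel) (\<lambda>z. gauss_density (snd z) * \<Psi> z)"
  proof (rule integrableI_bounded)
    have "(\<integral>\<^sup>+z. ennreal (norm (gauss_density (snd z) * \<Psi> z)) \<partial>(unit_law \<Otimes>\<^sub>M lborel))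
        = (\<integral>\<^sup>+s. \<integral>\<^sup>+y. ennreal (gauss_density y) * ennreal (norm (\<Psi> (s, y))) \<partial>lborel \<partial>unit_law)"
      by (subst lborel.nn_integral_fst[symmetric]) (auto simp: abs_mult ennreal_mult)
    also have "\<dots> = (\<integral>\<^sup>+s. \<integral>\<^sup>+y. ennreal (norm (\<Psi> (s, y))) \<partial>gauss \<partial>unit_law)"
      unfolding gauss_def by (intro nn_integral_cong) (subst nn_integral_density, auto)
    also have "\<dots> = (\<integral>\<^sup>+z. ennreal (norm (\<Psi> z)) \<partial>(unit_law \<Otimes>\<^sub>M gauss))"
      by (subst sigma_finite_measure.nn_integral_fst[OF prob_space_imp_sigma_finite[OF prob_space_gauss]]) auto
    also have "\<dots> < \<infinity>"
      using tame_integrable[OF tame_measure_pair[OF tame_measure_unit_law tame_measure_gauss] tame]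
      unfolding integrable_iff_bounded by simp
    finally show "(\<integral>\<^sup>+z. ennreal (norm (gauss_density (snd z) * \<Psi> z)) \<partial>(unit_law \<Otimes>\<^sub>M lborel)) < \<infinity>" .
  qed measurable
  have "integrable (unit_law \<Otimes>\<^sub>M lborel) (\<lambda>(s, y). gauss_density (y + c s) * \<Psi> (s, y + c s))"
    using integrable_shear[OF int, of c] by simp
  from pair_sigma_finite.Fubini_integral[OF pair this]
  have "(\<integral>y. \<integral>s. gauss_density (y + c s) * \<Psi> (s, y + c s) \<partial>unit_law \<partial>lborel)
      = (\<integral>s. \<integral>y. gauss_density (y + c s) * \<Psi> (s, y + c s) \<partial>lborel \<partial>unit_law)" .
  also have "\<dots> = (\<integral>s. \<integral>y. \<Psi> (s, y) \<partial>gauss \<partial>unit_law)"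
  proof (rule Bochner_Integration.integral_cong[OF refl])
    fix s :: real
    have [measurable]: "(\<lambda>y. \<Psi> (s, y)) \<in> borel_measurable borel" by measurable
    have "(\<integral>y. gauss_density (y + c s) * \<Psi> (s, y + c s) \<partial>lborel)
        = (\<integral>y. gauss_density y * \<Psi> (s, y) \<partial>distr lborel borel ((+) (c s)))"
      by (subst integral_distr) (auto simp: add.commute)
    then show "(\<integral>y. gauss_density (y + c s) * \<Psi> (s, y + c s) \<partial>lborel) = (\<integral>y. \<Psi> (s, y) \<partial>gauss)"
      by (simp add: lborel_distr_plus integral_gauss)
  qed
  finally show ?thesis .
qed

lemma has_derivative_line:
  fixes f :: "'a::euclidean_space \<Rightarrow> real"
  assumes "\<And>x. (f has_derivative (\<lambda>h. g x \<bullet> h)) (at x)" "(p has_vector_derivative p') (at s)"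
  shows "((\<lambda>s. f (p s)) has_real_derivative (g (p s) \<bullet> p')) (at s)"
proof -
  have "(p has_derivative (\<lambda>t. t *\<^sub>R p')) (at s)"
    using assms(2) by (simp add: has_vector_derivative_def)
  from has_derivative_compose[OF this assms(1)]
  show ?thesis by (simp add: has_field_derivative_def mult_commute_abs)
qed

lemma gauss_density_derivative:
  "(gauss_density has_derivative (\<lambda>h. (- gauss_density x *\<^sub>R x) \<bullet> h)) (at x)"
  unfolding gauss_density_def [abs_def] power2_norm_eq_inner
  by (rule derivative_eq_intros refl | simp)+
     (auto simp: fun_eq_iff inner_commute algebra_simps)

text \<open>The density times \<open>k\<close> has the same Lebesgue integral after translation by \<open>w\<close>. The difference is the
integral over a segment of the directional derivative, whose Gaussian expectation is therefore 0.\<close>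

lemma gauss_integration_by_parts:
  fixes k :: "'a::euclidean_space \<Rightarrow> real"
  assumes k: "tame k" "tame gk" "\<And>x. (k has_derivative (\<lambda>h. gk x \<bullet> h)) (at x)"
  shows "(\<integral>y. k y * (w \<bullet> y) \<partial>gauss) = (\<integral>y. gk y \<bullet> w \<partial>gauss)"
proof -
  let ?u = "\<lambda>y. gauss_density y * k y"
  let ?\<Psi> = "\<lambda>z::real \<times> 'a. gk (snd z) \<bullet> w - k (snd z) * (w \<bullet> snd z)"
  have du: "(?u has_derivative (\<lambda>h. (gauss_density y *\<^sub>R (gk y - k y *\<^sub>R y)) \<bullet> h)) (at y)" for y
    using has_derivative_mult[OF gauss_density_derivative k(3)]
    by (rule has_derivative_eq_rhs) (auto simp: fun_eq_iff algebra_simps)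
  have tame\<Psi>: "tame ?\<Psi>"
    by (intro tame_intros tame_comp[OF k(1)] tame_comp[OF k(2)])
  have ftc: "(\<integral>s. gauss_density (y + s *\<^sub>R w) * ?\<Psi> (s, y + s *\<^sub>R w) \<partial>unit_law) = ?u (y + w) - ?u y" for y
  proof -
    have "((\<lambda>s. ?u (y + s *\<^sub>R w)) has_real_derivative gauss_density (y + s *\<^sub>R w) * ?\<Psi> (s, y + s *\<^sub>R w)) (at s)" for s
    proof -
      have "((\<lambda>s. y + s *\<^sub>R w) has_vector_derivative w) (at s)"
        by (auto intro!: derivative_eq_intros)
      from has_derivative_line[OF du this] show ?thesis
        by (rule DERIV_cong) (simp add: algebra_simps inner_commute)
    qed
    moreover have "continuous_on UNIV (\<lambda>s. gauss_density (y + s *\<^sub>R w) * ?\<Psi> (s, y + s *\<^sub>R w))"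
      by (intro continuous_on_mult continuous_on_compose2[OF continuous_on_gauss_density]
          tameD_continuous[OF tame_comp[OF tame\<Psi>]] tame_intros continuous_intros) auto
    ultimately show ?thesis by (subst integral_unit_law_derivative) auto
  qed
  have intu: "integrable lborel ?u"
    using gauss_integrable[OF k(1)] integrable_gauss_iff[OF tameD_measurable[OF k(1)]] by simp
  have u_meas [measurable]: "?u \<in> borel_measurable borel" using intu by simp
  have shift: "integrable lborel (\<lambda>y. ?u (y + w))" "(\<integral>y. ?u (y + w) \<partial>lborel) = (\<integral>y. ?u y \<partial>lborel)"
  proof -
    have "integrable (distr lborel borel ((+) w)) ?u" using intu by (simp add: lborel_distr_plus)
    then show "integrable lborel (\<lambda>y. ?u (y + w))" by (subst (asm) integrable_distr_eq) (auto simp: add.commute)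
    have "(\<integral>y. ?u y \<partial>distr lborel borel ((+) w)) = (\<integral>y. ?u (y + w) \<partial>lborel)"
      by (subst integral_distr) (auto simp: add.commute)
    then show "(\<integral>y. ?u (y + w) \<partial>lborel) = (\<integral>y. ?u y \<partial>lborel)" by (simp add: lborel_distr_plus)
  qed
  have "0 = (\<integral>y. ?u (y + w) - ?u y \<partial>lborel)"
    using shift intu by simp
  also have "\<dots> = (\<integral>y. \<integral>s. gauss_density (y + s *\<^sub>R w) * ?\<Psi> (s, y + s *\<^sub>R w) \<partial>unit_law \<partial>lborel)"
    by (simp only: ftc)
  also have "\<dots> = (\<integral>s. \<integral>y. ?\<Psi> (s, y) \<partial>gauss \<partial>unit_law)"
    by (rule integral_gauss_shear[OF tame\<Psi>]) simp
  also have "\<dots> = (\<integral>y. gk y \<bullet> w \<partial>gauss) - (\<integral>y. k y * (w \<bullet> y) \<partial>gauss)"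
    by (simp add: Bochner_Integration.integral_diff gauss_integrable tame_intros k)
  finally show ?thesis by simp
qed

section \<open>The covariance identity\<close>

lemma marginal_rotation:
  fixes f :: "'a::euclidean_space \<Rightarrow> 'b::euclidean_space"
  assumes cs: "c\<^sup>2 + s\<^sup>2 = 1" "c \<noteq> -1" and f: "tame f"
  shows "(\<integral>x. \<integral>y. f (c *\<^sub>R x - s *\<^sub>R y) \<partial>gauss \<partial>gauss) = (\<integral>x. f x \<partial>gauss)"
proof -
  have t: "tame (\<lambda>z::'a\<times>'a. f (fst z))" "tame (\<lambda>z::'a\<times>'a. f (c *\<^sub>R fst z - s *\<^sub>R snd z))"
    by (intro tame_comp[OF f] tame_intros)+
  have "(\<integral>x. \<integral>y. f (c *\<^sub>R x - s *\<^sub>R y) \<partial>gauss \<partial>gauss) = (\<integral>z. f (c *\<^sub>R fst z - s *\<^sub>R snd z) \<partial>(gauss \<Otimes>\<^sub>M gauss))"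
    by (subst tame_Fubini(1)[OF tame_measure_gauss tame_measure_gauss t(2)]) simp
  also have "\<dots> = (\<integral>z. f (fst (z :: 'a \<times> 'a)) \<partial>(gauss \<Otimes>\<^sub>M gauss))"
    using integral_gauss_rotate[OF cs tameD_measurable[OF t(1)]] by simp
  also have "\<dots> = (\<integral>x. f x \<partial>gauss)"
    by (subst tame_Fubini(1)[OF tame_measure_gauss tame_measure_gauss t(1)])
       simp
  finally show ?thesis .
qed

text \<open>The quarter circle is parametrised by \<open>[0, 1]\<close> so that the integrals along it are expectations
under \<open>unit_law\<close>. With \<open>quarter_cos s = e\<^sup>-\<^sup>t\<close>, the pair \<open>quarter_cos s, quarter_sin s\<close> consists of the
coefficients \<open>e\<^sup>-\<^sup>t, sqrt(1 - e\<^sup>-\<^sup>2\<^sup>t)\<close> of the Ornstein-Uhlenbeck semigroup, and \<open>\<pi> / 2 quarter_sin s ds\<close>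
corresponds to \<open>e\<^sup>-\<^sup>t dt\<close>.\<close>

definition quarter_cos :: "real \<Rightarrow> real" where "quarter_cos s = cos (pi / 2 * s)"
definition quarter_sin :: "real \<Rightarrow> real" where "quarter_sin s = sin (pi / 2 * s)"

lemma tame_quarter: "tame f \<Longrightarrow> tame (\<lambda>x. quarter_cos (f x))" "tame f \<Longrightarrow> tame (\<lambda>x. quarter_sin (f x))"
  unfolding quarter_cos_def quarter_sin_def by (intro tame_intros; assumption)+

lemma quarter_square: "(quarter_cos s)\<^sup>2 + (quarter_sin s)\<^sup>2 = 1"
  by (simp add: quarter_cos_def quarter_sin_def)

lemma quarter_nonneg: "0 \<le> s \<Longrightarrow> s \<le> 1 \<Longrightarrow> 0 \<le> quarter_cos s" "0 \<le> s \<Longrightarrow> s \<le> 1 \<Longrightarrow> 0 \<le> quarter_sin s"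
proof -
  assume s: "0 \<le> s" "s \<le> 1"
  then have "0 \<le> pi / 2 * s" "pi / 2 * s \<le> pi / 2" by (auto simp: field_simps)
  moreover have "- (pi / 2) \<le> 0" "pi / 2 \<le> pi" by auto
  ultimately show "0 \<le> quarter_cos s" "0 \<le> quarter_sin s"
    unfolding quarter_cos_def quarter_sin_def by (intro cos_ge_zero sin_ge_zero; linarith)+
qed

lemma quarter_deriv:
  "(quarter_cos has_real_derivative - (pi / 2 * quarter_sin s)) (at s)"
  "(quarter_sin has_real_derivative pi / 2 * quarter_cos s) (at s)"
  unfolding quarter_cos_def [abs_def] quarter_sin_def [abs_def]
  by (auto intro!: derivative_eq_intros)

text \<open>The covariance is \<open>E[F(X) (H(X) - H(Y))]\<close> for independent \<open>X\<close> and \<open>Y\<close>. The points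
\<open>X\<^sub>s = C X + S Y\<close> on the quarter circle join \<open>X\<close> to \<open>Y\<close>, with velocity \<open>\<pi> / 2\<close> times \<open>V = C Y - S X\<close>. By
rotation invariance \<open>(X\<^sub>s, V)\<close> is again a pair of independent standard Gaussian vectors, and
\<open>X = C X\<^sub>s - S V\<close>. Integrating by parts in \<open>V\<close> turns \<open>F(X) (\<nabla>H(X\<^sub>s) \<bullet> V)\<close> into
\<open>- S \<nabla>F(C X\<^sub>s - S V) \<bullet> \<nabla>H(X\<^sub>s)\<close>.\<close>

lemma covariance_identity:
  fixes F H :: "'a::euclidean_space \<Rightarrow> real"
  assumes F: "tame F" "tame gF" "\<And>x. (F has_derivative (\<lambda>h. gF x \<bullet> h)) (at x)"
    and H: "tame H" "tame gH" "\<And>x. (H has_derivative (\<lambda>h. gH x \<bullet> h)) (at x)"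
  shows "(\<integral>x. F x * H x \<partial>gauss) - (\<integral>x. F x \<partial>gauss) * (\<integral>x. H x \<partial>gauss)
    = (\<integral>x. \<integral>s. \<integral>y. pi / 2 * quarter_sin s * (gF (quarter_cos s *\<^sub>R x - quarter_sin s *\<^sub>R y) \<bullet> gH x)
        \<partial>gauss \<partial>unit_law \<partial>gauss)"
proof -
  let ?C = quarter_cos and ?S = quarter_sin
  note tg = tame_measure_gauss and tu = tame_measure_unit_law
  note tgg = tame_measure_pair[OF tame_measure_gauss tame_measure_gauss]
  note ti = tame_intros tame_quarter tame_comp[OF F(1)] tame_comp[OF F(2)] tame_comp[OF H(1)] tame_comp[OF H(2)]
  let ?K = "\<lambda>z. \<lambda>s. F (fst z) * (pi / 2 * (gH (?C s *\<^sub>R fst z + ?S s *\<^sub>R snd z) \<bullet> (?C s *\<^sub>R snd z - ?S s *\<^sub>R fst z)))"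
  have path: "(\<integral>s. ?K (x, y) s \<partial>unit_law) = F x * (H y - H x)" for x y
  proof -
    have "((\<lambda>s. H (?C s *\<^sub>R x + ?S s *\<^sub>R y)) has_real_derivative
        pi / 2 * (gH (?C s *\<^sub>R x + ?S s *\<^sub>R y) \<bullet> (?C s *\<^sub>R y - ?S s *\<^sub>R x))) (at s)" for s
    proof -
      have "((\<lambda>s. ?C s *\<^sub>R x + ?S s *\<^sub>R y) has_vector_derivative
          (pi / 2) *\<^sub>R (?C s *\<^sub>R y - ?S s *\<^sub>R x)) (at s)"
        by (rule derivative_eq_intros quarter_deriv refl)+ (simp add: algebra_simps)
      from has_derivative_line[OF H(3) this] show ?thesis by simp
    qed
    moreover have "continuous_on UNIV (\<lambda>s. pi / 2 * (gH (?C s *\<^sub>R x + ?S s *\<^sub>R y) \<bullet> (?C s *\<^sub>R y - ?S s *\<^sub>R x)))"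
      by (intro tameD_continuous ti)
    ultimately have "(\<integral>s. pi / 2 * (gH (?C s *\<^sub>R x + ?S s *\<^sub>R y) \<bullet> (?C s *\<^sub>R y - ?S s *\<^sub>R x)) \<partial>unit_law)
        = H (?C 1 *\<^sub>R x + ?S 1 *\<^sub>R y) - H (?C 0 *\<^sub>R x + ?S 0 *\<^sub>R y)"
      by (rule integral_unit_law_derivative)
    then show ?thesis by (simp add: quarter_cos_def quarter_sin_def)
  qed
  have rot: "(\<integral>z. ?K z s \<partial>(gauss \<Otimes>\<^sub>M gauss)) =
      - (\<integral>x. \<integral>y. pi / 2 * ?S s * (gF (?C s *\<^sub>R x - ?S s *\<^sub>R y) \<bullet> gH x) \<partial>gauss \<partial>gauss)"
    if s: "0 \<le> s" "s \<le> 1" for s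
  proof -
    let ?f = "\<lambda>z. F (?C s *\<^sub>R fst z - ?S s *\<^sub>R snd z) * (pi / 2 * (gH (fst z) \<bullet> snd z))"
    have tf: "tame ?f" by (intro ti)
    have cs: "(?C s)\<^sup>2 + (- ?S s)\<^sup>2 = 1" "?C s \<noteq> -1"
      using quarter_square[of s] quarter_nonneg(1)[OF s] by auto
    have undo: "?C s *\<^sub>R (?C s *\<^sub>R x + ?S s *\<^sub>R y) - ?S s *\<^sub>R (?C s *\<^sub>R y - ?S s *\<^sub>R x) = x" for x y :: 'a
    proof -
      have "?C s *\<^sub>R (?C s *\<^sub>R x + ?S s *\<^sub>R y) - ?S s *\<^sub>R (?C s *\<^sub>R y - ?S s *\<^sub>R x) = ((?C s)\<^sup>2 + (?S s)\<^sup>2) *\<^sub>R x"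
        by (simp add: algebra_simps power2_eq_square)
      then show ?thesis by (simp add: quarter_square)
    qed
    have "(\<integral>z. ?K z s \<partial>(gauss \<Otimes>\<^sub>M gauss))
        = (\<integral>z. ?f (?C s *\<^sub>R fst z - (- ?S s) *\<^sub>R snd z, (- ?S s) *\<^sub>R fst z + ?C s *\<^sub>R snd z) \<partial>(gauss \<Otimes>\<^sub>M gauss))"
      using undo by (simp add: add.commute)
    also have "\<dots> = (\<integral>z. ?f z \<partial>(gauss \<Otimes>\<^sub>M gauss))"
      by (rule integral_gauss_rotate[OF cs tameD_measurable[OF tf]])
    also have "\<dots> = (\<integral>x. \<integral>y. ?f (x, y) \<partial>gauss \<partial>gauss)"
      by (rule tame_Fubini(1)[OF tg tg tf])
    also have "\<dots> = (\<integral>x. \<integral>y. - (pi / 2 * ?S s * (gF (?C s *\<^sub>R x - ?S s *\<^sub>R y) \<bullet> gH x)) \<partial>gauss \<partial>gauss)"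
    proof (rule Bochner_Integration.integral_cong[OF refl])
      fix x
      have d: "((\<lambda>y. F (?C s *\<^sub>R x - ?S s *\<^sub>R y)) has_derivative
          (\<lambda>h. (- ?S s *\<^sub>R gF (?C s *\<^sub>R x - ?S s *\<^sub>R y)) \<bullet> h)) (at y)" for y
      proof -
        have "((\<lambda>y. ?C s *\<^sub>R x - ?S s *\<^sub>R y) has_derivative (\<lambda>h. - (?S s *\<^sub>R h))) (at y)"
          by (auto intro!: derivative_eq_intros)
        from has_derivative_compose[OF this F(3)] show ?thesis by simp
      qed
      have "(\<integral>y. ?f (x, y) \<partial>gauss) = (\<integral>y. F (?C s *\<^sub>R x - ?S s *\<^sub>R y) * ((pi / 2) *\<^sub>R gH x \<bullet> y) \<partial>gauss)"
        by simp
      also have "\<dots> = (\<integral>y. (- ?S s *\<^sub>R gF (?C s *\<^sub>R x - ?S s *\<^sub>R y)) \<bullet> ((pi / 2) *\<^sub>R gH x) \<partial>gauss)"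
        by (rule gauss_integration_by_parts[OF _ _ d]) (intro ti)+
      finally show "(\<integral>y. ?f (x, y) \<partial>gauss) = (\<integral>y. - (pi / 2 * ?S s * (gF (?C s *\<^sub>R x - ?S s *\<^sub>R y) \<bullet> gH x)) \<partial>gauss)"
        by (simp add: algebra_simps)
    qed
    finally show ?thesis by simp
  qed
  have tprod: "tame (\<lambda>z::'a\<times>'a. F (fst z) * (H (fst z) - H (snd z)))"
    by (intro ti)
  have "(\<integral>x. F x * H x \<partial>gauss) - (\<integral>x. F x \<partial>gauss) * (\<integral>x. H x \<partial>gauss)
      = (\<integral>x. \<integral>y. F x * (H x - H y) \<partial>gauss \<partial>gauss)"
    by (simp add: Bochner_Integration.integral_diff gauss_integrable ti F H right_diff_distrib)
  also have "\<dots> = (\<integral>z. F (fst z) * (H (fst z) - H (snd z)) \<partial>(gauss \<Otimes>\<^sub>M gauss))"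
    by (subst tame_Fubini(1)[OF tg tg tprod]) simp
  also have "\<dots> = - (\<integral>z. \<integral>s. ?K z s \<partial>unit_law \<partial>(gauss \<Otimes>\<^sub>M gauss))"
  proof (subst Bochner_Integration.integral_minus[symmetric], rule Bochner_Integration.integral_cong[OF refl])
    fix z :: "'a \<times> 'a"
    show "F (fst z) * (H (fst z) - H (snd z)) = - (\<integral>s. ?K z s \<partial>unit_law)"
      using path[of "fst z" "snd z"] by (simp add: algebra_simps)
  qed
  also have "(\<integral>z. \<integral>s. ?K z s \<partial>unit_law \<partial>(gauss \<Otimes>\<^sub>M gauss)) = (\<integral>s. \<integral>z. ?K z s \<partial>(gauss \<Otimes>\<^sub>M gauss) \<partial>unit_law)"
  proof -
    have tK: "tame (\<lambda>p. ?K (fst p) (snd p))" by (intro ti)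
    show ?thesis
      using tame_Fubini(1)[OF tgg tu tK] tame_Fubini(2)[OF tgg tu tK] by simp
  qed
  also have "- \<dots> = (\<integral>s. \<integral>x. \<integral>y. pi / 2 * ?S s * (gF (?C s *\<^sub>R x - ?S s *\<^sub>R y) \<bullet> gH x) \<partial>gauss \<partial>gauss \<partial>unit_law)"
  proof (subst Bochner_Integration.integral_minus[symmetric], rule integral_cong_AE)
    show "(\<lambda>s. - (\<integral>z. ?K z s \<partial>(gauss \<Otimes>\<^sub>M gauss))) \<in> borel_measurable unit_law"
    proof -
      have "tame (\<lambda>p. ?K (snd p) (fst p))" by (intro ti)
      from tameD_measurable[OF tame_uminus[OF tame_integral[OF tgg this]]] show ?thesis by simp
    qed
    show "(\<lambda>s. \<integral>x. \<integral>y. pi / 2 * ?S s * (gF (?C s *\<^sub>R x - ?S s *\<^sub>R y) \<bullet> gH x) \<partial>gauss \<partial>gauss) \<in> borel_measurable unit_law"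
    proof -
      have "tame (\<lambda>p. pi / 2 * ?S (fst (fst p)) * (gF (?C (fst (fst p)) *\<^sub>R snd (fst p) - ?S (fst (fst p)) *\<^sub>R snd p) \<bullet> gH (snd (fst p))))"
        by (intro ti)
      from tameD_measurable[OF tame_integral[OF tg tame_integral[OF tg this]]] show ?thesis by simp
    qed
    show "AE s in unit_law. - (\<integral>z. ?K z s \<partial>(gauss \<Otimes>\<^sub>M gauss))
        = (\<integral>x. \<integral>y. pi / 2 * ?S s * (gF (?C s *\<^sub>R x - ?S s *\<^sub>R y) \<bullet> gH x) \<partial>gauss \<partial>gauss)"
      using AE_unit_law by eventually_elim (simp only: rot minus_minus)
  qed
  also have "\<dots> = (\<integral>x. \<integral>s. \<integral>y. pi / 2 * ?S s * (gF (?C s *\<^sub>R x - ?S s *\<^sub>R y) \<bullet> gH x) \<partial>gauss \<partial>unit_law \<partial>gauss)"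
  proof -
    have "tame (\<lambda>p. pi / 2 * ?S (fst (fst p)) * (gF (?C (fst (fst p)) *\<^sub>R snd (fst p) - ?S (fst (fst p)) *\<^sub>R snd p) \<bullet> gH (snd (fst p))))"
      by (intro ti)
    from tame_integral[OF tg this]
    have t2: "tame (\<lambda>p. \<integral>y. pi / 2 * ?S (fst p) * (gF (?C (fst p) *\<^sub>R snd p - ?S (fst p) *\<^sub>R y) \<bullet> gH (snd p)) \<partial>gauss)"
      by simp
    show ?thesis
      using tame_Fubini(1)[OF tu tg t2] tame_Fubini(2)[OF tu tg t2] by simp
  qed
  finally show ?thesis .
qed

section \<open>Gaussian smoothing\<close>

definition smoothing :: "real \<Rightarrow> ('a::euclidean_space \<Rightarrow> real) \<Rightarrow> 'a \<Rightarrow> real" where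
  "smoothing \<epsilon> f x = (\<integral>y. f (x + \<epsilon> *\<^sub>R y) \<partial>gauss)"

text \<open>The gradient of \<open>smoothing \<epsilon> f\<close>, with the derivative moved from \<open>f\<close> to the Gaussian density.\<close>

definition smoothing_gradient :: "real \<Rightarrow> ('a::euclidean_space \<Rightarrow> real) \<Rightarrow> 'a \<Rightarrow> 'a" where
  "smoothing_gradient \<epsilon> f x = (\<integral>y. (f (x + \<epsilon> *\<^sub>R y) / \<epsilon>) *\<^sub>R y \<partial>gauss)"

lemma tame_smoothing: "tame f \<Longrightarrow> tame (smoothing \<epsilon> f)"
proof -
  assume f: "tame f"
  have "tame (\<lambda>p. f (fst p + \<epsilon> *\<^sub>R snd p))" by (intro tame_comp[OF f] tame_intros)
  from tame_integral[OF tame_measure_gauss this] show ?thesis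
    unfolding smoothing_def [abs_def] by simp
qed

lemma tame_smoothing_gradient: "tame f \<Longrightarrow> tame (smoothing_gradient \<epsilon> f)"
proof -
  assume f: "tame f"
  have "tame (\<lambda>p. (f (fst p + \<epsilon> *\<^sub>R snd p) * inverse \<epsilon>) *\<^sub>R snd p)"
    by (intro tame_comp[OF f] tame_intros)
  from tame_integral[OF tame_measure_gauss this] show ?thesis
    unfolding smoothing_gradient_def [abs_def] by (simp add: divide_inverse)
qed

text \<open>Moving \<open>x\<close> by \<open>h\<close> translates the Gaussian density by \<open>h / \<epsilon>\<close>, and the density, unlike \<open>f\<close>, can be
differentiated along that translation.\<close>

lemma smoothing_increment:
  fixes f :: "'a::euclidean_space \<Rightarrow> real"
  assumes f: "tame f" and \<epsilon>: "\<epsilon> > 0"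
  shows "smoothing \<epsilon> f (x + h) - smoothing \<epsilon> f x
    = (\<integral>s. smoothing_gradient \<epsilon> f (x + s *\<^sub>R h) \<bullet> h \<partial>unit_law)"
proof -
  define v where "v = (1 / \<epsilon>) *\<^sub>R h"
  have h: "h = \<epsilon> *\<^sub>R v" using \<epsilon> by (simp add: v_def)
  let ?\<Psi> = "\<lambda>z::real \<times> 'a. f (x + fst z *\<^sub>R h + \<epsilon> *\<^sub>R snd z) * (snd z \<bullet> v)"
  note ti = tame_intros tame_comp[OF f]
  have t\<Psi>: "tame ?\<Psi>" by (intro ti)
  have fm: "(\<lambda>y. f (u + \<epsilon> *\<^sub>R y)) \<in> borel_measurable borel" for u
    by (intro tameD_measurable ti)
  have int1: "integrable lborel (\<lambda>y. gauss_density y * f (u + \<epsilon> *\<^sub>R y))" for u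
  proof -
    have "integrable gauss (\<lambda>y. f (u + \<epsilon> *\<^sub>R y))" by (intro gauss_integrable ti)
    then show ?thesis using integrable_gauss_iff[OF fm] by simp
  qed
  have val: "smoothing \<epsilon> f u = (\<integral>y. gauss_density y * f (u + \<epsilon> *\<^sub>R y) \<partial>lborel)" for u
    unfolding smoothing_def using integral_gauss[OF fm] by simp
  have int2: "integrable lborel (\<lambda>y. gauss_density (y - v) * f (x + \<epsilon> *\<^sub>R y))"
    and val2: "smoothing \<epsilon> f (x + h) = (\<integral>y. gauss_density (y - v) * f (x + \<epsilon> *\<^sub>R y) \<partial>lborel)"
  proof -
    have [measurable]: "(\<lambda>y. f (x + h + \<epsilon> *\<^sub>R y)) \<in> borel_measurable borel" by (rule fm)
    have eq: "x + h + \<epsilon> *\<^sub>R (- v + y) = x + \<epsilon> *\<^sub>R y" for y by (simp add: h algebra_simps)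
    have "integrable (distr lborel borel ((+) (-v))) (\<lambda>y. gauss_density y * f (x + h + \<epsilon> *\<^sub>R y))"
      using int1[of "x + h"] by (simp only: lborel_distr_plus)
    then show "integrable lborel (\<lambda>y. gauss_density (y - v) * f (x + \<epsilon> *\<^sub>R y))"
      by (subst (asm) integrable_distr_eq) (measurable, simp only: eq, simp)
    have "(\<integral>y. gauss_density y * f (x + h + \<epsilon> *\<^sub>R y) \<partial>distr lborel borel ((+) (-v)))
        = (\<integral>y. gauss_density (y - v) * f (x + \<epsilon> *\<^sub>R y) \<partial>lborel)"
      by (subst integral_distr) (measurable, simp only: eq, simp)
    then show "smoothing \<epsilon> f (x + h) = (\<integral>y. gauss_density (y - v) * f (x + \<epsilon> *\<^sub>R y) \<partial>lborel)"
      unfolding val by (simp only: lborel_distr_plus)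
  qed
  have ftc: "(\<integral>s. gauss_density (y + - s *\<^sub>R v) * ?\<Psi> (s, y + - s *\<^sub>R v) \<partial>unit_law)
      = gauss_density (y - v) * f (x + \<epsilon> *\<^sub>R y) - gauss_density y * f (x + \<epsilon> *\<^sub>R y)" for y
  proof -
    have "((\<lambda>s. gauss_density (y + - s *\<^sub>R v) * f (x + \<epsilon> *\<^sub>R y)) has_real_derivative
        gauss_density (y + - s *\<^sub>R v) * ?\<Psi> (s, y + - s *\<^sub>R v)) (at s)" for s
    proof -
      have eq: "x + s *\<^sub>R h + \<epsilon> *\<^sub>R (y + - s *\<^sub>R v) = x + \<epsilon> *\<^sub>R y" by (simp add: h algebra_simps)
      have "((\<lambda>s. y + - s *\<^sub>R v) has_vector_derivative - v) (at s)"
        by (auto intro!: derivative_eq_intros)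
      from DERIV_cmult_right[OF has_derivative_line[OF gauss_density_derivative this], of "f (x + \<epsilon> *\<^sub>R y)"]
      show ?thesis
        by (rule DERIV_cong) (simp only: fst_conv snd_conv eq, simp add: algebra_simps)
    qed
    moreover have "continuous_on UNIV (\<lambda>s. gauss_density (y + - s *\<^sub>R v) * ?\<Psi> (s, y + - s *\<^sub>R v))"
      by (intro continuous_on_mult continuous_on_compose2[OF continuous_on_gauss_density]
          tameD_continuous[OF tame_comp[OF t\<Psi>]] tame_intros continuous_intros) auto
    ultimately show ?thesis by (subst integral_unit_law_derivative) auto
  qed
  have "smoothing \<epsilon> f (x + h) - smoothing \<epsilon> f x
      = (\<integral>y. gauss_density (y - v) * f (x + \<epsilon> *\<^sub>R y) - gauss_density y * f (x + \<epsilon> *\<^sub>R y) \<partial>lborel)"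
    unfolding val2 val[of x] by (rule Bochner_Integration.integral_diff[OF int2 int1, symmetric])
  also have "\<dots> = (\<integral>y. \<integral>s. gauss_density (y + - s *\<^sub>R v) * ?\<Psi> (s, y + - s *\<^sub>R v) \<partial>unit_law \<partial>lborel)"
    by (simp only: ftc)
  also have "\<dots> = (\<integral>s. \<integral>y. ?\<Psi> (s, y) \<partial>gauss \<partial>unit_law)"
    by (rule integral_gauss_shear[OF t\<Psi>]) simp
  also have "\<dots> = (\<integral>s. smoothing_gradient \<epsilon> f (x + s *\<^sub>R h) \<bullet> h \<partial>unit_law)"
  proof (rule Bochner_Integration.integral_cong[OF refl])
    fix s :: real
    have "tame (\<lambda>y. (f (x + s *\<^sub>R h + \<epsilon> *\<^sub>R y) * inverse \<epsilon>) *\<^sub>R y)" by (intro ti)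
    then have "integrable gauss (\<lambda>y. (f (x + s *\<^sub>R h + \<epsilon> *\<^sub>R y) / \<epsilon>) *\<^sub>R y)"
      by (intro gauss_integrable) (simp add: divide_inverse)
    then show "(\<integral>y. ?\<Psi> (s, y) \<partial>gauss) = smoothing_gradient \<epsilon> f (x + s *\<^sub>R h) \<bullet> h"
      unfolding smoothing_gradient_def
      by (subst integral_inner_left[symmetric]) (auto simp: v_def)
  qed
  finally show ?thesis .
qed

lemma has_derivative_smoothing:
  fixes f :: "'a::euclidean_space \<Rightarrow> real"
  assumes f: "tame f" and \<epsilon>: "\<epsilon> > 0"
  shows "(smoothing \<epsilon> f has_derivative (\<lambda>h. smoothing_gradient \<epsilon> f x \<bullet> h)) (at x)"
proof -
  let ?g = "smoothing_gradient \<epsilon> f"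
  have tg: "tame ?g" by (rule tame_smoothing_gradient[OF f])
  have "isCont ?g x" using tameD_continuous[OF tg, of UNIV] continuous_on_eq_continuous_at by blast
  show ?thesis
    unfolding has_derivative_at_alt
  proof (intro conjI allI impI)
    show "bounded_linear (\<lambda>h. ?g x \<bullet> h)" by (rule bounded_linear_inner_right)
    fix e :: real assume "e > 0"
    with \<open>isCont ?g x\<close> obtain d where d: "d > 0" "\<And>z. dist z x < d \<Longrightarrow> dist (?g z) (?g x) < e"
      unfolding continuous_at_eps_delta by blast
    have "norm (smoothing \<epsilon> f z - smoothing \<epsilon> f x - ?g x \<bullet> (z - x)) \<le> e * norm (z - x)"
      if z: "norm (z - x) < d" for z
    proof -
      have int: "integrable unit_law (\<lambda>s. ?g (x + s *\<^sub>R (z - x)) \<bullet> (z - x))"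
        by (intro tame_integrable[OF tame_measure_unit_law] tame_intros tame_comp[OF tg])
      have "smoothing \<epsilon> f z - smoothing \<epsilon> f x - ?g x \<bullet> (z - x)
          = (\<integral>s. ?g (x + s *\<^sub>R (z - x)) \<bullet> (z - x) \<partial>unit_law) - ?g x \<bullet> (z - x)"
        using smoothing_increment[OF f \<epsilon>, of x "z - x"] by simp
      also have "\<dots> = (\<integral>s. (?g (x + s *\<^sub>R (z - x)) - ?g x) \<bullet> (z - x) \<partial>unit_law)"
        using int
        by (simp add: inner_diff_left Bochner_Integration.integral_diff)
      finally have eq: "smoothing \<epsilon> f z - smoothing \<epsilon> f x - ?g x \<bullet> (z - x)
          = (\<integral>s. (?g (x + s *\<^sub>R (z - x)) - ?g x) \<bullet> (z - x) \<partial>unit_law)" .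
      have "norm (\<integral>s. (?g (x + s *\<^sub>R (z - x)) - ?g x) \<bullet> (z - x) \<partial>unit_law)
          \<le> (\<integral>s. norm ((?g (x + s *\<^sub>R (z - x)) - ?g x) \<bullet> (z - x)) \<partial>unit_law)"
        by (rule integral_norm_bound)
      also have "\<dots> \<le> (\<integral>s. e * norm (z - x) \<partial>unit_law)"
      proof (rule integral_mono_AE)
        show "integrable unit_law (\<lambda>s. norm ((?g (x + s *\<^sub>R (z - x)) - ?g x) \<bullet> (z - x)))"
          by (intro tame_integrable[OF tame_measure_unit_law] tame_intros tame_comp[OF tg])
        show "AE s in unit_law. norm ((?g (x + s *\<^sub>R (z - x)) - ?g x) \<bullet> (z - x)) \<le> e * norm (z - x)"
          using AE_unit_law
        proof eventually_elim
          case (elim s)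
          have "norm (s *\<^sub>R (z - x)) \<le> norm (z - x)"
            using elim by (simp add: mult_left_le_one_le)
          then have "dist (x + s *\<^sub>R (z - x)) x < d" using z by (simp add: dist_norm)
          then have "norm (?g (x + s *\<^sub>R (z - x)) - ?g x) \<le> e" using d(2) less_imp_le unfolding dist_norm by blast
          then show ?case
            using Cauchy_Schwarz_ineq2[of "?g (x + s *\<^sub>R (z - x)) - ?g x" "z - x"]
              mult_right_mono[of "norm (?g (x + s *\<^sub>R (z - x)) - ?g x)" e "norm (z - x)"] by simp
        qed
      qed simp
      also have "\<dots> = e * norm (z - x)" by simp
      finally show ?thesis unfolding eq .
    qed
    with d(1) show "\<exists>d>0. \<forall>y. norm (y - x) < d \<longrightarrow>
        norm (smoothing \<epsilon> f y - smoothing \<epsilon> f x - ?g x \<bullet> (y - x)) \<le> e * norm (y - x)" by blast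
  qed
qed

text \<open>Local Lipschitz continuity with slope function \<open>k\<close>, together with a uniform quadratic error. The error
term is what products of Lipschitz fields produce, and it disappears in derivatives.\<close>

definition local_slope :: "('a::euclidean_space \<Rightarrow> real) \<Rightarrow> ('a \<Rightarrow> real) \<Rightarrow> real \<Rightarrow> bool" where
  "local_slope f k C \<longleftrightarrow> (\<forall>x h. \<bar>f (x + h) - f x\<bar> \<le> norm h * (k x + C * norm h))"

text \<open>The difference quotients in direction \<open>g\<close> converge to \<open>|g|\<^sup>2\<close>, and the hypothesis bounds their limit by
\<open>|g| K\<close>.\<close>

lemma gradient_le_slope:
  fixes f :: "'a::euclidean_space \<Rightarrow> real"
  assumes d: "(f has_derivative (\<lambda>h. g \<bullet> h)) (at x)"
    and b: "\<And>h. \<bar>f (x + h) - f x\<bar> \<le> norm h * (K + C * norm h)" and K: "K \<ge> 0"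
  shows "norm g \<le> K"
proof (cases "g = 0")
  case False
  have "((\<lambda>t. x + t *\<^sub>R g) has_derivative (\<lambda>t. t *\<^sub>R g)) (at 0)"
    by (auto intro!: derivative_eq_intros)
  from has_derivative_compose[OF this, of f "\<lambda>h. g \<bullet> h"] d
  have "((\<lambda>t. f (x + t *\<^sub>R g)) has_real_derivative (g \<bullet> g)) (at 0)"
    by (simp add: has_field_derivative_def mult_commute_abs)
  then have lim: "((\<lambda>t. (f (x + t *\<^sub>R g) - f x) / t) \<longlongrightarrow> g \<bullet> g) (at_right 0)"
    unfolding DERIV_def by (auto intro: filterlim_at_split[THEN iffD1, THEN conjunct2] simp: filterlim_at_split)
  have "((\<lambda>t. norm g * (K + C * (t * norm g))) \<longlongrightarrow> norm g * (K + C * (0 * norm g))) (at_right 0)"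
    by (intro tendsto_intros)
  then have lim2: "((\<lambda>t. norm g * (K + C * (t * norm g))) \<longlongrightarrow> norm g * K) (at_right 0)" by simp
  have "g \<bullet> g \<le> norm g * K"
  proof (rule tendsto_le[OF _ lim2 lim])
    show "\<forall>\<^sub>F t in at_right 0. (f (x + t *\<^sub>R g) - f x) / t \<le> norm g * (K + C * (t * norm g))"
      unfolding eventually_at_right_field
    proof (intro exI[of _ 1] conjI allI impI)
      fix t :: real assume t: "0 < t" "t < 1"
      have "f (x + t *\<^sub>R g) - f x \<le> t * norm g * (K + C * (t * norm g))"
        using b[of "t *\<^sub>R g"] t by simp
      then show "(f (x + t *\<^sub>R g) - f x) / t \<le> norm g * (K + C * (t * norm g))"
        using t by (simp add: divide_le_eq mult_ac)
    qed simp
  qed simp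
  then have "norm g * norm g \<le> norm g * K" by (simp add: power2_norm_eq_inner flip: power2_eq_square)
  with False show ?thesis by simp
qed (use K in simp)

lemma tame_local_slope:
  fixes f :: "'a::euclidean_space \<Rightarrow> real"
  assumes "local_slope f k C"
  shows "tame f"
proof (rule tameI)
  have b: "\<bar>f (x + h) - f x\<bar> \<le> norm h * (k x + C * norm h)" for x h
    using assms unfolding local_slope_def by blast
  show "continuous_on UNIV f"
    unfolding continuous_on_def
  proof (intro ballI)
    fix x :: 'a
    have "((\<lambda>z. norm (z - x) * (k x + C * norm (z - x))) \<longlongrightarrow> norm (x - x) * (k x + C * norm (x - x))) (at x)"
      by (intro tendsto_intros)
    then have "((\<lambda>z. norm (z - x) * (k x + C * norm (z - x))) \<longlongrightarrow> 0) (at x)" by simp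
    then have "((\<lambda>z. f z - f x) \<longlongrightarrow> 0) (at x)"
      by (rule Lim_null_comparison[rotated]) (use b[of x "_ - x"] in auto)
    then show "(f \<longlongrightarrow> f x) (at x within UNIV)" by (simp add: LIM_zero_iff)
  qed
  fix x :: 'a
  have "\<bar>f x\<bar> \<le> \<bar>f 0\<bar> + norm x * (\<bar>k 0\<bar> + \<bar>C\<bar> * norm x)"
  proof -
    have "norm x * (k 0 + C * norm x) \<le> norm x * (\<bar>k 0\<bar> + \<bar>C\<bar> * norm x)"
      by (intro mult_left_mono add_mono mult_right_mono) auto
    with b[of 0 x] show ?thesis by simp
  qed
  also have "\<dots> \<le> (\<bar>f 0\<bar> + \<bar>k 0\<bar> + \<bar>C\<bar>) * (1 + norm x) ^ 2"
  proof -
    have "1 \<le> (1 + norm x)^2" "norm x \<le> (1 + norm x)^2" "(norm x)\<^sup>2 \<le> (1 + norm x)^2"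
      by (auto simp: power2_eq_square algebra_simps)
    from mult_left_mono[OF this(1), of "\<bar>f 0\<bar>"] mult_left_mono[OF this(2), of "\<bar>k 0\<bar>"]
      mult_left_mono[OF this(3), of "\<bar>C\<bar>"]
    show ?thesis by (simp add: algebra_simps power2_eq_square)
  qed
  finally show "norm (f x) \<le> (\<bar>f 0\<bar> + \<bar>k 0\<bar> + \<bar>C\<bar>) * (1 + norm x) ^ 2" by simp
qed

definition gauss_norm_moment :: "'a::euclidean_space itself \<Rightarrow> nat \<Rightarrow> real" where
  "gauss_norm_moment _ n = (\<integral>y. norm (y::'a) ^ n \<partial>gauss)"

lemma smoothing_close:
  fixes f :: "'a::euclidean_space \<Rightarrow> real"
  assumes f: "local_slope f k C" and \<epsilon>: "\<epsilon> \<ge> 0"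
  shows "\<bar>smoothing \<epsilon> f x - f x\<bar> \<le>
    \<epsilon> * (k x * gauss_norm_moment TYPE('a) 1 + C * \<epsilon> * gauss_norm_moment TYPE('a) 2)"
proof -
  note tf = tame_local_slope[OF f]
  note int = gauss_integrable tame_intros tame_comp[OF tf]
  have "smoothing \<epsilon> f x - f x = (\<integral>y. f (x + \<epsilon> *\<^sub>R y) - f x \<partial>gauss)"
    unfolding smoothing_def
    by (subst Bochner_Integration.integral_diff) (auto intro!: int)
  also have "\<bar>\<dots>\<bar> \<le> (\<integral>y. \<bar>f (x + \<epsilon> *\<^sub>R y) - f x\<bar> \<partial>gauss)"
    by (rule integral_abs_bound)
  also have "\<dots> \<le> (\<integral>y. \<epsilon> * k x * norm (y::'a) ^ 1 + C * \<epsilon>\<^sup>2 * norm y ^ 2 \<partial>gauss)"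
  proof (rule integral_mono)
    show "\<bar>f (x + \<epsilon> *\<^sub>R y) - f x\<bar> \<le> \<epsilon> * k x * norm y ^ 1 + C * \<epsilon>\<^sup>2 * norm y ^ 2" for y
      using f[unfolded local_slope_def, rule_format, of x "\<epsilon> *\<^sub>R y"] \<epsilon>
      by (simp add: algebra_simps power2_eq_square)
  qed (intro int)+
  also have "\<dots> = \<epsilon> * k x * gauss_norm_moment TYPE('a) 1 + C * \<epsilon>\<^sup>2 * gauss_norm_moment TYPE('a) 2"
    unfolding gauss_norm_moment_def
    by (subst Bochner_Integration.integral_add) (auto intro!: int)
  finally show ?thesis by (simp add: algebra_simps power2_eq_square)
qed

text \<open>Smoothing averages increments, so its slope at \<open>x\<close> is at most the average of \<open>k (x + \<epsilon> y)\<close>, and this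
average is close to \<open>k x\<close> because \<open>k\<close> is Lipschitz.\<close>

lemma smoothing_gradient_bound:
  fixes f :: "'a::euclidean_space \<Rightarrow> real"
  assumes f: "local_slope f k C" and k: "\<And>x y. \<bar>k x - k y\<bar> \<le> M * norm (x - y)" "\<And>x. k x \<ge> 0"
    and C: "C \<ge> 0" and \<epsilon>: "\<epsilon> > 0"
  shows "norm (smoothing_gradient \<epsilon> f x) \<le> k x + M * \<epsilon> * gauss_norm_moment TYPE('a) 1"
proof -
  note tf = tame_local_slope[OF f]
  have tk: "tame k" by (rule tame_lipschitz[of _ M]) (use k in auto)
  note int = gauss_integrable tame_intros tame_comp[OF tf] tame_comp[OF tk]
  define K where "K = (\<integral>y. k (x + \<epsilon> *\<^sub>R y) \<partial>gauss)"
  have "norm (smoothing_gradient \<epsilon> f x) \<le> K"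
  proof (rule gradient_le_slope[OF has_derivative_smoothing[OF tf \<epsilon>]])
    fix h :: 'a
    have "smoothing \<epsilon> f (x + h) - smoothing \<epsilon> f x = (\<integral>y. f (x + \<epsilon> *\<^sub>R y + h) - f (x + \<epsilon> *\<^sub>R y) \<partial>gauss)"
      unfolding smoothing_def
      by (subst Bochner_Integration.integral_diff) (auto intro!: int simp: add_ac)
    also have "\<bar>\<dots>\<bar> \<le> (\<integral>y. \<bar>f (x + \<epsilon> *\<^sub>R y + h) - f (x + \<epsilon> *\<^sub>R y)\<bar> \<partial>gauss)"
      by (rule integral_abs_bound)
    also have "\<dots> \<le> (\<integral>y. norm h * (k (x + \<epsilon> *\<^sub>R y) + C * norm h) \<partial>gauss)"
      by (rule integral_mono) (use f[unfolded local_slope_def] in \<open>auto intro!: int\<close>)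
    also have "\<dots> = norm h * (K + C * norm h)"
      unfolding K_def
      by (subst Bochner_Integration.integral_mult_right_zero, subst Bochner_Integration.integral_add)
         (auto intro!: int)
    finally show "\<bar>smoothing \<epsilon> f (x + h) - smoothing \<epsilon> f x\<bar> \<le> norm h * (K + C * norm h)" .
  next
    show "K \<ge> 0" unfolding K_def using k(2) by simp
  qed
  also have "K \<le> (\<integral>y. k x + M * \<epsilon> * norm (y::'a) ^ 1 \<partial>gauss)"
    unfolding K_def
  proof (rule integral_mono)
    show "k (x + \<epsilon> *\<^sub>R y) \<le> k x + M * \<epsilon> * norm y ^ 1" for y
      using k(1)[of "x + \<epsilon> *\<^sub>R y" x] \<epsilon> by (simp add: mult_ac)
  qed (intro int)+
  also have "\<dots> = k x + M * \<epsilon> * gauss_norm_moment TYPE('a) 1"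
    unfolding gauss_norm_moment_def
    by (subst Bochner_Integration.integral_add) (auto intro!: int)
  finally show ?thesis .
qed

section \<open>The resolvent of the Ornstein-Uhlenbeck operator\<close>

text \<open>This is \<open>\<integral>\<^sub>0\<^sup>\<infinity> e\<^sup>-\<^sup>t P\<^sub>t f dt\<close> for the Ornstein-Uhlenbeck semigroup
\<open>P\<^sub>t f x = E f(e\<^sup>-\<^sup>t x - sqrt(1 - e\<^sup>-\<^sup>2\<^sup>t) Y)\<close>, that is, \<open>(I - L)\<^sup>-\<^sup>1 f\<close> for its generator \<open>L\<close>, after the
substitution \<open>e\<^sup>-\<^sup>t = quarter_cos s\<close>. It is an average with weights of total mass 1, hence positive and
contractive.\<close>

definition resolvent :: "('a::euclidean_space \<Rightarrow> 'b::euclidean_space) \<Rightarrow> 'a \<Rightarrow> 'b" where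
  "resolvent f x = (\<integral>p. (pi / 2 * quarter_sin (fst p)) *\<^sub>R
     f (quarter_cos (fst p) *\<^sub>R x - quarter_sin (fst p) *\<^sub>R snd p) \<partial>(unit_law \<Otimes>\<^sub>M gauss))"

lemma tame_measure_unit_gauss: "tame_measure (unit_law \<Otimes>\<^sub>M (gauss :: 'a::euclidean_space measure))"
  by (rule tame_measure_pair[OF tame_measure_unit_law tame_measure_gauss])

lemma tame_resolvent_integrand:
  assumes "tame f"
  shows "tame (\<lambda>p. (pi / 2 * quarter_sin (fst p)) *\<^sub>R f (quarter_cos (fst p) *\<^sub>R x - quarter_sin (fst p) *\<^sub>R snd p))"
  by (intro tame_intros tame_quarter tame_comp[OF assms])

lemma resolvent_integrable:
  assumes "tame f"
  shows "integrable (unit_law \<Otimes>\<^sub>M gauss) (\<lambda>p. (pi / 2 * quarter_sin (fst p)) *\<^sub>R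
     f (quarter_cos (fst p) *\<^sub>R x - quarter_sin (fst p) *\<^sub>R snd p))"
  by (intro tame_integrable[OF tame_measure_unit_gauss] tame_resolvent_integrand assms)

lemma tame_resolvent:
  assumes "tame f"
  shows "tame (resolvent f)"
proof -
  have "tame (\<lambda>q. (pi / 2 * quarter_sin (fst (snd q))) *\<^sub>R
      f (quarter_cos (fst (snd q)) *\<^sub>R fst q - quarter_sin (fst (snd q)) *\<^sub>R snd (snd q)))"
    by (intro tame_intros tame_quarter tame_comp[OF assms])
  from tame_integral[OF tame_measure_unit_gauss this] show ?thesis
    unfolding resolvent_def [abs_def] by simp
qed

lemma AE_unit_gauss:
  "AE p in unit_law \<Otimes>\<^sub>M (gauss :: 'a::euclidean_space measure). 0 \<le> quarter_sin (fst p) \<and> 0 \<le> quarter_cos (fst p)"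
proof -
  have [measurable]: "quarter_sin \<in> borel_measurable borel" "quarter_cos \<in> borel_measurable borel"
    by (intro tameD_measurable tame_quarter[OF tame_ident])+
  show ?thesis
  proof (rule pair_sigma_finite.AE_pair_measure[OF tame_measure_pair_sigma_finite[OF tame_measure_unit_law tame_measure_gauss]])
    show "AE x in unit_law. AE y in (gauss::'a measure). 0 \<le> quarter_sin (fst (x, y)) \<and> 0 \<le> quarter_cos (fst (x, y))"
      using AE_unit_law by eventually_elim (auto intro: quarter_nonneg)
  qed measurable
qed

lemma resolvent_add:
  assumes "tame f" "tame g"
  shows "resolvent (\<lambda>x. f x + g x) x = resolvent f x + resolvent g x"
  unfolding resolvent_def scaleR_add_right
  by (rule Bochner_Integration.integral_add[OF resolvent_integrable resolvent_integrable]) fact+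

lemma resolvent_cmult: "resolvent (\<lambda>x. c * f x) x = c * resolvent f x" for c :: real
  unfolding resolvent_def by (simp add: mult_ac)

lemma integral_unit_gauss_fst:
  assumes "tame f"
  shows "(\<integral>p. f (fst p) \<partial>(unit_law \<Otimes>\<^sub>M (gauss :: 'a::euclidean_space measure))) = (\<integral>s. f s \<partial>unit_law)"
proof -
  have t: "tame (\<lambda>p::real\<times>'a. f (fst p))" by (intro tame_comp[OF assms] tame_intros)
  show ?thesis
    using tame_Fubini(1)[OF tame_measure_unit_law tame_measure_gauss t]
    by simp
qed

lemma integral_quarter_weights:
  "(\<integral>s. pi / 2 * quarter_sin s \<partial>unit_law) = 1"
  "(\<integral>s. pi / 2 * quarter_sin s * quarter_cos s \<partial>unit_law) = 1 / 2"
proof -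
  have "(\<integral>s. pi / 2 * quarter_sin s \<partial>unit_law) = - quarter_cos 1 - - quarter_cos 0"
    by (rule integral_unit_law_derivative)
       (auto intro!: derivative_eq_intros quarter_deriv tameD_continuous tame_intros tame_quarter)
  then show "(\<integral>s. pi / 2 * quarter_sin s \<partial>unit_law) = 1" by (simp add: quarter_cos_def)
  have "(\<integral>s. pi / 2 * quarter_sin s * quarter_cos s \<partial>unit_law) = (quarter_sin 1)\<^sup>2 / 2 - (quarter_sin 0)\<^sup>2 / 2"
    by (rule integral_unit_law_derivative)
       (auto intro!: derivative_eq_intros quarter_deriv tameD_continuous tame_intros tame_quarter)
  then show "(\<integral>s. pi / 2 * quarter_sin s * quarter_cos s \<partial>unit_law) = 1 / 2" by (simp add: quarter_sin_def)
qed

lemma resolvent_const: "resolvent (\<lambda>x::'a::euclidean_space. c :: real) x = c"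
proof -
  have "tame (\<lambda>s. pi / 2 * quarter_sin s * c)" by (intro tame_intros tame_quarter)
  from integral_unit_gauss_fst[OF this, where 'a='a] show ?thesis
    unfolding resolvent_def using integral_quarter_weights(1) by auto
qed

lemma resolvent_mono:
  fixes f g :: "'a::euclidean_space \<Rightarrow> real"
  assumes "tame f" "tame g" "\<And>x. f x \<le> g x"
  shows "resolvent f x \<le> resolvent g x"
  unfolding resolvent_def
proof (rule integral_mono_AE[OF resolvent_integrable resolvent_integrable])
  show "AE p in unit_law \<Otimes>\<^sub>M gauss.
      (pi / 2 * quarter_sin (fst p)) *\<^sub>R f (quarter_cos (fst p) *\<^sub>R x - quarter_sin (fst p) *\<^sub>R snd p)
      \<le> (pi / 2 * quarter_sin (fst p)) *\<^sub>R g (quarter_cos (fst p) *\<^sub>R x - quarter_sin (fst p) *\<^sub>R snd p)"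
    using AE_unit_gauss by eventually_elim (auto intro!: mult_left_mono assms(3))
qed fact+

lemma norm_resolvent_le:
  assumes "tame f"
  shows "norm (resolvent f x) \<le> resolvent (\<lambda>x. norm (f x)) x"
proof -
  have "norm (resolvent f x) \<le> (\<integral>p. norm ((pi / 2 * quarter_sin (fst p)) *\<^sub>R
     f (quarter_cos (fst p) *\<^sub>R x - quarter_sin (fst p) *\<^sub>R snd p)) \<partial>(unit_law \<Otimes>\<^sub>M gauss))"
    unfolding resolvent_def by (rule integral_norm_bound)
  also have "\<dots> = resolvent (\<lambda>x. norm (f x)) x"
    unfolding resolvent_def
  proof (rule integral_cong_AE)
    show "AE p in unit_law \<Otimes>\<^sub>M gauss. norm ((pi / 2 * quarter_sin (fst p)) *\<^sub>R
       f (quarter_cos (fst p) *\<^sub>R x - quarter_sin (fst p) *\<^sub>R snd p))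
       = (pi / 2 * quarter_sin (fst p)) *\<^sub>R norm (f (quarter_cos (fst p) *\<^sub>R x - quarter_sin (fst p) *\<^sub>R snd p))"
      using AE_unit_gauss by eventually_elim auto
  qed (rule borel_measurable_integrable integrable_norm resolvent_integrable tame_norm assms)+
  finally show ?thesis .
qed

lemma resolvent_bounded:
  assumes "tame f" "\<And>x. norm (f x) \<le> B"
  shows "norm (resolvent f x) \<le> B"
  using norm_resolvent_le[OF assms(1), of x]
    resolvent_mono[OF tame_norm[OF assms(1)] tame_const[of B] assms(2), of x]
  by (simp add: resolvent_const)

text \<open>Jensen's inequality, from the positivity of the average of \<open>(f - c)\<^sup>2\<close>.\<close>

lemma resolvent_square_le:
  fixes f :: "'a::euclidean_space \<Rightarrow> real"
  assumes f: "tame f"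
  shows "(resolvent f x)\<^sup>2 \<le> resolvent (\<lambda>x. (f x)\<^sup>2) x"
proof -
  define c where "c = resolvent f x"
  note ti = tame_intros f
  have "0 \<le> resolvent (\<lambda>x. (f x - c)\<^sup>2) x"
    using resolvent_mono[of "\<lambda>x. 0" "\<lambda>x. (f x - c)\<^sup>2" x] by (simp add: resolvent_const ti)
  also have "resolvent (\<lambda>x. (f x - c)\<^sup>2) x = resolvent (\<lambda>x. (f x)\<^sup>2 + ((- 2 * c) * f x + c\<^sup>2)) x"
    by (simp add: power2_diff algebra_simps)
  also have "\<dots> = resolvent (\<lambda>x. (f x)\<^sup>2) x + ((- 2 * c) * c + c\<^sup>2)"
    by (subst resolvent_add, (intro ti)+, subst resolvent_add, (intro ti)+, subst resolvent_cmult)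
       (simp add: resolvent_const c_def)
  finally show ?thesis by (simp add: c_def power2_eq_square)
qed

text \<open>The Gaussian measure is invariant under the semigroup.\<close>

lemma integral_resolvent:
  fixes f :: "'a::euclidean_space \<Rightarrow> real"
  assumes f: "tame f"
  shows "(\<integral>x. resolvent f x \<partial>gauss) = (\<integral>x. f x \<partial>gauss)"
proof -
  note ti = tame_intros tame_quarter tame_comp[OF f]
  note tu = tame_measure_unit_law and tg = tame_measure_gauss
  let ?k = "\<lambda>s x y. pi / 2 * quarter_sin s * f (quarter_cos s *\<^sub>R x - quarter_sin s *\<^sub>R y)"
  have t3: "tame (\<lambda>q. ?k (fst (fst q)) (snd (fst q)) (snd q))" by (intro ti)
  have t2: "tame (\<lambda>q. \<integral>y. ?k (fst q) (snd q) y \<partial>gauss)"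
    using tame_integral[OF tg t3] by simp
  have "resolvent f x = (\<integral>s. \<integral>y. ?k s x y \<partial>gauss \<partial>unit_law)" for x
    unfolding resolvent_def using tame_Fubini(1)[OF tu tg tame_resolvent_integrand[OF f, of x]] by simp
  then have "(\<integral>x. resolvent f x \<partial>gauss) = (\<integral>x. \<integral>s. \<integral>y. ?k s x y \<partial>gauss \<partial>unit_law \<partial>gauss)"
    by (simp only:)
  also have "\<dots> = (\<integral>s. \<integral>x. \<integral>y. ?k s x y \<partial>gauss \<partial>gauss \<partial>unit_law)"
    using tame_Fubini(1)[OF tu tg t2] tame_Fubini(2)[OF tu tg t2] by simp
  also have "\<dots> = (\<integral>s. pi / 2 * quarter_sin s * (\<integral>x. f x \<partial>gauss) \<partial>unit_law)"
  proof (rule integral_cong_AE)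
    have "tame (\<lambda>s. \<integral>x. \<integral>y. ?k s x y \<partial>gauss \<partial>gauss)"
      using tame_integral[OF tg t2] by simp
    from tameD_measurable[OF this]
    show "(\<lambda>s. \<integral>x. \<integral>y. ?k s x y \<partial>gauss \<partial>gauss) \<in> borel_measurable unit_law" by simp
    have "tame (\<lambda>s. pi / 2 * quarter_sin s * (\<integral>x. f x \<partial>gauss))" by (intro ti)
    from tameD_measurable[OF this]
    show "(\<lambda>s. pi / 2 * quarter_sin s * (\<integral>x. f x \<partial>gauss)) \<in> borel_measurable unit_law" by simp
    show "AE s in unit_law. (\<integral>x. \<integral>y. ?k s x y \<partial>gauss \<partial>gauss) = pi / 2 * quarter_sin s * (\<integral>x. f x \<partial>gauss)"
      using AE_unit_law
    proof eventually_elim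
      case (elim s)
      then have "quarter_cos s \<noteq> -1" using quarter_nonneg(1)[of s] by auto
      from marginal_rotation[OF quarter_square this f] show ?case by simp
    qed
  qed
  also have "\<dots> = (\<integral>x. f x \<partial>gauss)"
    using integral_quarter_weights(1) by simp
  finally show ?thesis .
qed

text \<open>The semigroup contracts distances by \<open>e\<^sup>-\<^sup>t\<close>, and \<open>\<integral>\<^sub>0\<^sup>\<infinity> e\<^sup>-\<^sup>2\<^sup>t dt = 1 / 2\<close>.\<close>

lemma resolvent_lipschitz:
  assumes f: "\<And>x y. norm (f x - f y) \<le> L * norm (x - y)"
  shows "norm (resolvent f x - resolvent f y) \<le> L / 2 * norm (x - y)"
proof -
  have tf: "tame f" by (rule tame_lipschitz[OF f])
  let ?a = "\<lambda>x p. f (quarter_cos (fst p) *\<^sub>R x - quarter_sin (fst p) *\<^sub>R snd p)"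
  let ?w = "\<lambda>p. pi / 2 * quarter_sin (fst p)"
  note int = resolvent_integrable[OF tf]
  have "norm (resolvent f x - resolvent f y) = norm (\<integral>p. ?w p *\<^sub>R ?a x p - ?w p *\<^sub>R ?a y p \<partial>(unit_law \<Otimes>\<^sub>M gauss))"
    unfolding resolvent_def by (subst Bochner_Integration.integral_diff[OF int int]) simp
  also have "\<dots> \<le> (\<integral>p. norm (?w p *\<^sub>R ?a x p - ?w p *\<^sub>R ?a y p) \<partial>(unit_law \<Otimes>\<^sub>M gauss))"
    by (rule integral_norm_bound)
  also have "\<dots> \<le> (\<integral>p. L * norm (x - y) * (?w p * quarter_cos (fst p)) \<partial>(unit_law \<Otimes>\<^sub>M (gauss :: 'a measure)))"
  proof (rule integral_mono_AE)
    show "integrable (unit_law \<Otimes>\<^sub>M gauss) (\<lambda>p. norm (?w p *\<^sub>R ?a x p - ?w p *\<^sub>R ?a y p))"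
      by (intro integrable_norm Bochner_Integration.integrable_diff int)
    show "integrable (unit_law \<Otimes>\<^sub>M (gauss :: 'a measure)) (\<lambda>p. L * norm (x - y) * (?w p * quarter_cos (fst p)))"
      by (intro tame_integrable[OF tame_measure_unit_gauss] tame_intros tame_quarter)
    show "AE p in unit_law \<Otimes>\<^sub>M gauss. norm (?w p *\<^sub>R ?a x p - ?w p *\<^sub>R ?a y p)
        \<le> L * norm (x - y) * (?w p * quarter_cos (fst p))"
      using AE_unit_gauss
    proof eventually_elim
      case (elim p)
      have "norm (?a x p - ?a y p) \<le> L * norm (quarter_cos (fst p) *\<^sub>R (x - y))"
        using f[of "quarter_cos (fst p) *\<^sub>R x - quarter_sin (fst p) *\<^sub>R snd p"
            "quarter_cos (fst p) *\<^sub>R y - quarter_sin (fst p) *\<^sub>R snd p"]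
        by (simp add: scaleR_diff_right)
      then have "?w p * norm (?a x p - ?a y p) \<le> ?w p * (L * (quarter_cos (fst p) * norm (x - y)))"
        using elim by (intro mult_left_mono) auto
      moreover have "norm (?w p *\<^sub>R ?a x p - ?w p *\<^sub>R ?a y p) = ?w p * norm (?a x p - ?a y p)"
        using elim by (simp flip: scaleR_diff_right)
      ultimately show ?case by (simp add: mult_ac)
    qed
  qed
  also have "\<dots> = L / 2 * norm (x - y)"
  proof -
    have "tame (\<lambda>s. pi / 2 * quarter_sin s * quarter_cos s)" by (intro tame_intros tame_quarter)
    from integral_unit_gauss_fst[OF this, where 'a='a] show ?thesis
      by (simp only: Bochner_Integration.integral_mult_right_zero integral_quarter_weights(2))
  qed
  finally show ?thesis .
qed

lemma integral_norm_resolvent_le: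
  assumes f: "tame f"
  shows "(\<integral>x. norm (resolvent f x) \<partial>gauss) \<le> (\<integral>x. norm (f x) \<partial>gauss)"
proof -
  have "(\<integral>x. norm (resolvent f x) \<partial>gauss) \<le> (\<integral>x. resolvent (\<lambda>x. norm (f x)) x \<partial>gauss)"
    by (intro integral_mono gauss_integrable tame_norm tame_resolvent f norm_resolvent_le)
  then show ?thesis by (simp add: integral_resolvent tame_norm f)
qed

lemma integral_norm_sq_resolvent_le:
  assumes f: "tame f"
  shows "(\<integral>x. (norm (resolvent f x))\<^sup>2 \<partial>gauss) \<le> (\<integral>x. (norm (f x))\<^sup>2 \<partial>gauss)"
proof -
  have "(\<integral>x. (norm (resolvent f x))\<^sup>2 \<partial>gauss) \<le> (\<integral>x. resolvent (\<lambda>x. (norm (f x))\<^sup>2) x \<partial>gauss)"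
  proof (intro integral_mono gauss_integrable tame_power tame_norm tame_resolvent f)
    fix x
    have "(norm (resolvent f x))\<^sup>2 \<le> (resolvent (\<lambda>x. norm (f x)) x)\<^sup>2"
      by (intro power_mono norm_resolvent_le f) simp
    also have "\<dots> \<le> resolvent (\<lambda>x. (norm (f x))\<^sup>2) x"
      by (rule resolvent_square_le[OF tame_norm[OF f]])
    finally show "(norm (resolvent f x))\<^sup>2 \<le> resolvent (\<lambda>x. (norm (f x))\<^sup>2) x" .
  qed
  then show ?thesis by (simp add: integral_resolvent tame_norm tame_power f)
qed

theorem gauss_covariance:
  fixes F H :: "'a::euclidean_space \<Rightarrow> real"
  assumes F: "tame F" "tame gF" "\<And>x. (F has_derivative (\<lambda>h. gF x \<bullet> h)) (at x)"
    and H: "tame H" "tame gH" "\<And>x. (H has_derivative (\<lambda>h. gH x \<bullet> h)) (at x)"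
  shows "(\<integral>x. F x * H x \<partial>gauss) - (\<integral>x. F x \<partial>gauss) * (\<integral>x. H x \<partial>gauss) = (\<integral>x. resolvent gF x \<bullet> gH x \<partial>gauss)"
proof -
  note tu = tame_measure_unit_law and tg = tame_measure_gauss
  have "(\<integral>s. \<integral>y. pi / 2 * quarter_sin s * (gF (quarter_cos s *\<^sub>R x - quarter_sin s *\<^sub>R y) \<bullet> gH x) \<partial>gauss \<partial>unit_law)
      = resolvent gF x \<bullet> gH x" for x
  proof -
    let ?k = "\<lambda>p. (pi / 2 * quarter_sin (fst p)) *\<^sub>R gF (quarter_cos (fst p) *\<^sub>R x - quarter_sin (fst p) *\<^sub>R snd p)"
    have tk: "tame ?k" by (rule tame_resolvent_integrand[OF F(2)])
    have "resolvent gF x \<bullet> gH x = (\<integral>p. ?k p \<bullet> gH x \<partial>(unit_law \<Otimes>\<^sub>M gauss))"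
      unfolding resolvent_def
      by (rule integral_inner_left[symmetric]) (rule resolvent_integrable[OF F(2)])
    also have "\<dots> = (\<integral>s. \<integral>y. ?k (s, y) \<bullet> gH x \<partial>gauss \<partial>unit_law)"
      by (rule tame_Fubini(1)[OF tu tg]) (intro tame_intros tk)
    finally show ?thesis by simp
  qed
  then show ?thesis unfolding covariance_identity[OF assms] by simp
qed

section \<open>The Poincare inequality\<close>

definition gauss_variance :: "('a::euclidean_space \<Rightarrow> real) \<Rightarrow> real" where
  "gauss_variance f = (\<integral>x. (f x)\<^sup>2 \<partial>gauss) - (\<integral>x. f x \<partial>gauss)\<^sup>2"

lemma gauss_variance_centred:
  fixes f :: "'a::euclidean_space \<Rightarrow> real"
  assumes "tame f"
  shows "(\<integral>x. (f x - (\<integral>x. f x \<partial>gauss))\<^sup>2 \<partial>gauss) = gauss_variance f"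
proof -
  show ?thesis
    unfolding gauss_variance_def
    by (rule prob_space.variance_eq[OF prob_space_gauss]) (intro gauss_integrable tame_intros assms)+
qed

text \<open>The covariance identity with \<open>F = H\<close>, the elementary bound \<open>u \<bullet> v \<le> (|u|\<^sup>2 + |v|\<^sup>2) / 2\<close>, and the
contractivity of the resolvent.\<close>

lemma gauss_poincare_smooth:
  fixes f :: "'a::euclidean_space \<Rightarrow> real"
  assumes f: "tame f" "tame g" "\<And>x. (f has_derivative (\<lambda>h. g x \<bullet> h)) (at x)"
  shows "gauss_variance f \<le> (\<integral>x. (norm (g x))\<^sup>2 \<partial>gauss)"
proof -
  note int = gauss_integrable tame_intros tame_resolvent f(2)
  have "gauss_variance f = (\<integral>x. resolvent g x \<bullet> g x \<partial>gauss)"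
    using gauss_covariance[OF f f] by (simp add: gauss_variance_def power2_eq_square)
  also have "\<dots> \<le> (\<integral>x. ((norm (resolvent g x))\<^sup>2 + (norm (g x))\<^sup>2) / 2 \<partial>gauss)"
  proof (intro integral_mono integrable_divide_zero impI)
    fix x
    have "resolvent g x \<bullet> g x \<le> norm (resolvent g x) * norm (g x)" by (rule norm_cauchy_schwarz)
    also have "\<dots> \<le> ((norm (resolvent g x))\<^sup>2 + (norm (g x))\<^sup>2) / 2"
      using sum_squares_bound[of "norm (resolvent g x)" "norm (g x)"] by simp
    finally show "resolvent g x \<bullet> g x \<le> ((norm (resolvent g x))\<^sup>2 + (norm (g x))\<^sup>2) / 2" .
  qed (intro int)+
  also have "\<dots> = ((\<integral>x. (norm (resolvent g x))\<^sup>2 \<partial>gauss) + (\<integral>x. (norm (g x))\<^sup>2 \<partial>gauss)) / 2"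
    by (simp, subst Bochner_Integration.integral_add) (auto intro!: int)
  also have "\<dots> \<le> (\<integral>x. (norm (g x))\<^sup>2 \<partial>gauss)"
    using integral_norm_sq_resolvent_le[OF f(2)] by simp
  finally show ?thesis .
qed

text \<open>The variances of the approximations converge by dominated convergence, with a dominating function that
is tame. The error factor \<open>w\<close> may depend on the point.\<close>

lemma gauss_moments_tendsto:
  fixes f w :: "'a::euclidean_space \<Rightarrow> real"
  assumes f: "tame f" "\<And>n. tame (fn n)" and w: "tame w"
    and e: "e \<longlonglongrightarrow> 0" "\<And>n. 0 \<le> e n" "\<And>n. e n \<le> 1"
    and close: "\<And>n x. \<bar>fn n x - f x\<bar> \<le> e n * w x"
  shows "(\<lambda>n. fn n x) \<longlonglongrightarrow> f x"
    and "(\<lambda>n. \<integral>x. fn n x \<partial>gauss) \<longlonglongrightarrow> (\<integral>x. f x \<partial>gauss)"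
    and "(\<lambda>n. gauss_variance (fn n)) \<longlonglongrightarrow> gauss_variance f"
proof -
  let ?w = "\<lambda>x. \<bar>f x\<bar> + \<bar>w x\<bar>"
  note int = gauss_integrable tame_intros f w
  have dom: "\<bar>fn n x\<bar> \<le> ?w x" for n x
  proof -
    have "e n * w x \<le> e n * \<bar>w x\<bar>" using e(2) by (intro mult_left_mono) auto
    also have "\<dots> \<le> 1 * \<bar>w x\<bar>" using e(3) by (intro mult_right_mono) auto
    finally have "\<bar>fn n x - f x\<bar> \<le> \<bar>w x\<bar>" using close[of n x] by simp
    then show ?thesis by linarith
  qed
  show pt: "(\<lambda>n. fn n x) \<longlonglongrightarrow> f x" for x
  proof -
    have "(\<lambda>n. e n * w x) \<longlonglongrightarrow> 0 * w x"
      by (intro tendsto_intros e)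
    then have "(\<lambda>n. e n * w x) \<longlonglongrightarrow> 0" by simp
    then have "(\<lambda>n. fn n x - f x) \<longlonglongrightarrow> 0"
      by (rule Lim_null_comparison[rotated]) (use close in auto)
    then show ?thesis by (simp add: LIM_zero_iff)
  qed
  show m1: "(\<lambda>n. \<integral>x. fn n x \<partial>gauss) \<longlonglongrightarrow> (\<integral>x. f x \<partial>gauss)"
  proof (rule integral_dominated_convergence[where w="?w"])
    show "integrable gauss ?w" by (intro int)
    show "f \<in> borel_measurable gauss" "fn n \<in> borel_measurable gauss" for n
      using tameD_measurable[OF f(1)] tameD_measurable[OF f(2)] by simp_all
  qed (use pt dom in auto)
  have m2: "(\<lambda>n. \<integral>x. (fn n x)\<^sup>2 \<partial>gauss) \<longlonglongrightarrow> (\<integral>x. (f x)\<^sup>2 \<partial>gauss)"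
  proof (rule integral_dominated_convergence[where w="\<lambda>x. (?w x)\<^sup>2"])
    show "integrable gauss (\<lambda>x. (?w x)\<^sup>2)" by (intro int)
    show "AE x in gauss. (\<lambda>n. (fn n x)\<^sup>2) \<longlonglongrightarrow> (f x)\<^sup>2" by (intro AE_I2 tendsto_intros pt)
    show "AE x in gauss. norm ((fn n x)\<^sup>2) \<le> (?w x)\<^sup>2" for n
      by (intro AE_I2) (use power_mono[OF dom, of n _ 2] in simp)
    show "(\<lambda>x. (f x)\<^sup>2) \<in> borel_measurable gauss" "(\<lambda>x. (fn n x)\<^sup>2) \<in> borel_measurable gauss" for n
      using tameD_measurable[OF tame_power[OF f(1), of 2]] tameD_measurable[OF tame_power[OF f(2), of n 2]] by simp_all
  qed
  show "(\<lambda>n. gauss_variance (fn n)) \<longlonglongrightarrow> gauss_variance f"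
    unfolding gauss_variance_def by (intro tendsto_intros m1 m2)
qed

text \<open>The differentiable case, applied to the smoothed functions, whose gradients are bounded by \<open>k\<close> up to
an error that vanishes with the scale of smoothing.\<close>

theorem gauss_poincare:
  fixes f :: "'a::euclidean_space \<Rightarrow> real"
  assumes f: "local_slope f k C" and k: "\<And>x y. \<bar>k x - k y\<bar> \<le> M * norm (x - y)" "\<And>x. k x \<ge> 0"
    and C: "C \<ge> 0"
  shows "gauss_variance f \<le> (\<integral>x. (k x)\<^sup>2 \<partial>gauss)"
proof -
  note tf = tame_local_slope[OF f]
  have tk: "tame k" by (rule tame_lipschitz[of _ M]) (use k in auto)
  note int = gauss_integrable tame_intros tk tf
  define \<kappa> where "\<kappa> = gauss_norm_moment TYPE('a) 1"
  define \<kappa>' where "\<kappa>' = gauss_norm_moment TYPE('a) 2"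
  have \<kappa>: "\<kappa> \<ge> 0" "\<kappa>' \<ge> 0"
    unfolding \<kappa>_def \<kappa>'_def gauss_norm_moment_def by auto
  define e where "e n = inverse (real (Suc n))" for n
  have e: "e n > 0" "e n \<le> 1" for n
    unfolding e_def by (auto simp: inverse_eq_divide)
  have elim: "e \<longlonglongrightarrow> 0" unfolding e_def [abs_def] by (rule LIMSEQ_inverse_real_of_nat)
  let ?f = "\<lambda>n. smoothing (e n) f"
  have tfn: "tame (?f n)" for n by (rule tame_smoothing[OF tf])
  have close: "\<bar>?f n x - f x\<bar> \<le> e n * (k x * \<kappa> + C * \<kappa>')" for n x
  proof -
    have "C * e n * \<kappa>' \<le> C * 1 * \<kappa>'" using e[of n] C \<kappa> by (intro mult_right_mono mult_left_mono) auto
    then have "e n * (k x * \<kappa> + C * e n * \<kappa>') \<le> e n * (k x * \<kappa> + C * \<kappa>')"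
      using e[of n] by (intro mult_left_mono add_left_mono) auto
    with smoothing_close[OF f less_imp_le[OF e(1)], of n x] show ?thesis
      unfolding \<kappa>_def \<kappa>'_def by linarith
  qed
  have "(\<lambda>n. gauss_variance (?f n)) \<longlonglongrightarrow> gauss_variance f"
    by (rule gauss_moments_tendsto(3)[where w="\<lambda>x. k x * \<kappa> + C * \<kappa>'" and e=e])
       (use e elim close in \<open>auto intro!: tame_intros tfn tf tk simp: less_imp_le\<close>)
  moreover have "(\<lambda>n. (\<integral>x. (k x)\<^sup>2 \<partial>gauss) + (2 * M * \<kappa> * e n * (\<integral>x. k x \<partial>gauss) + (M * \<kappa> * e n)\<^sup>2))
      \<longlonglongrightarrow> (\<integral>x. (k x)\<^sup>2 \<partial>gauss) + (2 * M * \<kappa> * 0 * (\<integral>x. k x \<partial>gauss) + (M * \<kappa> * 0)\<^sup>2)"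
    by (intro tendsto_intros elim)
  moreover have "gauss_variance (?f n) \<le> (\<integral>x. (k x)\<^sup>2 \<partial>gauss) + (2 * M * \<kappa> * e n * (\<integral>x. k x \<partial>gauss) + (M * \<kappa> * e n)\<^sup>2)" for n
  proof -
    let ?g = "smoothing_gradient (e n) f"
    have tg: "tame ?g" by (rule tame_smoothing_gradient[OF tf])
    have "gauss_variance (?f n) \<le> (\<integral>x. (norm (?g x))\<^sup>2 \<partial>gauss)"
      by (rule gauss_poincare_smooth[OF tfn tg has_derivative_smoothing[OF tf e(1)]])
    also have "\<dots> \<le> (\<integral>x. (k x + M * \<kappa> * e n)\<^sup>2 \<partial>gauss)"
    proof (rule integral_mono)
      show "(norm (?g x))\<^sup>2 \<le> (k x + M * \<kappa> * e n)\<^sup>2" for x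
        using smoothing_gradient_bound[OF f k C e(1), of n x] unfolding \<kappa>_def
        by (intro power_mono) (simp_all add: mult_ac)
    qed (intro int tg)+
    also have "\<dots> = (\<integral>x. (k x)\<^sup>2 + (2 * M * \<kappa> * e n * k x + (M * \<kappa> * e n)\<^sup>2) \<partial>gauss)"
      by (simp add: power2_sum algebra_simps)
    also have "\<dots> = (\<integral>x. (k x)\<^sup>2 \<partial>gauss) + (2 * M * \<kappa> * e n * (\<integral>x. k x \<partial>gauss) + (M * \<kappa> * e n)\<^sup>2)"
      by (subst Bochner_Integration.integral_add, (intro int)+, subst Bochner_Integration.integral_add, (intro int)+) simp
    finally show ?thesis .
  qed
  ultimately show ?thesis
    by (intro LIMSEQ_le[of "\<lambda>n. gauss_variance (?f n)" "gauss_variance f"]) auto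
qed

text \<open>Since \<open>a\<close> is \<open>L\<close>-Lipschitz and \<open>R a\<close> is \<open>L / 2\<close>-Lipschitz, the product rule gives
\<open>R a \<bullet> a\<close> the slope \<open>L |R a| + L / 2 |a|\<close>. As \<open>E|R a|\<^sup>2 \<le> E|a|\<^sup>2\<close>, its second moment is at most
\<open>(L + L / 2)\<^sup>2 E|a|\<^sup>2\<close>.\<close>

lemma variance_resolvent_inner:
  fixes a :: "'a::euclidean_space \<Rightarrow> 'a"
  assumes a: "\<And>x y. norm (a x - a y) \<le> L * norm (x - y)" and L: "L \<ge> 0"
  shows "gauss_variance (\<lambda>x. resolvent a x \<bullet> a x) \<le> 9 / 4 * L\<^sup>2 * (\<integral>x. (norm (a x))\<^sup>2 \<partial>gauss)"
proof -
  let ?R = "resolvent a"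
  have ta: "tame a" by (rule tame_lipschitz[OF a])
  note tR = tame_resolvent[OF ta] and R = resolvent_lipschitz[of a, OF a]
  note int = gauss_integrable tame_intros ta tR
  let ?k = "\<lambda>x. L * norm (?R x) + L / 2 * norm (a x)"
  have slope: "local_slope (\<lambda>x. ?R x \<bullet> a x) ?k (L\<^sup>2 / 2)"
    unfolding local_slope_def
  proof (intro allI)
    fix x h
    have "?R (x + h) \<bullet> a (x + h) - ?R x \<bullet> a x = (?R (x + h) - ?R x) \<bullet> a (x + h) + ?R x \<bullet> (a (x + h) - a x)"
      by (simp add: inner_diff_left inner_diff_right)
    also have "\<bar>\<dots>\<bar> \<le> norm (?R (x + h) - ?R x) * norm (a (x + h)) + norm (?R x) * norm (a (x + h) - a x)"
      by (intro order_trans[OF abs_triangle_ineq] add_mono Cauchy_Schwarz_ineq2)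
    also have "\<dots> \<le> (L / 2 * norm h) * (norm (a x) + L * norm h) + norm (?R x) * (L * norm h)"
    proof (intro add_mono mult_mono)
      show "norm (?R (x + h) - ?R x) \<le> L / 2 * norm h" using R[of "x + h" x] by simp
      show ah: "norm (a (x + h) - a x) \<le> L * norm h" using a[of "x + h" x] by simp
      show "norm (a (x + h)) \<le> norm (a x) + L * norm h"
        using ah norm_triangle_ineq2[of "a (x + h)" "a x"] by linarith
    qed (use L in auto)
    also have "\<dots> = norm h * (?k x + L\<^sup>2 / 2 * norm h)"
      by (simp add: algebra_simps power2_eq_square)
    finally show "\<bar>?R (x + h) \<bullet> a (x + h) - ?R x \<bullet> a x\<bar> \<le> norm h * (?k x + L\<^sup>2 / 2 * norm h)" .
  qed
  have "gauss_variance (\<lambda>x. ?R x \<bullet> a x) \<le> (\<integral>x. (?k x)\<^sup>2 \<partial>gauss)"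
  proof (rule gauss_poincare[OF slope, of "L\<^sup>2"])
    fix x y
    have "\<bar>norm (?R x) - norm (?R y)\<bar> \<le> L / 2 * norm (x - y)"
      using R[of x y] norm_triangle_ineq3[of "?R x" "?R y"] by linarith
    moreover have "\<bar>norm (a x) - norm (a y)\<bar> \<le> L * norm (x - y)"
      using a[of x y] norm_triangle_ineq3[of "a x" "a y"] by linarith
    ultimately have "L * \<bar>norm (?R x) - norm (?R y)\<bar> + L / 2 * \<bar>norm (a x) - norm (a y)\<bar>
        \<le> L * (L / 2 * norm (x - y)) + L / 2 * (L * norm (x - y))"
      using L by (intro add_mono mult_left_mono) auto
    moreover have "\<bar>?k x - ?k y\<bar> \<le> L * \<bar>norm (?R x) - norm (?R y)\<bar> + L / 2 * \<bar>norm (a x) - norm (a y)\<bar>"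
    proof -
      have "?k x - ?k y = L * (norm (?R x) - norm (?R y)) + L / 2 * (norm (a x) - norm (a y))"
        by (simp add: algebra_simps)
      then show ?thesis
        using abs_triangle_ineq[of "L * (norm (?R x) - norm (?R y))" "L / 2 * (norm (a x) - norm (a y))"] L
        by (simp add: abs_mult)
    qed
    ultimately show "\<bar>?k x - ?k y\<bar> \<le> L\<^sup>2 * norm (x - y)"
      by (simp add: algebra_simps power2_eq_square)
  qed (use L in auto)
  also have "\<dots> \<le> (\<integral>x. 3 / 2 * L\<^sup>2 * ((norm (?R x))\<^sup>2 + 1 / 2 * (norm (a x))\<^sup>2) \<partial>gauss)"
  proof (rule integral_mono)
    fix x
    \<comment> \<open>Cauchy-Schwarz with weights 1 and 1/2; as the two second moments are comparable, the result is as good as that of the triangle inequality in the space of square integrable functions\<close>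
    have "(norm (?R x) + 1 / 2 * norm (a x))\<^sup>2 \<le> 3 / 2 * ((norm (?R x))\<^sup>2 + 1 / 2 * (norm (a x))\<^sup>2)"
      using zero_le_power2[of "norm (?R x) - norm (a x)"]
      by (simp add: power2_sum power2_diff power_divide algebra_simps)
    from mult_left_mono[OF this zero_le_power2[of L]]
    show "(?k x)\<^sup>2 \<le> 3 / 2 * L\<^sup>2 * ((norm (?R x))\<^sup>2 + 1 / 2 * (norm (a x))\<^sup>2)"
      by (simp add: power2_eq_square algebra_simps)
  qed (intro int)+
  also have "\<dots> = 3 / 2 * L\<^sup>2 * ((\<integral>x. (norm (?R x))\<^sup>2 \<partial>gauss) + 1 / 2 * (\<integral>x. (norm (a x))\<^sup>2 \<partial>gauss))"
    by (subst Bochner_Integration.integral_mult_right_zero, subst Bochner_Integration.integral_add) (auto intro!: int)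
  also have "\<dots> \<le> 3 / 2 * L\<^sup>2 * ((\<integral>x. (norm (a x))\<^sup>2 \<partial>gauss) + 1 / 2 * (\<integral>x. (norm (a x))\<^sup>2 \<partial>gauss))"
    by (intro mult_left_mono add_right_mono integral_norm_sq_resolvent_le ta) auto
  finally show ?thesis by simp
qed

section \<open>Normal approximation for smooth functionals\<close>

lemma gauss_variance_nonneg:
  fixes f :: "'a::euclidean_space \<Rightarrow> real"
  assumes "tame f"
  shows "0 \<le> gauss_variance f"
  unfolding gauss_variance_centred[OF assms, symmetric] by (rule integral_nonneg_AE) simp

lemma integral_abs_le_sqrt:
  fixes f :: "'a::euclidean_space \<Rightarrow> real"
  assumes "tame f"
  shows "(\<integral>x. \<bar>f x\<bar> \<partial>gauss) \<le> sqrt (\<integral>x. (f x)\<^sup>2 \<partial>gauss)"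
  using gauss_variance_nonneg[OF tame_abs[OF assms]]
  by (intro real_le_rsqrt) (simp add: gauss_variance_def)

text \<open>With \<open>T = R G \<bullet> G\<close> for \<open>G = a + b\<close>, Stein's equation and the covariance identity bound the left-hand
side by \<open>2 / s\<^sup>2 E|s\<^sup>2 - T|\<close>, and \<open>E T\<close> is the variance of \<open>\<Psi>\<close>. The part \<open>q = R a \<bullet> a\<close> of \<open>T\<close> is
controlled by its variance. The part \<open>r\<close> containing \<open>b\<close> is controlled by its mean, so that only the
supremum \<open>B\<close> of \<open>b\<close> enters; it counts twice because it also contributes to \<open>E T\<close>. The variable \<open>s\<^sup>2\<close> is
kept separate from the variance of \<open>\<Psi>\<close> so that \<open>\<Psi>\<close> may be an approximation of the functional of
interest.\<close>

lemma stein_bound: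
  fixes \<Psi> :: "'a::euclidean_space \<Rightarrow> real" and a b :: "'a \<Rightarrow> 'a"
  assumes \<Psi>: "tame \<Psi>" "\<And>x. (\<Psi> has_derivative (\<lambda>v. (a x + b x) \<bullet> v)) (at x)"
    and a: "\<And>x y. norm (a x - a y) \<le> L * norm (x - y)" and L: "L \<ge> 0"
    and b: "tame b" "\<And>x. norm (b x) \<le> B"
    and s: "s > 0" and h: "continuous_on UNIV h" "\<And>x. 0 \<le> h x" "\<And>x. h x \<le> 1"
  shows "\<bar>(\<integral>x. h (\<Psi> x - (\<integral>x. \<Psi> x \<partial>gauss)) \<partial>gauss)
      - (\<integral>t. h t \<partial>density lborel (\<lambda>t. ennreal (normal_density 0 s t)))\<bar>
    \<le> 2 / s\<^sup>2 * (\<bar>s\<^sup>2 - gauss_variance \<Psi>\<bar> + 3 / 2 * L * sqrt (\<integral>x. (norm (a x))\<^sup>2 \<partial>gauss)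
        + 2 * (2 * B * (\<integral>x. norm (a x) \<partial>gauss) + B\<^sup>2))"
proof -
  define c where "c = (\<integral>t. h t \<partial>density lborel (\<lambda>t. ennreal (normal_density 0 s t)))"
  obtain f f' where f: "\<And>x. (f has_real_derivative f' x) (at x)" "continuous_on UNIV f'"
    "\<And>x. \<bar>f' x\<bar> \<le> 2 / s\<^sup>2" "\<And>x. s\<^sup>2 * f' x - x * f x = h x - c"
    using stein_equation[OF s h] unfolding c_def by blast
  have tf': "tame f'" by (rule tameI[OF f(2), of "2 / s\<^sup>2" 0]) (use f(3) in simp)
  have th: "tame h" by (rule tameI[OF h(1), of 1 0]) (use h in simp)
  have tf: "tame f"
  proof (rule tame_lipschitz)
    fix x y :: real
    show "norm (f x - f y) \<le> 2 / s\<^sup>2 * norm (x - y)"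
      by (rule field_differentiable_bound[of UNIV f f']) (use f in auto)
  qed
  have ta: "tame a" by (rule tame_lipschitz[OF a])
  define m where "m = (\<integral>x. \<Psi> x \<partial>gauss)"
  define F where "F x = \<Psi> x - m" for x
  define G where "G x = a x + b x" for x
  have tF: "tame F" unfolding F_def [abs_def] by (intro tame_intros \<Psi>)
  have tG: "tame G" unfolding G_def [abs_def] by (intro tame_intros ta b)
  have dF: "(F has_derivative (\<lambda>v. G x \<bullet> v)) (at x)" for x
    unfolding F_def [abs_def] G_def by (rule has_derivative_diff[OF \<Psi>(2) has_derivative_const, simplified])
  have F0: "(\<integral>x. F x \<partial>gauss) = 0"
    unfolding F_def by (subst Bochner_Integration.integral_diff)
      (auto intro!: gauss_integrable tame_intros \<Psi> simp: m_def)
  have tfF: "tame (\<lambda>x. f (F x))" "tame (\<lambda>x. f' (F x))" "tame (\<lambda>x. h (F x))"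
    by (rule tame_comp[OF _ tF]; fact)+
  have dfF: "((\<lambda>x. f (F x)) has_derivative (\<lambda>v. (f' (F x) *\<^sub>R G x) \<bullet> v)) (at x)" for x
  proof -
    have "(f has_derivative (\<lambda>t. f' (F x) * t)) (at (F x))"
      using f(1) by (simp add: has_field_derivative_def)
    from has_derivative_compose[OF dF this] show ?thesis by simp
  qed
  let ?R = resolvent
  note tR = tame_resolvent
  define T where "T x = ?R G x \<bullet> G x" for x
  define q where "q x = ?R a x \<bullet> a x" for x
  define r where "r x = ?R a x \<bullet> b x + (?R b x \<bullet> a x + ?R b x \<bullet> b x)" for x
  have tT: "tame T" and tq: "tame q" and tr: "tame r"
    unfolding T_def [abs_def] q_def [abs_def] r_def [abs_def] by (intro tame_intros tR ta b tG)+
  note int = gauss_integrable tame_intros tfF tT tq tr tF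
  have Tqr: "T x = q x + r x" for x
    unfolding T_def q_def r_def G_def [abs_def] resolvent_add[OF ta b(1)]
    by (simp add: inner_add_left inner_add_right)
  have covFf: "(\<integral>x. F x * f (F x) \<partial>gauss) = (\<integral>x. f' (F x) * T x \<partial>gauss)"
    using gauss_covariance[OF tF tG dF tfF(1) _ dfF] F0
    by (simp add: T_def tame_intros tfF tG mult.commute)
  have var: "gauss_variance \<Psi> = (\<integral>x. T x \<partial>gauss)"
  proof -
    have "(\<integral>x. \<Psi> x * \<Psi> x \<partial>gauss) - (\<integral>x. \<Psi> x \<partial>gauss) * (\<integral>x. \<Psi> x \<partial>gauss) = (\<integral>x. T x \<partial>gauss)"
      unfolding T_def by (rule gauss_covariance[OF \<Psi>(1) tG _ \<Psi>(1) tG]) (use \<Psi>(2) in \<open>auto simp: G_def\<close>)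
    then show ?thesis by (simp add: gauss_variance_def power2_eq_square)
  qed
  have Eqr: "(\<integral>x. T x \<partial>gauss) = (\<integral>x. q x \<partial>gauss) + (\<integral>x. r x \<partial>gauss)"
    unfolding Tqr by (rule Bochner_Integration.integral_add) (intro int)+
  have "(\<integral>x. h (F x) \<partial>gauss) - c = (\<integral>x. h (F x) - c \<partial>gauss)"
    by (subst Bochner_Integration.integral_diff) (auto intro!: int)
  also have "\<dots> = (\<integral>x. s\<^sup>2 * f' (F x) - F x * f (F x) \<partial>gauss)"
    by (simp only: f(4))
  also have "\<dots> = (\<integral>x. s\<^sup>2 * f' (F x) \<partial>gauss) - (\<integral>x. f' (F x) * T x \<partial>gauss)"
    unfolding covFf[symmetric] by (rule Bochner_Integration.integral_diff) (intro int)+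
  also have "\<dots> = (\<integral>x. s\<^sup>2 * f' (F x) - f' (F x) * T x \<partial>gauss)"
    by (rule Bochner_Integration.integral_diff[symmetric]) (intro int)+
  also have "\<bar>\<dots>\<bar> \<le> (\<integral>x. \<bar>s\<^sup>2 * f' (F x) - f' (F x) * T x\<bar> \<partial>gauss)"
    by (rule integral_abs_bound)
  also have "\<dots> \<le> (\<integral>x. 2 / s\<^sup>2 * (\<bar>s\<^sup>2 - gauss_variance \<Psi>\<bar> + (\<bar>q x - (\<integral>x. q x \<partial>gauss)\<bar>
      + (\<bar>r x\<bar> + (\<integral>x. \<bar>r x\<bar> \<partial>gauss)))) \<partial>gauss)"
  proof (rule integral_mono)
    fix x
    have "s\<^sup>2 * f' (F x) - f' (F x) * T x = f' (F x) * (s\<^sup>2 - T x)" by (simp add: algebra_simps)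
    then have "\<bar>s\<^sup>2 * f' (F x) - f' (F x) * T x\<bar> \<le> 2 / s\<^sup>2 * \<bar>s\<^sup>2 - T x\<bar>"
      using f(3)[of "F x"] by (simp only: abs_mult mult_right_mono abs_ge_zero)
    moreover have "\<bar>s\<^sup>2 - T x\<bar> \<le> \<bar>s\<^sup>2 - gauss_variance \<Psi>\<bar> + (\<bar>q x - (\<integral>x. q x \<partial>gauss)\<bar>
      + (\<bar>r x\<bar> + (\<integral>x. \<bar>r x\<bar> \<partial>gauss)))"
      using integral_abs_bound[of gauss r] unfolding var Eqr Tqr[of x] by linarith
    ultimately show "\<bar>s\<^sup>2 * f' (F x) - f' (F x) * T x\<bar> \<le> 2 / s\<^sup>2 * (\<bar>s\<^sup>2 - gauss_variance \<Psi>\<bar>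
      + (\<bar>q x - (\<integral>x. q x \<partial>gauss)\<bar> + (\<bar>r x\<bar> + (\<integral>x. \<bar>r x\<bar> \<partial>gauss))))"
      by (elim order_trans) (intro mult_left_mono, auto)
  qed (intro int)+
  also have "\<dots> = 2 / s\<^sup>2 * (\<bar>s\<^sup>2 - gauss_variance \<Psi>\<bar> + ((\<integral>x. \<bar>q x - (\<integral>x. q x \<partial>gauss)\<bar> \<partial>gauss)
      + ((\<integral>x. \<bar>r x\<bar> \<partial>gauss) + (\<integral>x. \<bar>r x\<bar> \<partial>gauss))))"
    by (subst Bochner_Integration.integral_mult_right_zero,
        subst Bochner_Integration.integral_add, (intro int)+,
        subst Bochner_Integration.integral_add, (intro int)+,
        subst Bochner_Integration.integral_add, (intro int)+) simp
  also have "\<dots> \<le> 2 / s\<^sup>2 * (\<bar>s\<^sup>2 - gauss_variance \<Psi>\<bar> + 3 / 2 * L * sqrt (\<integral>x. (norm (a x))\<^sup>2 \<partial>gauss)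
        + 2 * (2 * B * (\<integral>x. norm (a x) \<partial>gauss) + B\<^sup>2))"
  proof -
    have "(\<integral>x. \<bar>q x - (\<integral>x. q x \<partial>gauss)\<bar> \<partial>gauss) \<le> sqrt (gauss_variance q)"
      using integral_abs_le_sqrt[of "\<lambda>x. q x - (\<integral>x. q x \<partial>gauss)"] gauss_variance_centred[OF tq]
      by (simp add: tame_intros tq)
    also have "\<dots> \<le> sqrt ((3 / 2 * L)\<^sup>2 * (\<integral>x. (norm (a x))\<^sup>2 \<partial>gauss))"
      using variance_resolvent_inner[OF a L] unfolding q_def [abs_def]
      by (intro real_sqrt_le_mono) (simp add: power2_eq_square)
    also have "\<dots> = 3 / 2 * L * sqrt (\<integral>x. (norm (a x))\<^sup>2 \<partial>gauss)"
      using L by (simp add: real_sqrt_mult)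
    finally have 1: "(\<integral>x. \<bar>q x - (\<integral>x. q x \<partial>gauss)\<bar> \<partial>gauss) \<le> 3 / 2 * L * sqrt (\<integral>x. (norm (a x))\<^sup>2 \<partial>gauss)" .
    have B: "B \<ge> 0" using b(2)[of 0] norm_ge_zero[of "b 0"] by linarith
    have Rb: "norm (?R b x) \<le> B" for x by (rule resolvent_bounded[OF b])
    have "(\<integral>x. \<bar>r x\<bar> \<partial>gauss) \<le> (\<integral>x. B * norm (?R a x) + (B * norm (a x) + B\<^sup>2) \<partial>gauss)"
    proof (rule integral_mono)
      fix x
      have "\<bar>?R a x \<bullet> b x\<bar> \<le> B * norm (?R a x)"
        using Cauchy_Schwarz_ineq2[of "?R a x" "b x"] mult_left_mono[OF b(2)[of x] norm_ge_zero[of "?R a x"]]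
        by (simp add: mult.commute)
      moreover have "\<bar>?R b x \<bullet> a x\<bar> \<le> B * norm (a x)"
        using Cauchy_Schwarz_ineq2[of "?R b x" "a x"] mult_right_mono[OF Rb[of x] norm_ge_zero[of "a x"]] by simp
      moreover have "\<bar>?R b x \<bullet> b x\<bar> \<le> B\<^sup>2"
        using Cauchy_Schwarz_ineq2[of "?R b x" "b x"] mult_mono[OF Rb[of x] b(2)[of x] B norm_ge_zero[of "b x"]]
        by (simp add: power2_eq_square)
      ultimately show "\<bar>r x\<bar> \<le> B * norm (?R a x) + (B * norm (a x) + B\<^sup>2)"
        unfolding r_def by linarith
    qed (intro int tR ta)+
    also have "\<dots> = B * (\<integral>x. norm (?R a x) \<partial>gauss) + (B * (\<integral>x. norm (a x) \<partial>gauss) + B\<^sup>2)"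
      by (subst Bochner_Integration.integral_add, (intro int tR ta)+,
          subst Bochner_Integration.integral_add, (intro int tR ta)+) simp
    also have "\<dots> \<le> B * (\<integral>x. norm (a x) \<partial>gauss) + (B * (\<integral>x. norm (a x) \<partial>gauss) + B\<^sup>2)"
      by (intro add_right_mono mult_left_mono integral_norm_resolvent_le ta B)
    finally have "(\<integral>x. \<bar>r x\<bar> \<partial>gauss) \<le> 2 * B * (\<integral>x. norm (a x) \<partial>gauss) + B\<^sup>2" by simp
    with 1 show ?thesis by (intro mult_left_mono) auto
  qed
  finally show ?thesis unfolding F_def m_def c_def .
qed

section \<open>The distance between the cone functional and the normal law\<close>

lemma std_gaussian_density_eq: "std_gaussian_density (x :: real ^ 'd) = gauss_density x"
proof -
  have Basis: "(Basis :: (real ^ 'd) set) = (\<lambda>i. axis i 1) ` UNIV"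
    by (auto simp: Basis_vec_def)
  have "inj_on (\<lambda>i::'d. axis i (1::real)) UNIV"
    by (auto simp: inj_on_def axis_eq_axis)
  then show ?thesis
    unfolding gauss_density_prod std_gaussian_density_def Basis
    by (simp add: prod.reindex inner_axis)
qed

text \<open>Only the Lipschitz part \<open>\<psi> = - 2 \<mu> \<bullet> \<Pi>(x + \<mu>)\<close> is smoothed. Then \<open>stein_bound\<close> applies with
\<open>a = 2 \<Pi>(x + \<mu>)\<close>, \<open>L = 2\<close> and \<open>B = 2 |\<mu>|\<close> at every scale of smoothing, and the approximations converge
to \<open>\<Phi>\<close> uniformly.\<close>

lemma cone_statistic_test_bound:
  fixes C :: "'a::euclidean_space set" and \<mu> :: 'a
  assumes C: "positive_convex_cone C" "closed C" "C \<noteq> {}"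
    and h: "continuous_on UNIV h" "\<And>x. 0 \<le> h x" "\<And>x. h x \<le> 1"
  defines "\<Phi> \<equiv> \<lambda>x. (norm (\<mu> - closest_point C (x + \<mu>)))\<^sup>2"
    and "P \<equiv> \<lambda>x. norm (closest_point C (x + \<mu>))"
  assumes s: "s > 0" "s\<^sup>2 = gauss_variance \<Phi>"
  shows "\<bar>(\<integral>x. h (\<Phi> x - (\<integral>x. \<Phi> x \<partial>gauss)) \<partial>gauss)
      - (\<integral>t. h t \<partial>density lborel (\<lambda>t. ennreal (normal_density 0 s t)))\<bar>
    \<le> 4 / s\<^sup>2 * (3 * sqrt (\<integral>x. (P x)\<^sup>2 \<partial>gauss) + 8 * norm \<mu> * (\<integral>x. P x \<partial>gauss) + 4 * (norm \<mu>)\<^sup>2)"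
proof -
  let ?p = "\<lambda>x. closest_point C (x + \<mu>)"
  have plip: "norm (?p x - ?p y) \<le> norm (x - y)" for x y
    using cone_projection_lipschitz[OF C, of "x + \<mu>" "y + \<mu>"] by simp
  have tp: "tame ?p" by (rule tame_lipschitz[of _ 1]) (use plip in simp)
  define \<psi> where "\<psi> x = - 2 * (\<mu> \<bullet> ?p x)" for x
  have \<Phi>: "\<Phi> x = (norm \<mu>)\<^sup>2 + (norm (?p x))\<^sup>2 + \<psi> x" for x
    unfolding \<Phi>_def \<psi>_def
    by (simp add: power2_norm_eq_inner inner_diff_left inner_diff_right inner_commute)
  have slope: "local_slope \<psi> (\<lambda>_. 2 * norm \<mu>) 0"
    unfolding local_slope_def
  proof (intro allI)
    fix x v
    have "\<psi> (x + v) - \<psi> x = - 2 * (\<mu> \<bullet> (?p (x + v) - ?p x))"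
      by (simp add: \<psi>_def inner_diff_right)
    then have "\<bar>\<psi> (x + v) - \<psi> x\<bar> = 2 * \<bar>\<mu> \<bullet> (?p (x + v) - ?p x)\<bar>" by simp
    also have "\<dots> \<le> 2 * (norm \<mu> * norm (?p (x + v) - ?p x))"
      by (intro mult_left_mono Cauchy_Schwarz_ineq2) simp
    also have "\<dots> \<le> 2 * (norm \<mu> * norm v)"
      using plip[of "x + v" x] by (intro mult_left_mono) auto
    finally show "\<bar>\<psi> (x + v) - \<psi> x\<bar> \<le> norm v * (2 * norm \<mu> + 0 * norm v)" by (simp add: ac_simps)
  qed
  have t\<psi>: "tame \<psi>" by (rule tame_local_slope[OF slope])
  have t\<Phi>: "tame \<Phi>" unfolding \<Phi> [abs_def] by (intro tame_intros tp t\<psi>)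
  define e where "e n = inverse (real (Suc n))" for n
  have e: "e n > 0" "e n \<le> 1" for n
    unfolding e_def by (auto simp: inverse_eq_divide)
  have elim: "e \<longlonglongrightarrow> 0" unfolding e_def [abs_def] by (rule LIMSEQ_inverse_real_of_nat)
  define \<Psi> where "\<Psi> n x = (norm \<mu>)\<^sup>2 + (norm (?p x))\<^sup>2 + smoothing (e n) \<psi> x" for n x
  have t\<Psi>: "tame (\<Psi> n)" for n
    unfolding \<Psi>_def [abs_def] by (intro tame_intros tp tame_comp[OF tame_smoothing[OF t\<psi>]])
  let ?b = "\<lambda>n. smoothing_gradient (e n) \<psi>"
  have d\<Psi>: "(\<Psi> n has_derivative (\<lambda>v. (2 *\<^sub>R ?p x + ?b n x) \<bullet> v)) (at x)" for n x
  proof -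
    have "((\<lambda>x. x + \<mu>) has_derivative (\<lambda>v. v)) (at x)" by (auto intro!: derivative_eq_intros)
    from has_derivative_compose[OF this cone_projection_sq_derivative[OF C]]
    have "((\<lambda>x. (norm (?p x))\<^sup>2) has_derivative (\<lambda>v. (2 *\<^sub>R ?p x) \<bullet> v)) (at x)" .
    from has_derivative_add[OF has_derivative_add[OF has_derivative_const this]
        has_derivative_smoothing[OF t\<psi> e(1)[of n], of x], of "(norm \<mu>)\<^sup>2"]
    show ?thesis unfolding \<Psi>_def [abs_def] by (simp add: inner_add_left)
  qed
  have b: "norm (?b n x) \<le> 2 * norm \<mu>" for n x
    using smoothing_gradient_bound[OF slope, of 0 "e n" x] e(1)[of n] by simp
  have close: "\<bar>\<Psi> n x - \<Phi> x\<bar> \<le> e n * (2 * norm \<mu> * gauss_norm_moment TYPE('a) 1)" for n x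
    using smoothing_close[OF slope less_imp_le[OF e(1)[of n]], of x] unfolding \<Psi>_def \<Phi> by simp
  note lim = gauss_moments_tendsto[OF t\<Phi> t\<Psi> tame_const elim less_imp_le[OF e(1)] e(2) close]
  let ?D = "12 * sqrt (\<integral>x. (P x)\<^sup>2 \<partial>gauss) + 32 * norm \<mu> * (\<integral>x. P x \<partial>gauss) + 16 * (norm \<mu>)\<^sup>2"
  let ?N = "\<integral>t. h t \<partial>density lborel (\<lambda>t. ennreal (normal_density 0 s t))"
  have "(\<integral>x. (norm (2 *\<^sub>R ?p x))\<^sup>2 \<partial>gauss) = 2\<^sup>2 * (\<integral>x. (P x)\<^sup>2 \<partial>gauss)"
    unfolding P_def by (simp add: power_mult_distrib)
  then have sq: "sqrt (\<integral>x. (norm (2 *\<^sub>R ?p x))\<^sup>2 \<partial>gauss) = 2 * sqrt (\<integral>x. (P x)\<^sup>2 \<partial>gauss)"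
    by (simp add: real_sqrt_mult)
  have ab: "(\<integral>x. norm (2 *\<^sub>R ?p x) \<partial>gauss) = 2 * (\<integral>x. P x \<partial>gauss)"
    unfolding P_def by simp
  have bound: "\<bar>(\<integral>x. h (\<Psi> n x - (\<integral>x. \<Psi> n x \<partial>gauss)) \<partial>gauss) - ?N\<bar>
      \<le> 2 / s\<^sup>2 * \<bar>s\<^sup>2 - gauss_variance (\<Psi> n)\<bar> + ?D / s\<^sup>2" for n
  proof -
    have "norm (2 *\<^sub>R ?p x - 2 *\<^sub>R ?p y) \<le> 2 * norm (x - y)" for x y
      using plip[of x y] by (simp flip: scaleR_diff_right)
    from stein_bound[OF t\<Psi> d\<Psi> this _ tame_smoothing_gradient[OF t\<psi>] b s(1) h, of n]
    have "\<bar>(\<integral>x. h (\<Psi> n x - (\<integral>x. \<Psi> n x \<partial>gauss)) \<partial>gauss) - ?N\<bar>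
      \<le> 2 / s\<^sup>2 * (\<bar>s\<^sup>2 - gauss_variance (\<Psi> n)\<bar> + 3 / 2 * 2 * (2 * sqrt (\<integral>x. (P x)\<^sup>2 \<partial>gauss))
        + 2 * (2 * (2 * norm \<mu>) * (2 * (\<integral>x. P x \<partial>gauss)) + (2 * norm \<mu>)\<^sup>2))"
      unfolding sq ab by simp
    also have "\<dots> = 2 / s\<^sup>2 * \<bar>s\<^sup>2 - gauss_variance (\<Psi> n)\<bar> + ?D / s\<^sup>2"
      using s(1) by (simp add: field_simps power2_eq_square)
    finally show ?thesis .
  qed
  have "(\<lambda>n. \<integral>x. h (\<Psi> n x - (\<integral>x. \<Psi> n x \<partial>gauss)) \<partial>gauss) \<longlonglongrightarrow> (\<integral>x. h (\<Phi> x - (\<integral>x. \<Phi> x \<partial>gauss)) \<partial>gauss)"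
  proof (rule integral_dominated_convergence[where w="\<lambda>_. 1"])
    have th: "tame h" by (rule tameI[OF h(1), of 1 0]) (use h in simp)
    have "tame (\<lambda>x. h (\<Phi> x - (\<integral>x. \<Phi> x \<partial>gauss)))" "tame (\<lambda>x. h (\<Psi> n x - (\<integral>x. \<Psi> n x \<partial>gauss)))" for n
      by (rule tame_comp[OF th], intro tame_intros t\<Phi> t\<Psi>)+
    from this[THEN tameD_measurable]
    show "(\<lambda>x. h (\<Phi> x - (\<integral>x. \<Phi> x \<partial>gauss))) \<in> borel_measurable gauss"
      "(\<lambda>x. h (\<Psi> n x - (\<integral>x. \<Psi> n x \<partial>gauss))) \<in> borel_measurable gauss" for n
      by simp_all
    have "isCont h t" for t using h(1) continuous_on_eq_continuous_at by blast
    then show "AE x in gauss. (\<lambda>n. h (\<Psi> n x - (\<integral>x. \<Psi> n x \<partial>gauss))) \<longlonglongrightarrow> h (\<Phi> x - (\<integral>x. \<Phi> x \<partial>gauss))"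
      by (intro AE_I2 isCont_tendsto_compose[of _ h] tendsto_diff lim)
  qed (use h in auto)
  then have "(\<lambda>n. \<bar>(\<integral>x. h (\<Psi> n x - (\<integral>x. \<Psi> n x \<partial>gauss)) \<partial>gauss) - ?N\<bar>)
      \<longlonglongrightarrow> \<bar>(\<integral>x. h (\<Phi> x - (\<integral>x. \<Phi> x \<partial>gauss)) \<partial>gauss) - ?N\<bar>"
    by (intro tendsto_intros)
  moreover have "(\<lambda>n. 2 / s\<^sup>2 * \<bar>s\<^sup>2 - gauss_variance (\<Psi> n)\<bar> + ?D / s\<^sup>2)
      \<longlonglongrightarrow> 2 / s\<^sup>2 * \<bar>s\<^sup>2 - gauss_variance \<Phi>\<bar> + ?D / s\<^sup>2"
    by (intro tendsto_intros lim)
  ultimately have "\<bar>(\<integral>x. h (\<Phi> x - (\<integral>x. \<Phi> x \<partial>gauss)) \<partial>gauss) - ?N\<bar>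
      \<le> 2 / s\<^sup>2 * \<bar>s\<^sup>2 - gauss_variance \<Phi>\<bar> + ?D / s\<^sup>2"
    by (rule LIMSEQ_le) (use bound in auto)
  also have "\<dots> = 4 / s\<^sup>2 * (3 * sqrt (\<integral>x. (P x)\<^sup>2 \<partial>gauss) + 8 * norm \<mu> * (\<integral>x. P x \<partial>gauss) + 4 * (norm \<mu>)\<^sup>2)"
    using s by (simp add: field_simps)
  finally show ?thesis .
qed

text \<open>The second inequality is the triangle inequality in the space of square integrable vector fields.\<close>

lemma norm_projection_moments:
  fixes p :: "'a::euclidean_space \<Rightarrow> 'b::euclidean_space" and \<mu> :: 'b
  assumes "tame p"
  shows "(\<integral>x. norm (p x) \<partial>gauss) \<le> sqrt (\<integral>x. (norm (p x))\<^sup>2 \<partial>gauss)"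
    and "sqrt (\<integral>x. (norm (p x))\<^sup>2 \<partial>gauss) \<le> sqrt (\<integral>x. (norm (\<mu> - p x))\<^sup>2 \<partial>gauss) + norm \<mu>"
proof -
  note int = gauss_integrable tame_intros assms
  show "(\<integral>x. norm (p x) \<partial>gauss) \<le> sqrt (\<integral>x. (norm (p x))\<^sup>2 \<partial>gauss)"
    using integral_abs_le_sqrt[OF tame_norm[OF assms]] by simp
  let ?m = "\<integral>x. (norm (\<mu> - p x))\<^sup>2 \<partial>gauss"
  have m0: "?m \<ge> 0" by simp
  have "(\<integral>x. (norm (p x))\<^sup>2 \<partial>gauss) \<le> (\<integral>x. (norm (\<mu> - p x))\<^sup>2 + (2 * norm \<mu> * norm (\<mu> - p x) + (norm \<mu>)\<^sup>2) \<partial>gauss)"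
  proof (rule integral_mono)
    fix x
    have "norm (p x) \<le> norm (\<mu> - p x) + norm \<mu>"
      using norm_triangle_ineq4[of \<mu> "\<mu> - p x"] by simp
    then have "(norm (p x))\<^sup>2 \<le> (norm (\<mu> - p x) + norm \<mu>)\<^sup>2" by (intro power_mono) auto
    then show "(norm (p x))\<^sup>2 \<le> (norm (\<mu> - p x))\<^sup>2 + (2 * norm \<mu> * norm (\<mu> - p x) + (norm \<mu>)\<^sup>2)"
      by (simp add: power2_sum algebra_simps)
  qed (intro int)+
  also have "\<dots> = ?m + (2 * norm \<mu> * (\<integral>x. norm (\<mu> - p x) \<partial>gauss) + (norm \<mu>)\<^sup>2)"
    by (subst Bochner_Integration.integral_add, (intro int)+,
        subst Bochner_Integration.integral_add, (intro int)+) simp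
  also have "\<dots> \<le> ?m + (2 * norm \<mu> * sqrt ?m + (norm \<mu>)\<^sup>2)"
  proof -
    have "(\<integral>x. norm (\<mu> - p x) \<partial>gauss) \<le> sqrt ?m"
      using integral_abs_le_sqrt[of "\<lambda>x. norm (\<mu> - p x)"] by (simp add: tame_intros assms)
    then show ?thesis by (intro add_left_mono add_right_mono mult_left_mono) auto
  qed
  also have "\<dots> = (sqrt ?m + norm \<mu>)\<^sup>2"
    using m0 by (simp add: power2_sum algebra_simps)
  finally show "sqrt (\<integral>x. (norm (p x))\<^sup>2 \<partial>gauss) \<le> sqrt ?m + norm \<mu>"
    using m0 by (intro real_le_lsqrt) auto
qed

theorem theorem3p1:
  fixes C :: "(real ^ 'd) set"
    and \<mu> :: "real ^ 'd"
    and M :: "'w measure" and g :: "'w \<Rightarrow> real ^ 'd" and F :: "'w \<Rightarrow> real"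
    and M' :: "'v measure" and N :: "'v \<Rightarrow> real"
    and m \<sigma> :: real
  assumes "C \<noteq> {}" and "C \<noteq> UNIV" and "closed C" and "positive_convex_cone C"
    and "prob_space M"
    and "distributed M lborel g (\<lambda>x. ennreal (std_gaussian_density x))"
    and "m = prob_space.expectation M (\<lambda>\<omega>. (norm (\<mu> - closest_point C (g \<omega> + \<mu>)))\<^sup>2)"
    and "F = (\<lambda>\<omega>. (norm (\<mu> - closest_point C (g \<omega> + \<mu>)))\<^sup>2 - m)"
    and "\<sigma>\<^sup>2 = prob_space.variance M F"
    and "prob_space M'"
    and "N \<in> borel_measurable M'"
    and "distr M' borel N = normal_law 0 (\<sigma>\<^sup>2)"
  shows "tv_distance M F M' N
           \<le> 16 / \<sigma>\<^sup>2 * (sqrt (prob_space.expectation M (\<lambda>\<omega>. (norm (closest_point C (g \<omega> + \<mu>)))\<^sup>2))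
                       + 2 * sqrt m * norm \<mu> + 3 * (norm \<mu>)\<^sup>2)
       \<and> 16 / \<sigma>\<^sup>2 * (sqrt (prob_space.expectation M (\<lambda>\<omega>. (norm (closest_point C (g \<omega> + \<mu>)))\<^sup>2))
                       + 2 * sqrt m * norm \<mu> + 3 * (norm \<mu>)\<^sup>2)
           \<le> 16 / \<sigma>\<^sup>2 * (sqrt m * (1 + 2 * norm \<mu>) + 3 * (norm \<mu>)\<^sup>2 + norm \<mu>)"
proof -
  note C = assms(4,3,1)
  let ?p = "\<lambda>x. closest_point C (x + \<mu>)"
  let ?\<Phi> = "\<lambda>x. (norm (\<mu> - ?p x))\<^sup>2"
  let ?\<delta> = "\<integral>x. (norm (?p x))\<^sup>2 \<partial>gauss"
  have tp: "tame ?p"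
    by (rule tame_lipschitz[of _ 1]) (use cone_projection_lipschitz[OF C, of "_ + \<mu>" "_ + \<mu>"] in simp)
  have t\<Phi>: "tame ?\<Phi>" by (intro tame_intros tp)
  have gm: "g \<in> measurable M borel" using distributed_measurable[OF assms(6)] by simp
  have law: "distr M borel g = gauss"
  proof -
    have "distr M borel g = distr M lborel g" by (rule distr_cong) auto
    also have "\<dots> = gauss"
      unfolding distributed_distr_eq_density[OF assms(6)] gauss_def std_gaussian_density_eq ..
    finally show ?thesis .
  qed
  have expect: "(\<integral>\<omega>. f (g \<omega>) \<partial>M) = (\<integral>x. f x \<partial>gauss)" if "tame f" for f :: "real ^ 'd \<Rightarrow> real"
    unfolding law[symmetric] by (rule integral_distr[OF gm tameD_measurable[OF that], symmetric])
  have m: "m = (\<integral>x. ?\<Phi> x \<partial>gauss)" unfolding assms(7) by (rule expect[OF t\<Phi>])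
  have \<delta>: "(\<integral>\<omega>. (norm (?p (g \<omega>)))\<^sup>2 \<partial>M) = ?\<delta>"
    by (rule expect) (intro tame_intros tp)
  have F: "F = (\<lambda>\<omega>. (\<lambda>x. ?\<Phi> x - m) (g \<omega>))" unfolding assms(8) by simp
  have tF: "tame (\<lambda>x. ?\<Phi> x - m)" by (intro tame_intros tp)
  have Fm: "F \<in> borel_measurable M"
    unfolding F by (rule measurable_compose[OF gm tameD_measurable[OF tF]])
  have EF: "integral\<^sup>L M F = 0"
    unfolding F expect[OF tF]
    by (subst Bochner_Integration.integral_diff) (auto intro!: gauss_integrable tame_intros tp simp: m)
  have \<sigma>F: "\<sigma>\<^sup>2 = (\<integral>\<omega>. (F \<omega>)\<^sup>2 \<partial>M)" unfolding assms(9) EF by simp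
  have tF2: "tame (\<lambda>x. (?\<Phi> x - m)\<^sup>2)" by (intro tame_intros tp)
  have var: "\<sigma>\<^sup>2 = gauss_variance ?\<Phi>"
  proof -
    have "\<sigma>\<^sup>2 = (\<integral>x. (?\<Phi> x - m)\<^sup>2 \<partial>gauss)"
      unfolding \<sigma>F F using expect[OF tF2] by simp
    then show ?thesis unfolding m using gauss_variance_centred[OF t\<Phi>] by simp
  qed
  have m0: "m \<ge> 0" unfolding m by simp
  note mom = norm_projection_moments(1)[OF tp] norm_projection_moments(2)[OF tp, of \<mu>, folded m]
  have second: "16 / \<sigma>\<^sup>2 * (sqrt ?\<delta> + 2 * sqrt m * norm \<mu> + 3 * (norm \<mu>)\<^sup>2)
      \<le> 16 / \<sigma>\<^sup>2 * (sqrt m * (1 + 2 * norm \<mu>) + 3 * (norm \<mu>)\<^sup>2 + norm \<mu>)"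
    using mom(2) by (intro mult_left_mono) (auto simp: algebra_simps)
  have "tv_distance M F M' N \<le> 16 / \<sigma>\<^sup>2 * (sqrt ?\<delta> + 2 * sqrt m * norm \<mu> + 3 * (norm \<mu>)\<^sup>2)"
  proof (rule tv_distance_le[OF assms(5) Fm assms(10,11)])
    fix h :: "real \<Rightarrow> real"
    assume h: "continuous_on UNIV h" "\<And>x. 0 \<le> h x" "\<And>x. h x \<le> 1"
    show "\<bar>(\<integral>\<omega>. h (F \<omega>) \<partial>M) - (\<integral>x. h x \<partial>distr M' borel N)\<bar>
      \<le> 16 / \<sigma>\<^sup>2 * (sqrt ?\<delta> + 2 * sqrt m * norm \<mu> + 3 * (norm \<mu>)\<^sup>2)"
    proof (cases "\<sigma>\<^sup>2 = 0")
      case True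
      \<comment> \<open>a vanishing variance forces the functional to be constant; integrability excludes the default value 0 of the integral\<close>
      have "integrable M (\<lambda>\<omega>. (F \<omega>)\<^sup>2)"
      proof -
        have "integrable (distr M borel g) (\<lambda>x. (?\<Phi> x - m)\<^sup>2)"
          unfolding law by (rule gauss_integrable[OF tF2])
        then show ?thesis
          unfolding F by (subst (asm) integrable_distr_eq[OF gm tameD_measurable[OF tF2]])
      qed
      then have "AE \<omega> in M. (F \<omega>)\<^sup>2 = 0"
        using integral_nonneg_eq_0_iff_AE[of M "\<lambda>\<omega>. (F \<omega>)\<^sup>2"] True \<sigma>F by simp
      then have "AE \<omega> in M. h (F \<omega>) = h 0" by eventually_elim simp
      then have "(\<integral>\<omega>. h (F \<omega>) \<partial>M) = (\<integral>\<omega>. h 0 \<partial>M)"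
        using measurable_compose[OF Fm borel_measurable_continuous_onI[OF h(1)]]
        by (intro integral_cong_AE) auto
      also have "\<dots> = h 0" by (simp add: prob_space.prob_space[OF assms(5)])
      finally have "(\<integral>\<omega>. h (F \<omega>) \<partial>M) = h 0" .
      moreover have "(\<integral>x. h x \<partial>distr M' borel N) = h 0"
        unfolding assms(12) normal_law_def using True borel_measurable_continuous_onI[OF h(1)]
        by (simp add: integral_return)
      ultimately show ?thesis using True by simp
    next
      case False
      define s where "s = sqrt (\<sigma>\<^sup>2)"
      have s: "s > 0" "s\<^sup>2 = \<sigma>\<^sup>2" using False by (auto simp: s_def)
      have th: "tame (\<lambda>x. h (?\<Phi> x - m))"
        by (rule tame_comp[OF tameI[OF h(1), of 1 0] tF]) (use h in simp)
      have "(\<integral>\<omega>. h (F \<omega>) \<partial>M) = (\<integral>x. h (?\<Phi> x - m) \<partial>gauss)"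
        unfolding F using expect[OF th] by simp
      moreover have "distr M' borel N = density lborel (\<lambda>t. ennreal (normal_density 0 s t))"
        unfolding assms(12) normal_law_def s_def using False by simp
      ultimately have "\<bar>(\<integral>\<omega>. h (F \<omega>) \<partial>M) - (\<integral>x. h x \<partial>distr M' borel N)\<bar>
          \<le> 4 / \<sigma>\<^sup>2 * (3 * sqrt ?\<delta> + 8 * norm \<mu> * (\<integral>x. norm (?p x) \<partial>gauss) + 4 * (norm \<mu>)\<^sup>2)"
        using cone_statistic_test_bound[OF C h, where \<mu>=\<mu> and s=s] s var unfolding m by simp
      also have "\<dots> \<le> 4 / \<sigma>\<^sup>2 * (4 * (sqrt ?\<delta> + 2 * sqrt m * norm \<mu> + 3 * (norm \<mu>)\<^sup>2))"
      proof (intro mult_left_mono)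
        have "norm \<mu> * (\<integral>x. norm (?p x) \<partial>gauss) \<le> norm \<mu> * (sqrt m + norm \<mu>)"
          using mom by (intro mult_left_mono) auto
        then have mix: "norm \<mu> * (\<integral>x. norm (?p x) \<partial>gauss) \<le> sqrt m * norm \<mu> + (norm \<mu>)\<^sup>2"
          by (simp add: algebra_simps power2_eq_square)
        have "3 * d + 8 * u + 4 * q \<le> 4 * (d + 2 * v + 3 * q)"
          if "u \<le> v + q" "0 \<le> d" for d u v q :: real
          using that by (simp add: algebra_simps)
        from this[OF mix, of "sqrt ?\<delta>"] show "3 * sqrt ?\<delta> + 8 * norm \<mu> * (\<integral>x. norm (?p x) \<partial>gauss) + 4 * (norm \<mu>)\<^sup>2
            \<le> 4 * (sqrt ?\<delta> + 2 * sqrt m * norm \<mu> + 3 * (norm \<mu>)\<^sup>2)"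
          by (simp add: mult.assoc)
      qed simp
      finally show ?thesis by simp
    qed
  qed
  with second show ?thesis unfolding \<delta> by blast
qed

end
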